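(* Let $\tilde Z(s,z,c,[\gamma])$ be the analytic continuation of the Lerch transcendent to the universal cover $\tilde{\mathcal N}$ (see context). (1) $\tilde Z$ satisfies $\left(z\frac{\partial}{\partial z}+c\right)\tilde Z(s,z,c,[\gamma])=\tilde Z(s-1,z,c,[\gamma_-])$ and $\frac{\partial}{\partial c}\tilde Z(s,z,c,[\gamma])=-s\,\tilde Z(s+1,z,c,[\gamma_+])$, where $\gamma_\pm$ is the path that first traverses $\gamma$ and then, from its endpoint, a path changing only the $s$-variable from $s$ to $s\pm1$. (2) $\tilde Z$ satisfies on $\tilde{\mathcal N}$ the linear partial differential equation $\left(z\frac{\partial}{\partial z}\frac{\partial}{\partial c}+c\frac{\partial}{\partial c}\right)\tilde Z(s,z,c,[\gamma])=-s\,\tilde Z(s,z,c,[\gamma])$. (3) For each $[\tau]\in\pi_1(\mathcal N,x_0')$ the monodromy function $M_{[\tau]}(\tilde Z)$ satisfies on $\tilde{\mathcal N}$ the same two differential-difference equations and the same linear partial differential equation.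
   Context: $\Phi(s,z,c)=\sum_{n\ge0}z^n(n+c)^{-s}$ (principal branch powers), holomorphic for $\Re s>1$, $|z|<1$, $0<\Re c<1$. $\mathcal N=\mathbb C\times(\mathbb P^1(\mathbb C)\setminus\{0,1,\infty\})\times(\mathbb C\setminus\mathbb Z)$, base point $x_0'=(\tfrac12,-1,\tfrac12)$. $\Phi$ extends to a single-valued holomorphic function on the simply connected domain $\mathcal D=\mathbb C\times(\mathbb C\setminus\mathbb R_{\ge0})\times\{0<\Re c<1\}\ni x_0'$ and continues analytically along all paths in $\mathcal N$; points of $\tilde{\mathcal N}$ are homotopy classes $[\gamma]$ of paths from $x_0'$, with endpoint $\gamma(1)=(s,z,c)$, and $\tilde Z([\gamma])$ is the value at $\gamma(1)$ of the continuation along $\gamma$ of the germ at $x_0'$. For $[\tau]\in\pi_1(\mathcal N,x_0')$, $M_{[\tau]}(f)([\gamma])=f([\tau\gamma])-f([\gamma])$, where $\tau\gamma$ means first $\tau$, then $\gamma$. *)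

theory Defs
  imports "HOL-Analysis.Analysis"
begin

type_synonym pt = "complex \<times> complex \<times> complex"   (* (s, z, c) *)

definition NN :: "pt set" where
  "NN = {(s, z, c). z \<noteq> 0 \<and> z \<noteq> 1 \<and> c \<notin> \<int>}"

definition x0 :: pt where
  "x0 = (1/2, -1, 1/2)"

definition DD :: "pt set" where
  "DD = {(s, z, c). \<not> (Im z = 0 \<and> Re z \<ge> 0) \<and> 0 < Re c \<and> Re c < 1}"

text \<open>Domain of convergence of the defining series.\<close>
definition RR :: "pt set" where
  "RR = {(s, z, c). 1 < Re s \<and> norm z < 1 \<and> 0 < Re c \<and> Re c < 1}"

definition Phi_series :: "pt \<Rightarrow> complex" where
  "Phi_series x = (case x of (s, z, c) \<Rightarrow> (\<Sum>n. z ^ n * (of_nat n + c) powr (- s)))"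

definition holo3 :: "(pt \<Rightarrow> complex) \<Rightarrow> pt set \<Rightarrow> bool" where
  "holo3 f U \<longleftrightarrow> open U \<and> (\<forall>x\<in>U. \<exists>a b d. (f has_derivative
      (\<lambda>y. a * fst y + b * fst (snd y) + d * snd (snd y))) (at x))"

definition PhiD :: "pt \<Rightarrow> complex" where
  "PhiD = (SOME F. holo3 F DD \<and> (\<forall>x\<in>DD \<inter> RR. F x = Phi_series x))"

text \<open>Analytic continuation along a path g (parametrised on [0,1]) of the germ of F
  at g 0, ending with value v at g 1: a family of function elements (f t, U t).\<close>
definition cont_along :: "(pt \<Rightarrow> complex) \<Rightarrow> (real \<Rightarrow> pt) \<Rightarrow> complex \<Rightarrow> bool" where
  "cont_along F g v \<longleftrightarrow> (\<exists>f U.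
     (\<forall>t\<in>{0..1}. holo3 (f t) (U t) \<and> g t \<in> U t) \<and>
     (\<forall>t\<in>{0..1}. \<exists>\<delta>>0. \<forall>t'\<in>{0..1}. \<bar>t' - t\<bar> < \<delta> \<longrightarrow>
         g t' \<in> U t \<and> (\<exists>e>0. \<forall>y\<in>ball (g t') e. y \<in> U t \<and> y \<in> U t' \<and> f t y = f t' y)) \<and>
     (\<exists>e>0. \<forall>y\<in>ball (g 0) e. f 0 y = F y) \<and>
     v = f 1 (g 1))"

text \<open>Admissible paths: paths in N from the base point; they represent points of the
  universal cover.\<close>
definition adm :: "(real \<Rightarrow> pt) \<Rightarrow> bool" where
  "adm g \<longleftrightarrow> path g \<and> path_image g \<subseteq> NN \<and> pathstart g = x0"

definition Ztilde :: "(real \<Rightarrow> pt) \<Rightarrow> complex" where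
  "Ztilde g = (THE v. cont_along PhiD g v)"

definition ext :: "(real \<Rightarrow> pt) \<Rightarrow> pt \<Rightarrow> (real \<Rightarrow> pt)" where
  "ext g d = g +++ linepath (pathfinish g) (pathfinish g + d)"

text \<open>Partial derivatives of functions on the universal cover (via local lifts).\<close>
definition Dz :: "((real \<Rightarrow> pt) \<Rightarrow> complex) \<Rightarrow> (real \<Rightarrow> pt) \<Rightarrow> complex" where
  "Dz G g = deriv (\<lambda>h. G (ext g (0, h, 0))) 0"

definition Dc :: "((real \<Rightarrow> pt) \<Rightarrow> complex) \<Rightarrow> (real \<Rightarrow> pt) \<Rightarrow> complex" where
  "Dc G g = deriv (\<lambda>h. G (ext g (0, 0, h))) 0"

definition satisfies_system :: "((real \<Rightarrow> pt) \<Rightarrow> complex) \<Rightarrow> bool" where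
  "satisfies_system G \<longleftrightarrow> (\<forall>g. adm g \<longrightarrow>
     (case pathfinish g of (s, z, c) \<Rightarrow>
        (\<lambda>h. G (ext g (0, h, 0))) field_differentiable (at 0) \<and>
        (\<lambda>h. G (ext g (0, 0, h))) field_differentiable (at 0) \<and>
        (\<lambda>h. Dc G (ext g (0, h, 0))) field_differentiable (at 0) \<and>
        z * Dz G g + c * G g = G (ext g (-1, 0, 0)) \<and>
        Dc G g = - s * G (ext g (1, 0, 0)) \<and>
        z * Dz (Dc G) g + c * Dc G g = - s * G g))"

definition Mono :: "(real \<Rightarrow> pt) \<Rightarrow> ((real \<Rightarrow> pt) \<Rightarrow> complex) \<Rightarrow> (real \<Rightarrow> pt) \<Rightarrow> complex" where
  "Mono tau G g = G (tau +++ g) - G g"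

end

theory Submission
  imports Defs "HOL-Complex_Analysis.Complex_Analysis" "HOL-Real_Asymp.Real_Asymp"
begin

text \<open>
  For \<open>Re s > 1\<close> and \<open>Re c > 2\<close> the Lerch function is
  \<open>1/\<Gamma>(s) \<integral>\<^sub>0\<^sup>1 (- ln v)^(s - 1) v^(c - 1) / (1 - z v) dv\<close>, which is holomorphic off the cut \<open>z \<ge> 1\<close>.
  The relation \<open>(z \<partial>/\<partial>z + c) \<Phi>(s + 1) = \<Phi>(s)\<close> extends it to all \<open>s\<close>, and
  \<open>\<Phi>(s,z,c) = \<Sum>k<m. z^k (c + k)^(-s) + z^m \<Phi>(s,z,c + m)\<close> moves any path in \<open>c\<close> into the half-plane
  \<open>Re c > 2\<close>. Removing the pole of the integrand at \<open>v = 1/z\<close> shows that crossing the cut in \<open>z\<close> adds a multiple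
  of \<open>(log z)^(s - 1) z^(-c) / \<Gamma>(s)\<close>. Hence any two local branches differ by a sum of germs
  \<open>(log z)^(s - 1) z^(-c) / \<Gamma>(s)\<close> and \<open>z^k (c + k)^(-s)\<close>, which continue along every path, and so does \<open>\<Phi>\<close>.
  All function elements are entire in \<open>s\<close>, so the shifts \<open>s \<mapsto> s \<plusminus> 1\<close> act on them, and the
  equations, valid at the base point, persist along paths by the identity theorem; being linear, they pass to
  the monodromy functions.
\<close>

section \<open>Holomorphic functions of three variables\<close>

text \<open>The region \<open>Re s > 1\<close>, \<open>Re c > 2\<close> is chosen so that the kernel
  extends continuously by 0 to both ends of the unit interval. Every integral then has a continuous
  integrand on a compact interval, and parameter theorems apply without improper integrals. The
  price is a small domain, recovered by steps in s and shifts in c.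

  The equations couple s with s - 1 and s + 1, so they do not concern germs at a single point
  (s,z,c). Function elements therefore live on cylinders, the whole s-plane times an open set of
  pairs (z,c), and germs at a pair (z,c) are compared for all s at once. A path then acts only
  through its (z,c)-projection.

  No monodromy is computed and no homotopy of paths enters. It suffices that the class of germs of
  the form \<open>chosen local branch plus jump germ\<close> extends from any point of a box to the
  whole box and is kept there. The shift of c depends on the path, whose compactness bounds Re c
  from below.

  \<open>Ztilde\<close> is a definite description over arbitrary function elements, so uniqueness is
  proved for arbitrary elements, while existence produces cylinders.\<close>

lemma holomorphic_onI_at: "(\<And>w. w \<in> S \<Longrightarrow> f field_differentiable at w) \<Longrightarrow> f holomorphic_on S"
  by (simp add: holomorphic_on_def field_differentiable_at_within)

text \<open>Cauchy's formula with the contour integral unfolded to a real integral over the unit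
  interval, the form that results on parameter integrals can use.\<close>

lemma deriv_circle_integral:
  assumes "continuous_on (cball w0 R) f" "f holomorphic_on ball w0 R" "w \<in> ball w0 R"
  shows "deriv f w = 1 / (2 * of_real pi * \<i>) *
    integral {0..1} (\<lambda>t. f (circlepath w0 R t) / (circlepath w0 R t - w)\<^sup>2 *
      (2 * of_real pi * \<i> * of_real R * exp (2 * of_real pi * \<i> * of_real t)))"
  using DERIV_imp_deriv[OF Cauchy_derivative_integral_circlepath(2)[OF assms]]
  unfolding contour_integral_integral vector_derivative_circlepath by simp

lemma continuous_on_circlepath [continuous_intros]:
  "continuous_on A f \<Longrightarrow> continuous_on A (\<lambda>x. circlepath w R (f x))"
  unfolding circlepath by (intro continuous_intros)

lemma circlepath_in_cball: "0 < R \<Longrightarrow> circlepath w R t \<in> cball w R"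
  by (simp add: circlepath dist_norm norm_mult)

lemma circlepath_neq: "w \<in> ball w0 R \<Longrightarrow> circlepath w0 R t \<noteq> w"
  by (auto simp: circlepath dist_norm norm_mult)

text \<open>The derivative is an integral of \<open>K\<close> over a fixed circle, so joint
  continuity of \<open>K\<close> carries over to it. The closed disc in the hypothesis contains that
  circle.\<close>

lemma deriv_param_continuous:
  fixes K :: "complex \<Rightarrow> 'p::topological_space \<Rightarrow> complex"
  assumes cont: "continuous_on (cball w0 R \<times> P) (\<lambda>(w,p). K w p)"
    and hol: "\<And>p. p \<in> P \<Longrightarrow> (\<lambda>w. K w p) holomorphic_on ball w0 R"
  shows "continuous_on (ball w0 R \<times> P) (\<lambda>(w,p). deriv (\<lambda>w. K w p) w)"
proof (cases "R > 0")
  case False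
  then show ?thesis by (simp add: ball_empty)
next
  case R: True
  define \<Theta> where "\<Theta> = (\<lambda>(x::complex \<times> 'p) (t::real). K (circlepath w0 R t) (snd x) / (circlepath w0 R t - fst x)\<^sup>2 *
      (2 * of_real pi * \<i> * of_real R * exp (2 * of_real pi * \<i> * of_real t)))"
  have c1: "continuous_on ((ball w0 R \<times> P) \<times> cbox 0 1) (\<lambda>y. (\<lambda>(w,p). K w p) (circlepath w0 R (snd y), snd (fst y)))"
    by (rule continuous_on_compose2[OF cont], intro continuous_intros) (use circlepath_in_cball[OF R] in auto)
  have c2: "continuous_on ((ball w0 R \<times> P) \<times> cbox 0 1) (\<lambda>(x,t). \<Theta> x t)"
    unfolding \<Theta>_def split_beta
    using c1 by (intro continuous_intros) (auto simp: circlepath_neq split_beta)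
  have "continuous_on (ball w0 R \<times> P) (\<lambda>x. 1 / (2 * of_real pi * \<i>) * integral (cbox 0 1) (\<Theta> x))"
    by (intro continuous_intros integral_continuous_on_param c2)
  moreover have "(case x of (w,p) \<Rightarrow> deriv (\<lambda>w. K w p) w) = 1 / (2 * of_real pi * \<i>) * integral (cbox 0 1) (\<Theta> x)"
    if mem: "x \<in> ball w0 R \<times> P" for x
  proof -
    obtain w p where x: "x = (w,p)" "w \<in> ball w0 R" "p \<in> P" using mem by auto
    have "continuous_on (cball w0 R) (\<lambda>w. (\<lambda>(w,p). K w p) (w,p))"
      by (rule continuous_on_compose2[OF cont], intro continuous_intros) (use x in auto)
    then show ?thesis
      using deriv_circle_integral[of w0 R "\<lambda>w. K w p" w] hol x by (simp add: \<Theta>_def)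
  qed
  ultimately show ?thesis
    by (metis (mono_tags, lifting) continuous_on_cong)
qed

lemma open_pt_box:
  assumes "open (U :: pt set)" "(s,z,c) \<in> U"
  obtains r where "r > 0" "\<forall>x\<in>cball s r. \<forall>y\<in>cball z r. \<forall>w\<in>cball c r. (x,y,w) \<in> U"
proof -
  obtain A B where AB: "open A" "open B" "s \<in> A" "(z,c) \<in> B" "A \<times> B \<subseteq> U"
    using assms open_prod_elim by (metis mem_Sigma_iff)
  obtain C D where CD: "open C" "open D" "z \<in> C" "c \<in> D" "C \<times> D \<subseteq> B"
    using AB open_prod_elim by (metis mem_Sigma_iff)
  obtain r1 where "r1 > 0" "cball s r1 \<subseteq> A" using AB open_contains_cball by blast
  moreover obtain r2 where "r2 > 0" "cball z r2 \<subseteq> C" using CD open_contains_cball by blast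
  moreover obtain r3 where "r3 > 0" "cball c r3 \<subseteq> D" using CD open_contains_cball by blast
  ultimately have "min r1 (min r2 r3) > 0"
    "\<forall>x\<in>cball s (min r1 (min r2 r3)). \<forall>y\<in>cball z (min r1 (min r2 r3)). \<forall>w\<in>cball c (min r1 (min r2 r3)). (x,y,w) \<in> U"
    using AB CD by (auto simp: subset_iff)
  then show thesis by (rule that)
qed

lemma holo3_open: "holo3 f U \<Longrightarrow> open U"
  by (simp add: holo3_def)

lemma holo3_continuous_on: "holo3 f U \<Longrightarrow> continuous_on U f"
  unfolding holo3_def by (meson continuous_at_imp_continuous_on has_derivative_continuous)

text \<open>Chain rule along a curve \<open>g\<close> with one complex parameter. It reduces three
  variables to one; the curves used later are coordinate lines, their translates and general complex
  lines.\<close>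

lemma holo3_line:
  assumes "holo3 f U" "x \<in> U"
    and g: "g w = x" "((\<lambda>w. fst (g w)) has_field_derivative g1) (at w)"
      "((\<lambda>w. fst (snd (g w))) has_field_derivative g2) (at w)"
      "((\<lambda>w. snd (snd (g w))) has_field_derivative g3) (at w)"
  shows "(\<lambda>w. f (g w)) field_differentiable at w"
proof -
  obtain a b d where abd: "(f has_derivative
      (\<lambda>y. a * fst y + b * fst (snd y) + d * snd (snd y))) (at (g w))"
    using assms unfolding holo3_def by blast
  have "((\<lambda>w. (fst (g w), fst (snd (g w)), snd (snd (g w)))) has_derivative (\<lambda>h. (g1*h, g2*h, g3*h))) (at w)"
    using g(2-) unfolding has_field_derivative_def by (intro has_derivative_Pair)
  then have "(g has_derivative (\<lambda>h. (g1*h, g2*h, g3*h))) (at w)" by simp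
  from diff_chain_at[OF this abd] have "((\<lambda>w. f (g w)) has_derivative (\<lambda>h. (a*g1 + b*g2 + d*g3) * h)) (at w)"
    by (simp add: o_def algebra_simps)
  then show ?thesis
    unfolding field_differentiable_def has_field_derivative_def by blast
qed

lemma holo3_fd:
  assumes "holo3 f U" "(s,z,c) \<in> U"
  shows "(\<lambda>w. f (w,z,c)) field_differentiable at s"
    "(\<lambda>w. f (s,w,c)) field_differentiable at z"
    "(\<lambda>w. f (s,z,w)) field_differentiable at c"
proof -
  note * = holo3_line[OF assms]
  show "(\<lambda>w. f (w,z,c)) field_differentiable at s"
    by (rule *[where ?g = "\<lambda>w. (w,z,c)"]) (auto intro!: derivative_eq_intros)
  show "(\<lambda>w. f (s,w,c)) field_differentiable at z"
    by (rule *[where ?g = "\<lambda>w. (s,w,c)"]) (auto intro!: derivative_eq_intros)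
  show "(\<lambda>w. f (s,z,w)) field_differentiable at c"
    by (rule *[where ?g = "\<lambda>w. (s,z,w)"]) (auto intro!: derivative_eq_intros)
qed

text \<open>Osgood's lemma: the Cauchy integral formula makes the partial derivatives jointly continuous.\<close>

lemma holo3I:
  assumes U: "open U" and cont: "continuous_on U f"
    and d1: "\<And>s z c. (s,z,c) \<in> U \<Longrightarrow> (\<lambda>w. f (w,z,c)) field_differentiable at s"
    and d2: "\<And>s z c. (s,z,c) \<in> U \<Longrightarrow> (\<lambda>w. f (s,w,c)) field_differentiable at z"
    and d3: "\<And>s z c. (s,z,c) \<in> U \<Longrightarrow> (\<lambda>w. f (s,z,w)) field_differentiable at c"
  shows "holo3 f U"
proof -
  have "\<exists>a b d. (f has_derivative (\<lambda>y. a * fst y + b * fst (snd y) + d * snd (snd y))) (at (s,z,c))"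
    if mem: "(s,z,c) \<in> U" for s z c
  proof -
    obtain r where r: "r > 0" "\<forall>x\<in>cball s r. \<forall>y\<in>cball z r. \<forall>w\<in>cball c r. (x,y,w) \<in> U"
      using open_pt_box[OF U mem] .
    define Dz where "Dz = (\<lambda>(s,z,c). deriv (\<lambda>w. f (s,w,c)) z)"
    define Dc where "Dc = (\<lambda>(s,z,c). deriv (\<lambda>w. f (s,z,w)) c)"
    \<comment> \<open>The coordinates are reordered so that the variable to be differentiated comes
      first; the next step permutes them back.\<close>
    have "continuous_on (ball z r \<times> (ball s r \<times> ball c r)) (\<lambda>(w,p). deriv (\<lambda>w. f (fst p, w, snd p)) w)"
    proof (rule deriv_param_continuous)
      show "continuous_on (cball z r \<times> ball s r \<times> ball c r) (\<lambda>(w, p). f (fst p, w, snd p))"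
        unfolding split_beta
        by (rule continuous_on_compose2[OF cont], intro continuous_intros) (use r in auto)
      show "(\<lambda>w. f (fst p, w, snd p)) holomorphic_on ball z r" if "p \<in> ball s r \<times> ball c r" for p
        by (intro holomorphic_onI_at d2) (use r that in auto)
    qed
    then have "continuous_on (ball s r \<times> ball z r \<times> ball c r) (\<lambda>x. (\<lambda>(w,p). deriv (\<lambda>w. f (fst p, w, snd p)) w) (fst (snd x), fst x, snd (snd x)))"
      by (rule continuous_on_compose2, intro continuous_intros) auto
    then have cz: "continuous_on (ball s r \<times> ball z r \<times> ball c r) Dz"
      by (simp add: Dz_def split_beta)
    have "continuous_on (ball c r \<times> (ball s r \<times> ball z r)) (\<lambda>(w,p). deriv (\<lambda>w. f (fst p, snd p, w)) w)"
    proof (rule deriv_param_continuous)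
      show "continuous_on (cball c r \<times> ball s r \<times> ball z r) (\<lambda>(w, p). f (fst p, snd p, w))"
        unfolding split_beta
        by (rule continuous_on_compose2[OF cont], intro continuous_intros) (use r in auto)
      show "(\<lambda>w. f (fst p, snd p, w)) holomorphic_on ball c r" if "p \<in> ball s r \<times> ball z r" for p
        by (intro holomorphic_onI_at d3) (use r that in auto)
    qed
    then have "continuous_on (ball s r \<times> ball z r \<times> ball c r) (\<lambda>x. (\<lambda>(w,p). deriv (\<lambda>w. f (fst p, snd p, w)) w) (snd (snd x), fst x, fst (snd x)))"
      by (rule continuous_on_compose2, intro continuous_intros) auto
    then have cc: "continuous_on (ball s r \<times> ball z r \<times> ball c r) Dc"
      by (simp add: Dc_def split_beta)
    \<comment> \<open>Derivative in the pair (z,c) as a bounded operator, the form in which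
      \<open>has_derivative_partialsI\<close> asks for continuity of the second partial
      derivative.\<close>
    define fy where "fy = (\<lambda>(x,q). (blinfun_mult_right (Dz (x,q)) o\<^sub>L fst_blinfun) + (blinfun_mult_right (Dc (x,q)) o\<^sub>L snd_blinfun))"
    have inner: "((\<lambda>q. f (x,q)) has_derivative blinfun_apply (fy (x,q))) (at q within ball z r \<times> ball c r)"
      if x: "x \<in> ball s r" and q: "q \<in> ball z r \<times> ball c r" for x q
    proof -
      obtain u v where uv: "q = (u,v)" "u \<in> ball z r" "v \<in> ball c r" using q by auto
      have "((\<lambda>(u,v). f (x,u,v)) has_derivative (\<lambda>(tx,ty). Dz (x,u,v) * tx + blinfun_apply (blinfun_mult_right (Dc (x,u,v))) ty))
        (at (u,v) within ball z r \<times> ball c r)"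
      proof (rule has_derivative_partialsI)
        have "(x,u,v) \<in> U" using r uv x by auto
        from d2[OF this] show "((\<lambda>y. f (x,y,v)) has_derivative (*) (Dz (x,u,v))) (at u within ball z r)"
          unfolding Dz_def
          by (simp add: DERIV_deriv_iff_field_differentiable has_field_derivative_at_within flip: has_field_derivative_def)
        show "((\<lambda>y. f (x,a,y)) has_derivative blinfun_apply (blinfun_mult_right (Dc (x,a,b)))) (at b within ball c r)"
          if "a \<in> ball z r" "b \<in> ball c r" for a b
        proof -
          have "(x,a,b) \<in> U" using r that x by auto
          from d3[OF this] show ?thesis
            unfolding Dc_def
            by (simp add: DERIV_deriv_iff_field_differentiable has_field_derivative_at_within flip: has_field_derivative_def)
        qed
        have "continuous_on (ball z r \<times> ball c r) (\<lambda>y. Dc (x,y))"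
          by (rule continuous_on_compose2[OF cc continuous_on_Pair[OF continuous_on_const continuous_on_id]]) (use x in auto)
        from bounded_linear.continuous_on[OF bounded_linear_blinfun_mult_right this]
        have "continuous (at (u, v) within ball z r \<times> ball c r) (\<lambda>y. blinfun_mult_right (Dc (x, y)))"
          unfolding continuous_on_eq_continuous_within by (rule bspec) (use uv in simp)
        then show "continuous (at (u, v) within ball z r \<times> ball c r) (\<lambda>(a, y). blinfun_mult_right (Dc (x, a, y)))"
          by (simp add: case_prod_unfold)
      qed (use uv in auto)
      then show ?thesis
        unfolding uv fy_def
        by (simp add: case_prod_unfold plus_blinfun.rep_eq fst_blinfun.rep_eq snd_blinfun.rep_eq)
    qed
    have cfy: "continuous_on (ball s r \<times> ball z r \<times> ball c r) fy"
      unfolding fy_def split_beta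
      using bounded_linear.continuous_on[OF bounded_linear_blinfun_mult_right cz]
        bounded_linear.continuous_on[OF bounded_linear_blinfun_mult_right cc]
      by (intro continuous_on_add bounded_bilinear.continuous_on[OF bounded_bilinear_blinfun_compose] continuous_on_const)
         simp_all
    \<comment> \<open>The rule takes the first partial derivative at the point and the second one
      nearby, with continuity. It is used twice: here to split off s, and in \<open>inner\<close> to
      split z from c.\<close>
    have "((\<lambda>(x,q). f (x,q)) has_derivative (\<lambda>(tx,ty). deriv (\<lambda>w. f (w,z,c)) s * tx + blinfun_apply (fy (s,z,c)) ty))
        (at (s,z,c) within ball s r \<times> (ball z r \<times> ball c r))"
    proof (rule has_derivative_partialsI)
      show "((\<lambda>y. f (y,z,c)) has_derivative (*) (deriv (\<lambda>w. f (w,z,c)) s)) (at s within ball s r)"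
        using d1[OF mem]
        by (simp add: DERIV_deriv_iff_field_differentiable has_field_derivative_at_within flip: has_field_derivative_def)
      have "continuous (at (s,z,c) within ball s r \<times> (ball z r \<times> ball c r)) fy"
        using cfy unfolding continuous_on_eq_continuous_within by (rule bspec) (use r in simp)
      then show "continuous (at (s,z,c) within ball s r \<times> (ball z r \<times> ball c r)) (\<lambda>(x, y). fy (x, y))"
        by simp
    qed (use inner r in \<open>auto intro!: convex_Times\<close>)
    moreover have "(at (s,z,c) within ball s r \<times> (ball z r \<times> ball c r)) = at (s,z,c)"
      by (rule at_within_open) (use r in \<open>auto intro!: open_Times\<close>)
    ultimately have "(f has_derivative (\<lambda>y. deriv (\<lambda>w. f (w,z,c)) s * fst y + Dz (s,z,c) * fst (snd y) + Dc (s,z,c) * snd (snd y))) (at (s,z,c))"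
      by (simp add: case_prod_unfold fy_def plus_blinfun.rep_eq fst_blinfun.rep_eq snd_blinfun.rep_eq add.assoc)
    then show ?thesis by blast
  qed
  then show ?thesis using U unfolding holo3_def by auto
qed

section \<open>Closure properties of holomorphic functions of three variables\<close>

lemma holo3_subset: "holo3 f U \<Longrightarrow> open V \<Longrightarrow> V \<subseteq> U \<Longrightarrow> holo3 f V"
  unfolding holo3_def by blast

lemma holo3_localI:
  assumes "open U"
    and "\<And>x. x \<in> U \<Longrightarrow> \<exists>V g. x \<in> V \<and> holo3 g V \<and> (\<forall>y\<in>V. f y = g y)"
  shows "holo3 f U"
  unfolding holo3_def
proof (intro conjI ballI assms(1))
  fix x assume "x \<in> U"
  then obtain V g where V: "x \<in> V" "holo3 g V" "\<forall>y\<in>V. f y = g y" using assms(2) by blast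
  then obtain a b d where "(g has_derivative (\<lambda>y. a * fst y + b * fst (snd y) + d * snd (snd y))) (at x)"
    unfolding holo3_def by blast
  then have "(f has_derivative (\<lambda>y. a * fst y + b * fst (snd y) + d * snd (snd y))) (at x)"
    by (rule has_derivative_transform_within_open[OF _ holo3_open[OF V(2)] V(1)]) (use V in auto)
  then show "\<exists>a b d. (f has_derivative (\<lambda>y. a * fst y + b * fst (snd y) + d * snd (snd y))) (at x)"
    by blast
qed

lemma holo3_cong:
  assumes "holo3 g U" "\<And>x. x \<in> U \<Longrightarrow> f x = g x"
  shows "holo3 f U"
proof (rule holo3_localI[OF holo3_open[OF assms(1)]])
  show "\<exists>V g. x \<in> V \<and> holo3 g V \<and> (\<forall>y\<in>V. f y = g y)" if "x \<in> U" for x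
    by (intro exI[of _ U] exI[of _ g]) (simp add: assms that)
qed

lemma holo3_const: "open U \<Longrightarrow> holo3 (\<lambda>x. k) U"
  by (rule holo3I) auto

lemma holo3_coord:
  assumes "open U"
  shows "holo3 fst U" "holo3 (\<lambda>x. fst (snd x)) U" "holo3 (\<lambda>x. snd (snd x)) U"
  by (rule holo3I[OF assms], intro continuous_intros, (simp add: field_differentiable_ident field_differentiable_const; fail)+)+

lemma holo3_add:
  assumes f: "holo3 f U" and g: "holo3 g U"
  shows "holo3 (\<lambda>x. f x + g x) U"
  by (rule holo3I, rule holo3_open[OF f], intro continuous_on_add holo3_continuous_on[OF f] holo3_continuous_on[OF g];
      intro field_differentiable_add holo3_fd[OF f] holo3_fd[OF g])

lemma holo3_diff:
  assumes f: "holo3 f U" and g: "holo3 g U"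
  shows "holo3 (\<lambda>x. f x - g x) U"
  by (rule holo3I, rule holo3_open[OF f], intro continuous_on_diff holo3_continuous_on[OF f] holo3_continuous_on[OF g];
      intro field_differentiable_diff holo3_fd[OF f] holo3_fd[OF g])

lemma holo3_mult:
  assumes f: "holo3 f U" and g: "holo3 g U"
  shows "holo3 (\<lambda>x. f x * g x) U"
  by (rule holo3I, rule holo3_open[OF f], intro continuous_on_mult holo3_continuous_on[OF f] holo3_continuous_on[OF g];
      intro field_differentiable_mult holo3_fd[OF f] holo3_fd[OF g])

lemma holo3_uminus: "holo3 f U \<Longrightarrow> holo3 (\<lambda>x. - f x) U"
  using holo3_diff[OF holo3_const, of U f 0] holo3_open by simp

lemma holo3_compose:
  assumes "holo3 f U" "g holomorphic_on W" "open W" "\<And>x. x \<in> U \<Longrightarrow> f x \<in> W"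
  shows "holo3 (\<lambda>x. g (f x)) U"
proof (rule holo3I)
  show "open U" using assms(1) holo3_open by blast
  show "continuous_on U (\<lambda>x. g (f x))"
    by (rule continuous_on_compose2[OF holomorphic_on_imp_continuous_on[OF assms(2)] holo3_continuous_on[OF assms(1)]])
       (use assms in auto)
  have *: "g field_differentiable at (f x)" if "x \<in> U" for x
    using assms that holomorphic_on_imp_differentiable_at by blast
  show "(\<lambda>w. g (f (w, z, c))) field_differentiable at s" "(\<lambda>w. g (f (s, w, c))) field_differentiable at z"
    "(\<lambda>w. g (f (s, z, w))) field_differentiable at c" if "(s,z,c) \<in> U" for s z c
    using field_differentiable_compose[of "\<lambda>w. f (w,z,c)" s g] field_differentiable_compose[of "\<lambda>w. f (s,w,c)" z g]
      field_differentiable_compose[of "\<lambda>w. f (s,z,w)" c g] *[OF that] holo3_fd[OF assms(1) that]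
    by (simp_all add: o_def)
qed

lemma holo3_exp: "holo3 f U \<Longrightarrow> holo3 (\<lambda>x. exp (f x)) U"
  by (rule holo3_compose[where W = UNIV]) (auto intro!: holomorphic_intros)

lemma holo3_power: "holo3 f U \<Longrightarrow> holo3 (\<lambda>x. f x ^ n) U"
  by (rule holo3_compose[where W = UNIV and g = "\<lambda>w. w ^ n"]) (auto intro!: holomorphic_intros)

lemma holo3_inverse: "holo3 f U \<Longrightarrow> (\<And>x. x \<in> U \<Longrightarrow> f x \<noteq> 0) \<Longrightarrow> holo3 (\<lambda>x. inverse (f x)) U"
  by (rule holo3_compose[where W = "-{0}"]) (auto intro!: holomorphic_intros)

lemma holo3_divide:
  "holo3 f U \<Longrightarrow> holo3 g U \<Longrightarrow> (\<And>x. x \<in> U \<Longrightarrow> g x \<noteq> 0) \<Longrightarrow> holo3 (\<lambda>x. f x / g x) U"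
  unfolding divide_inverse by (intro holo3_mult holo3_inverse)

lemma holo3_Ln:
  "holo3 f U \<Longrightarrow> (\<And>x. x \<in> U \<Longrightarrow> f x \<notin> \<real>\<^sub>\<le>\<^sub>0) \<Longrightarrow> holo3 (\<lambda>x. Ln (f x)) U"
  by (rule holo3_compose[where W = "-\<real>\<^sub>\<le>\<^sub>0"]) (auto intro!: holomorphic_intros)

lemma holo3_rGamma: "holo3 f U \<Longrightarrow> holo3 (\<lambda>x. rGamma (f x)) U"
  by (rule holo3_compose[where W = UNIV and g = rGamma]) (auto intro!: holomorphic_intros)

lemma holo3_sum:
  assumes "open U" "\<And>k. k \<in> I \<Longrightarrow> holo3 (f k) U"
  shows "holo3 (\<lambda>x. \<Sum>k\<in>I. f k x) U"
  using assms(2)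
proof (induction I rule: infinite_finite_induct)
  case (insert k I)
  then have "holo3 (\<lambda>x. f k x + (\<Sum>k\<in>I. f k x)) U" by (intro holo3_add) auto
  then show ?case using insert by simp
qed (use assms(1) holo3_const in auto)

lemmas holo3_intros = holo3_const holo3_coord holo3_add holo3_diff holo3_mult holo3_uminus holo3_exp holo3_power holo3_divide holo3_sum

text \<open>Translation in s serves the step in s and the equations, translation in c the shift by
  m. Uses that move only one coordinate carry a literal \<open>+ 0\<close> in the other.\<close>

lemma holo3_shift:
  assumes "holo3 f U"
  shows "holo3 (\<lambda>x. f (fst x + a, fst (snd x), snd (snd x) + b)) {x. (fst x + a, fst (snd x), snd (snd x) + b) \<in> U}"
proof (rule holo3I)
  have c: "continuous_on A (\<lambda>x::pt. (fst x + a, fst (snd x), snd (snd x) + b))" for A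
    by (intro continuous_intros)
  show "open {x. (fst x + a, fst (snd x), snd (snd x) + b) \<in> U}"
    using open_vimage[OF holo3_open[OF assms] c] by (simp add: vimage_def)
  show "continuous_on {x. (fst x + a, fst (snd x), snd (snd x) + b) \<in> U} (\<lambda>x. f (fst x + a, fst (snd x), snd (snd x) + b))"
    by (rule continuous_on_compose2[OF holo3_continuous_on[OF assms] c]) auto
next
  fix s z c assume "(s,z,c) \<in> {x. (fst x + a, fst (snd x), snd (snd x) + b) \<in> U}"
  then have m: "(s + a, z, c + b) \<in> U" by simp
  show "(\<lambda>w. f (fst (w, z, c) + a, fst (snd (w, z, c)), snd (snd (w, z, c)) + b)) field_differentiable at s"
    by (rule holo3_line[OF assms m]) (auto intro!: derivative_eq_intros)
  show "(\<lambda>w. f (fst (s, w, c) + a, fst (snd (s, w, c)), snd (snd (s, w, c)) + b)) field_differentiable at z"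
    by (rule holo3_line[OF assms m]) (auto intro!: derivative_eq_intros)
  show "(\<lambda>w. f (fst (s, z, w) + a, fst (snd (s, z, w)), snd (snd (s, z, w)) + b)) field_differentiable at c"
    by (rule holo3_line[OF assms m]) (auto intro!: derivative_eq_intros)
qed

section \<open>Integrals depending on complex parameters\<close>

lemma integral_field_differentiable:
  fixes K :: "complex \<Rightarrow> real \<Rightarrow> complex"
  assumes W: "open W" "w \<in> W" and cont: "continuous_on (W \<times> {a..b}) (\<lambda>(w,t). K w t)"
    and hol: "\<And>t. t \<in> {a..b} \<Longrightarrow> (\<lambda>w. K w t) holomorphic_on W"
  shows "(\<lambda>w. integral {a..b} (K w)) field_differentiable at w"
proof -
  obtain r where r: "r > 0" "cball w r \<subseteq> W" using W open_contains_cball by blast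
  have rb: "ball w r \<subseteq> W" using r ball_subset_cball by blast
  have "((\<lambda>x. integral (cbox a b) (K x)) has_field_derivative integral (cbox a b) (\<lambda>t. deriv (\<lambda>w. K w t) w)) (at w within ball w r)"
  proof (rule leibniz_rule_field_derivative)
    show "((\<lambda>x. K x t) has_field_derivative deriv (\<lambda>w. K w t) x) (at x within ball w r)"
      if "x \<in> ball w r" "t \<in> cbox a b" for x t
      by (rule has_field_derivative_at_within, rule holomorphic_derivI[OF hol W(1)]) (use that rb in auto)
    show "K x integrable_on cbox a b" if "x \<in> ball w r" for x
    proof (rule integrable_continuous)
      show "continuous_on (cbox a b) (K x)"
        using continuous_on_compose2[OF cont continuous_on_Pair[OF continuous_on_const continuous_on_id], of x "cbox a b"] that rb
        by (auto simp: subset_iff image_iff)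
    qed
    show "continuous_on (ball w r \<times> cbox a b) (\<lambda>(x, t). deriv (\<lambda>w. K w t) x)"
      by (rule deriv_param_continuous)
         (use r rb in \<open>auto intro!: holomorphic_on_subset[OF hol] continuous_on_subset[OF cont]\<close>)
  qed (use r in auto)
  then show ?thesis
    using r at_within_open[of w "ball w r"] by (auto simp: field_differentiable_def)
qed

text \<open>By \<open>holo3I\<close> it is enough to have continuity of the integral and to
  differentiate under it along each coordinate line; \<open>l\<close> in the proof stands for any of
  the three lines.\<close>

lemma holo3_integral:
  fixes K :: "pt \<Rightarrow> real \<Rightarrow> complex"
  assumes U: "open U" and cont: "continuous_on (U \<times> {a..b}) (\<lambda>(x,t). K x t)"
    and hol: "\<And>t. t \<in> {a..b} \<Longrightarrow> holo3 (\<lambda>x. K x t) U"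
  shows "holo3 (\<lambda>x. integral {a..b} (K x)) U"
proof (rule holo3I[OF U])
  show "continuous_on U (\<lambda>x. integral {a..b} (K x))"
    using integral_continuous_on_param[of U a b K] cont by simp
next
  fix s z c assume m: "(s,z,c) \<in> U"
  have *: "(\<lambda>w. integral {a..b} (K (l w))) field_differentiable at w0"
    if l: "\<And>A. continuous_on A l" "l w0 = (s,z,c)"
      and fd: "\<And>w t. l w \<in> U \<Longrightarrow> t \<in> {a..b} \<Longrightarrow> (\<lambda>w. K (l w) t) field_differentiable at w" for l w0
  proof (rule integral_field_differentiable)
    show "open (l -` U)" "w0 \<in> l -` U" using open_vimage[OF U l(1)] m l(2) by auto
    have "continuous_on (l -` U \<times> {a..b}) (\<lambda>y. (\<lambda>(x,t). K x t) (l (fst y), snd y))"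
      by (rule continuous_on_compose2[OF cont], intro continuous_intros continuous_on_compose2[OF l(1)]) auto
    then show "continuous_on (l -` U \<times> {a..b}) (\<lambda>(w,t). K (l w) t)" by (simp add: split_beta)
    show "(\<lambda>w. K (l w) t) holomorphic_on l -` U" if "t \<in> {a..b}" for t
      by (intro holomorphic_onI_at fd) (use that in auto)
  qed
  show "(\<lambda>w. integral {a..b} (K (w, z, c))) field_differentiable at s"
    by (rule *[of "\<lambda>w. (w,z,c)"]) (auto intro!: continuous_intros holo3_fd[OF hol])
  show "(\<lambda>w. integral {a..b} (K (s, w, c))) field_differentiable at z"
    by (rule *[of "\<lambda>w. (s,w,c)"]) (auto intro!: continuous_intros holo3_fd[OF hol])
  show "(\<lambda>w. integral {a..b} (K (s, z, w))) field_differentiable at c"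
    by (rule *[of "\<lambda>w. (s,z,w)"]) (auto intro!: continuous_intros holo3_fd[OF hol])
qed

section \<open>Partial derivatives in z and c\<close>

definition dz :: "(pt \<Rightarrow> complex) \<Rightarrow> pt \<Rightarrow> complex" where
  "dz f x = deriv (\<lambda>w. f (fst x, w, snd (snd x))) (fst (snd x))"

definition dc :: "(pt \<Rightarrow> complex) \<Rightarrow> pt \<Rightarrow> complex" where
  "dc f x = deriv (\<lambda>w. f (fst x, fst (snd x), w)) (snd (snd x))"

lemma holo3_DERIV:
  assumes "holo3 f U" "(s,z,c) \<in> U"
  shows "((\<lambda>w. f (s,w,c)) has_field_derivative dz f (s,z,c)) (at z)"
    and "((\<lambda>w. f (s,z,w)) has_field_derivative dc f (s,z,c)) (at c)"
  using holo3_fd[OF assms] by (simp_all add: dz_def dc_def DERIV_deriv_iff_field_differentiable)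

text \<open>Near a point the derivative is a Cauchy integral over a circle that does not move with
  the point, hence a parameter integral of holomorphic functions.\<close>

lemma holo3_dz:
  assumes f: "holo3 f U"
  shows "holo3 (dz f) U"
proof (rule holo3_localI[OF holo3_open[OF f]])
  fix x assume "x \<in> U"
  obtain s z c where x: "x = (s,z,c)" by (cases x)
  obtain r where r: "r > 0" "\<forall>x\<in>cball s r. \<forall>y\<in>cball z r. \<forall>w\<in>cball c r. (x,y,w) \<in> U"
    using open_pt_box[OF holo3_open[OF f]] \<open>x \<in> U\<close> x by blast
  define V where "V = ball s r \<times> ball z r \<times> ball c r"
  have V: "open V" by (auto simp: V_def intro!: open_Times)
  have V': "(fst y, circlepath z r t, snd (snd y)) \<in> U" if "y \<in> V" for y t
    using that r circlepath_in_cball[OF r(1), of z t] by (auto simp: V_def)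
  define K where "K = (\<lambda>(y::pt) t. f (fst y, circlepath z r t, snd (snd y)) / (circlepath z r t - fst (snd y))\<^sup>2 *
      (2 * of_real pi * \<i> * of_real r * exp (2 * of_real pi * \<i> * of_real t)))"
  have ne: "circlepath z r t - fst (snd y) \<noteq> 0" if "y \<in> V" for y t
  proof -
    have "fst (snd y) \<in> ball z r" using that by (auto simp: V_def)
    from circlepath_neq[OF this] show ?thesis by simp
  qed
  have fh: "holo3 (\<lambda>y. f (fst y, circlepath z r t, snd (snd y))) V" for t
  proof (rule holo3I[OF V])
    show "continuous_on V (\<lambda>y. f (fst y, circlepath z r t, snd (snd y)))"
      by (rule continuous_on_compose2[OF holo3_continuous_on[OF f]], intro continuous_intros) (use V' in auto)
  next
    fix s' z' c' assume "(s',z',c') \<in> V"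
    from V'[OF this, of t] have m: "(s', circlepath z r t, c') \<in> U" by simp
    show "(\<lambda>w. f (fst (w,z',c'), circlepath z r t, snd (snd (w,z',c')))) field_differentiable at s'"
      "(\<lambda>w. f (fst (s',w,c'), circlepath z r t, snd (snd (s',w,c')))) field_differentiable at z'"
      "(\<lambda>w. f (fst (s',z',w), circlepath z r t, snd (snd (s',z',w)))) field_differentiable at c'"
      using holo3_fd[OF f m] by (auto intro: field_differentiable_const)
  qed
  have "holo3 (\<lambda>y. integral {0..1} (K y)) V"
  proof (rule holo3_integral[OF V])
    have c1: "continuous_on (V \<times> {0..1}) (\<lambda>y. f (fst (fst y), circlepath z r (snd y), snd (snd (fst y))))"
      by (rule continuous_on_compose2[OF holo3_continuous_on[OF f]], intro continuous_intros) (use V' in auto)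
    show "continuous_on (V \<times> {0..1}) (\<lambda>(x, t). K x t)"
      unfolding K_def split_beta by (intro continuous_intros c1) (use ne in auto)
    show "holo3 (\<lambda>x. K x t) V" for t
      unfolding K_def by (intro holo3_intros fh V) (use ne in auto)
  qed
  then have h: "holo3 (\<lambda>y. 1 / (2 * of_real pi * \<i>) * integral {0..1} (K y)) V"
    by (intro holo3_intros V)
  have "dz f y = 1 / (2 * of_real pi * \<i>) * integral {0..1} (K y)" if "y \<in> V" for y
    unfolding dz_def K_def
  proof (rule deriv_circle_integral)
    show "continuous_on (cball z r) (\<lambda>w. f (fst y, w, snd (snd y)))"
      by (rule continuous_on_compose2[OF holo3_continuous_on[OF f]], intro continuous_intros) (use that r in \<open>auto simp: V_def\<close>)
    show "(\<lambda>w. f (fst y, w, snd (snd y))) holomorphic_on ball z r"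
      by (intro holomorphic_onI_at holo3_fd[OF f]) (use that r in \<open>auto simp: V_def\<close>)
    show "fst (snd y) \<in> ball z r" using that by (auto simp: V_def)
  qed
  then show "\<exists>V g. x \<in> V \<and> holo3 g V \<and> (\<forall>y\<in>V. dz f y = g y)"
    using h r x by (intro exI[of _ V]) (auto simp: V_def)
qed

lemma holo3_dc:
  assumes f: "holo3 f U"
  shows "holo3 (dc f) U"
proof -
  \<comment> \<open>Conjugation by the exchange of z and c turns \<open>dc\<close> into
    \<open>dz\<close>.\<close>
  define \<sigma> :: "pt \<Rightarrow> pt" where "\<sigma> = (\<lambda>x. (fst x, snd (snd x), fst (snd x)))"
  have \<sigma>: "\<sigma> (\<sigma> x) = x" for x by (simp add: \<sigma>_def)
  have c: "continuous_on A \<sigma>" for A unfolding \<sigma>_def by (intro continuous_intros)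
  have *: "holo3 (\<lambda>x. g (\<sigma> x)) {x. \<sigma> x \<in> V}" if g: "holo3 g V" for g V
  proof (rule holo3I)
    show "open {x. \<sigma> x \<in> V}" using open_vimage[OF holo3_open[OF g] c] by (simp add: vimage_def)
    show "continuous_on {x. \<sigma> x \<in> V} (\<lambda>x. g (\<sigma> x))"
      by (rule continuous_on_compose2[OF holo3_continuous_on[OF g] c]) auto
    show "(\<lambda>w. g (\<sigma> (w, z, c))) field_differentiable at s" "(\<lambda>w. g (\<sigma> (s, w, c))) field_differentiable at z"
      "(\<lambda>w. g (\<sigma> (s, z, w))) field_differentiable at c" if "(s,z,c) \<in> {x. \<sigma> x \<in> V}" for s z c
      using holo3_fd[OF g, of s c z] that by (auto simp: \<sigma>_def)
  qed
  have "holo3 (\<lambda>x. dz (\<lambda>x. f (\<sigma> x)) (\<sigma> x)) {x. \<sigma> x \<in> {x. \<sigma> x \<in> U}}"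
    by (intro * holo3_dz f)
  moreover have "dz (\<lambda>x. f (\<sigma> x)) (\<sigma> x) = dc f x" for x by (simp add: dz_def dc_def \<sigma>_def)
  ultimately show ?thesis by (simp add: \<sigma>)
qed

section \<open>The identity theorem\<close>

lemma holo3_zero_convex:
  assumes f: "holo3 f U" and U: "convex U" "a \<in> U" "y \<in> U" and z: "\<forall>\<^sub>F x in nhds a. f x = 0"
  shows "f y = 0"
proof -
  \<comment> \<open>The complex line with \<open>a\<close> at parameter 0 and \<open>y\<close> at
    parameter 1. It meets the convex set \<open>U\<close> in a convex, hence connected, set of
    parameters, and the one-variable identity theorem applies there.\<close>
  define g where "g = (\<lambda>w::complex. (fst a + w * (fst y - fst a), fst (snd a) + w * (fst (snd y) - fst (snd a)),
     snd (snd a) + w * (snd (snd y) - snd (snd a))))"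
  have cg: "continuous_on A g" for A unfolding g_def by (intro continuous_intros)
  define W where "W = {w. g w \<in> U}"
  have W: "open W" using open_vimage[OF holo3_open[OF f] cg] by (simp add: vimage_def W_def)
  have "convex W"
  proof (rule convexI)
    fix p q u v assume *: "p \<in> W" "q \<in> W" "0 \<le> u" "0 \<le> v" "u + v = (1::real)"
    have "of_real u + of_real v = (1::complex)" using *(5) by (metis of_real_1 of_real_add)
    then have v: "complex_of_real v = 1 - of_real u" by (simp add: algebra_simps)
    have "g (u *\<^sub>R p + v *\<^sub>R q) = u *\<^sub>R g p + v *\<^sub>R g q"
      unfolding g_def by (simp add: scaleR_conv_of_real v) (simp add: algebra_simps)
    then show "u *\<^sub>R p + v *\<^sub>R q \<in> W"
      using * U(1) unfolding W_def by (simp add: convexD)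
  qed
  then have conn: "connected W" by (rule convex_connected)
  have g01: "g 0 = a" "g 1 = y" by (simp_all add: g_def)
  have hol: "(\<lambda>w. f (g w)) holomorphic_on W"
  proof (rule holomorphic_onI_at)
    fix w assume "w \<in> W"
    then show "(\<lambda>w. f (g w)) field_differentiable at w"
      by (intro holo3_line[OF f, of "g w" g w]) (auto simp: W_def g_def intro!: derivative_eq_intros)
  qed
  have "\<forall>\<^sub>F w in nhds 0. f (g w) = 0"
  proof (rule eventually_compose_filterlim[OF z])
    have "isCont g 0" using cg[of UNIV] by (simp add: continuous_on_eq_continuous_at)
    then have "(g \<longlongrightarrow> g 0) (nhds 0)"
      unfolding isCont_def tendsto_at_iff_tendsto_nhds .
    then show "filterlim g (nhds a) (nhds 0)" by (simp only: g01)
  qed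
  moreover have "\<forall>\<^sub>F w in nhds 0. w \<in> W"
    using W U g01 by (intro eventually_nhds_in_open) (auto simp: W_def)
  ultimately have "\<forall>\<^sub>F w in nhds 0. w \<in> W \<and> f (g w) = 0" by eventually_elim auto
  then obtain S where S: "open S" "0 \<in> S" "\<forall>w\<in>S. w \<in> W \<and> f (g w) = 0"
    unfolding eventually_nhds by blast
  have "f (g 1) = 0"
    by (rule analytic_continuation_open[where f = "\<lambda>w. f (g w)" and g = "\<lambda>_. 0" and s = S and s' = W])
       (use S W conn hol U g01 in \<open>auto simp: W_def\<close>)
  then show ?thesis by (simp add: g01)
qed

text \<open>Points with vanishing germ form an open set; so do the others, since in a ball inside
  \<open>U\<close> one vanishing germ forces zero throughout by the convex case.\<close>

lemma holo3_zero_connected: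
  assumes f: "holo3 f U" and U: "connected U" "a \<in> U" "y \<in> U" and z: "\<forall>\<^sub>F x in nhds a. f x = 0"
  shows "f y = 0"
proof -
  define A where "A = {x\<in>U. \<forall>\<^sub>F y in nhds x. f y = 0}"
  have oU: "open U" using f holo3_open by blast
  have oA: "open A"
  proof -
    have "\<forall>\<^sub>F y in nhds x. y \<in> A" if "x \<in> A" for x
    proof -
      have "\<forall>\<^sub>F y in nhds x. \<forall>\<^sub>F w in nhds y. f w = 0"
        using that by (simp add: A_def eventually_eventually)
      moreover have "\<forall>\<^sub>F y in nhds x. y \<in> U" using oU that by (intro eventually_nhds_in_open) (auto simp: A_def)
      ultimately show ?thesis by eventually_elim (auto simp: A_def)
    qed
    then show ?thesis by (subst open_subopen) (simp add: eventually_nhds subset_eq)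
  qed
  have "open (U - A)"
  proof (subst open_contains_ball, intro ballI)
    fix x assume x: "x \<in> U - A"
    obtain r where r: "r > 0" "ball x r \<subseteq> U" using openE[OF oU, of x] x by blast
    have "y \<notin> A" if y: "y \<in> ball x r" for y
    proof
      assume "y \<in> A"
      then have "f w = 0" if "w \<in> ball x r" for w
        using holo3_zero_convex[OF holo3_subset[OF f], of "ball x r" y w] r y that by (auto simp: A_def)
      then have "\<forall>\<^sub>F w in nhds x. f w = 0"
        unfolding eventually_nhds using r by (intro exI[of _ "ball x r"]) auto
      then show False using x by (auto simp: A_def)
    qed
    then show "\<exists>e>0. ball x e \<subseteq> U - A" using r by blast
  qed
  then have "A \<inter> U = {} \<or> (U - A) \<inter> U = {}"
    using U(1) oA unfolding connected_def by blast
  moreover have "a \<in> A" using U z by (simp add: A_def)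
  ultimately have "y \<in> A" using U by blast
  then show ?thesis by (auto simp: A_def dest: eventually_nhds_x_imp_x)
qed

section \<open>The integral representation\<close>

text \<open>The factor (- ln v)^(s - 1) v^(c - 1), written with real logarithms so that no branch of
  a power is chosen. The value 0 at the end points is the limit when Re s > 1 and Re c > 2.\<close>

definition ker :: "complex \<Rightarrow> complex \<Rightarrow> real \<Rightarrow> complex" where
  "ker s c v = (if 0 < v \<and> v < 1 then exp ((s - 1) * of_real (ln (- ln v)) + (c - 1) * of_real (ln v)) else 0)"

abbreviation kdom :: "(complex \<times> complex) set" where
  "kdom \<equiv> {s. 1 < Re s} \<times> {c. 2 < Re c}"

lemma norm_ker:
  "0 < v \<Longrightarrow> v < 1 \<Longrightarrow> norm (ker s c v) = (- ln v) powr (Re s - 1) * v powr (Re c - 1)"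
  by (simp add: ker_def powr_def exp_add norm_mult)

lemma ker_outside: "\<not> (0 < v \<and> v < 1) \<Longrightarrow> ker s c v = 0"
  unfolding ker_def by (rule if_not_P)

lemma ker_0_1 [simp]: "ker s c 0 = 0" "ker s c 1 = 0"
  by (auto simp: ker_def)

lemma neg_ln_powr_times_tendsto:
  "S > 0 \<Longrightarrow> ((\<lambda>v::real. (- ln v) powr S * v) \<longlongrightarrow> 0) (at_right 0)"
  by real_asymp

text \<open>The end points are the issue. Near 1 the power of v is at most 1 and (- ln v)^(Re s - 1)
  tends to 0 jointly in s and v; near 0 the power of v beats the logarithm uniformly for nearby
  s.\<close>

lemma continuous_on_ker:
  "continuous_on (kdom \<times> {0..1}) (\<lambda>(p, v). ker (fst p) (snd p) v)"
  unfolding continuous_on_def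
proof
  fix x assume "x \<in> kdom \<times> {0..1::real}"
  then obtain s c v where x: "x = ((s,c),v)" "1 < Re s" "2 < Re c" "0 \<le> v" "v \<le> 1"
    by auto
  define F where "F = at x within kdom \<times> {0..1::real}"
  have tx: "((\<lambda>y. y) \<longlongrightarrow> x) F" by (simp add: F_def tendsto_ident_at)
  have ts: "((\<lambda>y. Re (fst (fst y))) \<longlongrightarrow> Re s) F" and tv: "((\<lambda>y. snd y) \<longlongrightarrow> v) F"
    using tx x(1) by (auto intro!: tendsto_eq_intros)
  have inD: "\<forall>\<^sub>F y in F. y \<in> kdom \<times> {0..1}" by (simp add: F_def eventually_at_filter)
  consider "0 < v \<and> v < 1" | "v = 1" | "v = 0" using x by linarith
  then have "((\<lambda>y. ker (fst (fst y)) (snd (fst y)) (snd y)) \<longlongrightarrow> ker s c v) F"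
  proof cases
    case 1
    have "\<forall>\<^sub>F y in F. 0 < snd y \<and> snd y < 1"
      using order_tendstoD[OF tv] 1 by (simp add: eventually_conj)
    then have ev: "\<forall>\<^sub>F y in F. exp ((fst (fst y) - 1) * of_real (ln (- ln (snd y))) + (snd (fst y) - 1) * of_real (ln (snd y))) =
       ker (fst (fst y)) (snd (fst y)) (snd y)"
      by eventually_elim (simp add: ker_def)
    have "((\<lambda>y. exp ((fst (fst y) - 1) * of_real (ln (- ln (snd y))) + (snd (fst y) - 1) * of_real (ln (snd y)))) \<longlongrightarrow> 
       exp ((s - 1) * of_real (ln (- ln v)) + (c - 1) * of_real (ln v))) F"
      using tx x(1) 1 tv by (intro tendsto_intros) (auto intro!: tendsto_eq_intros)
    from Lim_transform_eventually[OF this ev] show ?thesis using 1 by (simp add: ker_def[of s c v])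
  next
    case 2
    have "((\<lambda>y. (- ln (snd y)) powr (Re (fst (fst y)) - 1)) \<longlongrightarrow> (- ln v) powr (Re s - 1)) F"
    proof (rule tendsto_powr'[OF tendsto_minus[OF tendsto_ln[OF tv]] tendsto_diff[OF ts tendsto_const]])
      have "\<forall>\<^sub>F y in F. 0 < snd y" using order_tendstoD(1)[OF tv, of 0] 2 by simp
      with inD have "\<forall>\<^sub>F y in F. 0 \<le> - ln (snd y)" by eventually_elim auto
      then show "- ln v \<noteq> 0 \<or> 0 < Re s - 1 \<and> (\<forall>\<^sub>F y in F. 0 \<le> - ln (snd y))"
        using x by simp
    qed (use 2 in auto)
    then have l: "((\<lambda>y. (- ln (snd y)) powr (Re (fst (fst y)) - 1)) \<longlongrightarrow> 0) F" using 2 by simp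
    have "\<forall>\<^sub>F y in F. 0 < snd y" using order_tendstoD(1)[OF tv, of 0] 2 by simp
    with inD have "\<forall>\<^sub>F y in F. norm (ker (fst (fst y)) (snd (fst y)) (snd y)) \<le> (- ln (snd y)) powr (Re (fst (fst y)) - 1)"
    proof eventually_elim
      case (elim y)
      show ?case
      proof (cases "snd y = 1")
        case False
        then have v: "0 < snd y" "snd y < 1" using elim by auto
        have "snd y powr (Re (snd (fst y)) - 1) \<le> 1 powr (Re (snd (fst y)) - 1)"
          using v elim by (intro powr_mono2) auto
        then show ?thesis using v by (simp add: norm_ker mult_left_le)
      qed simp
    qed
    then show ?thesis using 2 l Lim_null_comparison by simp
  next
    case 3
    \<comment> \<open>Majorant near v = 0: Re c > 2 leaves at least one full factor v, and the
      exponent Re s exceeds Re s' - 1 for every s' with Re s' < Re s + 1.\<close>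
    define m where "m = (\<lambda>v::real. (- ln v) powr (Re s) * v)"
    have "(m \<longlongrightarrow> 0) (at_right 0)" unfolding m_def by (rule neg_ln_powr_times_tendsto) (use x in auto)
    moreover have "m 0 = 0" by (simp add: m_def)
    ultimately have "continuous (at 0 within {0..}) m"
      unfolding continuous_within by (simp add: at_within_Ici_at_right)
    moreover have "((\<lambda>y. snd y) \<longlongrightarrow> 0) F" using tv 3 by simp
    moreover have "\<forall>\<^sub>F y in F. snd y \<in> {0..}" using inD by eventually_elim auto
    ultimately have l: "((\<lambda>y. m (snd y)) \<longlongrightarrow> m 0) F"
      by (intro continuous_within_tendsto_compose[of 0 "{0..}" m "\<lambda>y. snd y"]) auto
    \<comment> \<open>Below exp (- 1) the base - ln v exceeds 1, so enlarging its exponent enlarges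
      the power.\<close>
    have "\<forall>\<^sub>F y in F. snd y < exp (-1)" using order_tendstoD(2)[OF tv, of "exp (-1)"] 3 by simp
    moreover have "\<forall>\<^sub>F y in F. Re (fst (fst y)) < Re s + 1" using order_tendstoD(2)[OF ts, of "Re s + 1"] by simp
    ultimately have "\<forall>\<^sub>F y in F. norm (ker (fst (fst y)) (snd (fst y)) (snd y)) \<le> m (snd y)"
      using inD
    proof eventually_elim
      case (elim y)
      show ?case
      proof (cases "snd y = 0")
        case False
        then have v: "0 < snd y" "snd y < 1" using elim by (auto intro: less_trans)
        have L: "- ln (snd y) > 1"
          using elim(1) v ln_less_cancel_iff[of "snd y" "exp (-1)"] by simp
        have "snd y powr (Re (snd (fst y)) - 1) \<le> snd y powr 1"
          using v elim by (intro powr_mono') auto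
        moreover have "(- ln (snd y)) powr (Re (fst (fst y)) - 1) \<le> (- ln (snd y)) powr (Re s)"
          using L elim by (intro powr_mono) auto
        ultimately show ?thesis using v unfolding norm_ker[OF v] m_def by (intro mult_mono) auto
      qed (simp add: m_def)
    qed
    then show ?thesis using 3 l Lim_null_comparison by (simp add: m_def)
  qed
  then show "((\<lambda>(p, v). ker (fst p) (snd p) v) \<longlongrightarrow> (case x of (p, v) \<Rightarrow> ker (fst p) (snd p) v)) (at x within kdom \<times> {0..1})"
    by (simp add: F_def x case_prod_unfold)
qed

lemma continuous_on_ker' [continuous_intros]:
  assumes "continuous_on A f" "continuous_on A g" "continuous_on A h"
    and "\<And>x. x \<in> A \<Longrightarrow> 1 < Re (f x) \<and> 2 < Re (g x) \<and> 0 \<le> h x \<and> h x \<le> 1"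
  shows "continuous_on A (\<lambda>x. ker (f x) (g x) (h x))"
proof -
  have "continuous_on A (\<lambda>x. (\<lambda>(p, v). ker (fst p) (snd p) v) ((f x, g x), h x))"
    by (rule continuous_on_compose2[OF continuous_on_ker], intro continuous_intros assms) (use assms(4) in auto)
  then show ?thesis by simp
qed

lemma ker_times_power: "0 \<le> v \<Longrightarrow> v \<le> 1 \<Longrightarrow> ker s (c + of_nat k) v = ker s c v * of_real v ^ k"
proof (cases "0 < v \<and> v < 1")
  case True
  then have "of_real v ^ k = exp (of_nat k * complex_of_real (ln v))"
    by (metis exp_ln exp_of_nat_mult exp_of_real of_real_exp)
  then show ?thesis using True by (simp add: ker_def algebra_simps flip: exp_add)
qed (simp add: ker_outside)

lemma ker_add1: "0 \<le> v \<Longrightarrow> v \<le> 1 \<Longrightarrow> ker s (c + 1) v = ker s c v * of_real v"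
  using ker_times_power[of v s c 1] by simp

lemma ker_s_add1: "ker (s + 1) c v = - ker s c v * of_real (ln v)"
proof (cases "0 < v \<and> v < 1")
  case True
  then have "complex_of_real (- ln v) = exp (of_real (ln (- ln v)))"
    by (metis exp_ln exp_of_real ln_less_zero neg_0_less_iff_less)
  moreover have "ker s c v * exp (of_real (ln (- ln v))) = ker (s + 1) c v"
    using True by (simp add: ker_def algebra_simps flip: exp_add)
  ultimately have "ker s c v * of_real (- ln v) = ker (s + 1) c v" by (simp only:)
  then show ?thesis by simp
qed (simp add: ker_outside)

lemma DERIV_ker_c: "((\<lambda>c. ker s c v) has_field_derivative - ker (s + 1) c v) (at c within A)"
proof (cases "0 < v \<and> v < 1")
  case True
  have "((\<lambda>c. ker s c v) has_field_derivative ker s c v * of_real (ln v)) (at c within A)"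
    unfolding ker_def using True by (auto intro!: derivative_eq_intros)
  then show ?thesis by (simp add: ker_s_add1)
qed (simp add: ker_outside)

text \<open>The function is (- ln v)^s v^c, which is set to 0 at both ends of the unit interval.
  This derivative is the source of the integration by parts behind the z-equation.\<close>

lemma vector_derivative_ker:
  assumes v: "0 < v" "v < 1"
  shows "((\<lambda>v. ker (s + 1) (c + 1) v) has_vector_derivative (c * ker (s + 1) c v - s * ker s c v)) (at v)"
proof -
  let ?E = "exp (s * of_real (ln (- ln v)) + c * of_real (ln v))"
  have l: "- ln v > 0" using v by simp
  have "((\<lambda>v. exp (s * of_real (ln (- ln v)) + c * of_real (ln v))) has_vector_derivative
      (?E * (s * of_real (1 / (v * ln v)) + c * of_real (1 / v)))) (at v)"
  proof (rule has_vector_derivative_eq_rhs)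
    have "((\<lambda>v. ln (- ln v)) has_vector_derivative 1 / (v * ln v)) (at v)"
      unfolding has_real_derivative_iff_has_vector_derivative[symmetric]
      using v l by (auto intro!: derivative_eq_intros simp: field_simps)
    then have 1: "((\<lambda>v. complex_of_real (ln (- ln v))) has_vector_derivative of_real (1 / (v * ln v))) (at v)"
      by (rule bounded_linear.has_vector_derivative[OF bounded_linear_of_real])
    have "((\<lambda>v. ln v) has_vector_derivative 1 / v) (at v)"
      unfolding has_real_derivative_iff_has_vector_derivative[symmetric]
      using v by (auto intro!: derivative_eq_intros)
    then have 2: "((\<lambda>v. complex_of_real (ln v)) has_vector_derivative of_real (1 / v)) (at v)"
      by (rule bounded_linear.has_vector_derivative[OF bounded_linear_of_real])
    have "((\<lambda>v. s * of_real (ln (- ln v)) + c * of_real (ln v)) has_vector_derivative (s * of_real (1 / (v * ln v)) + c * of_real (1 / v))) (at v)"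
      by (intro has_vector_derivative_add has_vector_derivative_mult_right 1 2)
    from field_vector_diff_chain_at[OF this DERIV_exp]
    show "((\<lambda>v. exp (s * of_real (ln (- ln v)) + c * of_real (ln v))) has_vector_derivative
      ((s * of_real (1 / (v * ln v)) + c * of_real (1 / v)) * ?E)) (at v)"
      by (simp add: o_def)
  qed (simp add: mult.commute)
  then have d: "((\<lambda>v. ker (s + 1) (c + 1) v) has_vector_derivative
      (?E * (s * of_real (1 / (v * ln v)) + c * of_real (1 / v)))) (at v)"
    by (rule has_vector_derivative_transform_within_open[where S = "{0<..<1}"]) (use v in \<open>auto simp: ker_def\<close>)
  have k: "?E = ker s c v * of_real v * - of_real (ln v)"
    using ker_s_add1[of s "c + 1" v] ker_add1[of v s c] v by (simp add: ker_def)
  have "ker s c v * of_real v * - of_real (ln v) * (s * of_real (1 / (v * ln v)) + c * of_real (1 / v)) =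
      c * ker (s + 1) c v - s * ker s c v"
    unfolding ker_s_add1 using v l by (simp add: field_simps)
  then show ?thesis using d unfolding k by simp
qed

section \<open>The integral off the cut and its differential equations\<close>

abbreviation slit :: "complex set" where
  "slit \<equiv> {z. Im z \<noteq> 0 \<or> Re z < 1}"

lemma slit_neq: "z \<in> slit \<Longrightarrow> 0 \<le> v \<Longrightarrow> v \<le> 1 \<Longrightarrow> 1 - z * of_real v \<noteq> 0"
proof
  assume *: "z \<in> slit" "0 \<le> v" "v \<le> 1" "1 - z * of_real v = 0"
  then have "Im (z * of_real v) = 0" "Re (z * of_real v) = 1"
    by (metis eq_iff_diff_eq_0 one_complex.simps)+
  then have "Im z * v = 0" "Re z * v = 1" by auto
  then have "Im z = 0" "Re z < 1" "v \<noteq> 0" using * by auto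
  moreover have "Re z * v \<le> max 0 (Re z)"
    using * by (cases "Re z \<le> 0") (auto simp: mult_nonpos_nonneg mult_left_le)
  ultimately have "Re z * v < 1" by simp
  then show False using \<open>Re z * v = 1\<close> by simp
qed

lemma open_slit: "open slit"
  by (intro open_Collect_disj open_Collect_neq open_Collect_less continuous_intros)

abbreviation half1 :: "complex set" where "half1 \<equiv> {s. 1 < Re s}"
abbreviation half2 :: "complex set" where "half2 \<equiv> {c. 2 < Re c}"

text \<open>Stated for subintervals because, for z near the cut, the unit interval is later split
  around the pole v = 1/z.\<close>

lemma holo3_ker_integral:
  assumes Z: "open Z" and ab: "0 \<le> a" "b \<le> 1" and nz: "\<And>z v. z \<in> Z \<Longrightarrow> a \<le> v \<Longrightarrow> v \<le> b \<Longrightarrow> 1 - z * of_real v \<noteq> 0"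
  shows "holo3 (\<lambda>x. integral {a..b} (\<lambda>v. ker (fst x) (snd (snd x)) v / (1 - fst (snd x) * of_real v))) (half1 \<times> Z \<times> half2)"
proof (rule holo3_integral)
  show o: "open (half1 \<times> Z \<times> half2)"
    by (intro open_Times Z open_halfspace_Re_gt)
  show "continuous_on ((half1 \<times> Z \<times> half2) \<times> {a..b}) (\<lambda>(x, t). ker (fst x) (snd (snd x)) t / (1 - fst (snd x) * complex_of_real t))"
    unfolding split_beta by (intro continuous_intros) (use nz ab in auto)
  show "holo3 (\<lambda>x. ker (fst x) (snd (snd x)) t / (1 - fst (snd x) * complex_of_real t)) (half1 \<times> Z \<times> half2)"
    if t: "t \<in> {a..b}" for t
  proof (intro holo3_intros o)
    show "holo3 (\<lambda>x. ker (fst x) (snd (snd x)) t) (half1 \<times> Z \<times> half2)"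
      unfolding ker_def by (cases "0 < t \<and> t < 1") (auto intro!: holo3_intros o)
  qed (use nz t in auto)
qed

definition Phi0 :: "pt \<Rightarrow> complex" where
  "Phi0 x = rGamma (fst x) * integral {0..1} (\<lambda>v. ker (fst x) (snd (snd x)) v / (1 - fst (snd x) * of_real v))"

lemma holo3_Phi0: "holo3 Phi0 (half1 \<times> slit \<times> half2)"
  unfolding Phi0_def
  by (intro holo3_mult holo3_rGamma holo3_coord holo3_ker_integral open_Times open_slit open_halfspace_Re_gt slit_neq) auto

lemma ker_divide_integrable:
  assumes "1 < Re s" "2 < Re c" "z \<in> slit"
  shows "(\<lambda>v. ker s c v / (1 - z * of_real v) ^ n) integrable_on {0..1}"
  by (intro integrable_continuous_interval continuous_intros) (use assms slit_neq[OF assms(3)] in auto)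

text \<open>Differentiating v^(c - 1) in c produces ln v, which raises the power of - ln v by one
  with a minus sign; the factor s comes from s rGamma (s + 1) = rGamma s.\<close>

lemma Phi0_dc:
  assumes "1 < Re s" "2 < Re c" "z \<in> slit"
  shows "((\<lambda>w. Phi0 (s,z,w)) has_field_derivative - s * Phi0 (s + 1, z, c)) (at c)"
proof -
  have "((\<lambda>w. integral (cbox 0 1) (\<lambda>v. ker s w v / (1 - z * of_real v))) has_field_derivative
     integral (cbox 0 1) (\<lambda>v. - ker (s + 1) c v / (1 - z * of_real v))) (at c within half2)"
  proof (rule leibniz_rule_field_derivative)
    show "((\<lambda>w. ker s w v / (1 - z * of_real v)) has_field_derivative - ker (s + 1) x v / (1 - z * of_real v)) (at x within half2)" for x v
      by (intro DERIV_cdivide DERIV_ker_c)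
    show "(\<lambda>v. ker s x v / (1 - z * of_real v)) integrable_on cbox 0 1" if "x \<in> half2" for x
      using ker_divide_integrable[of s x z 1] assms that by simp
    show "continuous_on (half2 \<times> cbox 0 1) (\<lambda>(x, t). - ker (s + 1) x t / (1 - z * complex_of_real t))"
      unfolding split_beta by (intro continuous_intros) (use assms slit_neq[OF assms(3)] in auto)
  qed (use assms convex_halfspace_Re_gt in auto)
  then have "((\<lambda>w. integral {0..1} (\<lambda>v. ker s w v / (1 - z * of_real v))) has_field_derivative
     integral {0..1} (\<lambda>v. - ker (s + 1) c v / (1 - z * of_real v))) (at c)"
    using at_within_open[of c half2] open_halfspace_Re_gt assms by simp
  from DERIV_cmult[OF this, of "rGamma s"]
  show ?thesis by (simp add: Phi0_def rGamma_plus1[of s, symmetric] mult.assoc)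
qed

abbreviation kint :: "complex \<Rightarrow> complex \<Rightarrow> complex \<Rightarrow> complex" where
  "kint s z c \<equiv> integral {0..1} (\<lambda>v. ker s c v / (1 - z * of_real v))"

text \<open>Integrate the derivative of (- ln v)^s v^c / (1 - z v) over the unit interval; the
  boundary terms vanish.\<close>

lemma ker_parts:
  assumes "1 < Re s" "2 < Re c" "z \<in> slit"
  shows "c * kint (s + 1) z c +
     z * integral {0..1} (\<lambda>v. ker (s + 1) (c + 1) v / (1 - z * of_real v)\<^sup>2) =
     s * kint s z c"
proof -
  note nz = slit_neq[OF assms(3)]
  note ig = ker_divide_integrable[OF _ _ assms(3)]
  have "((\<lambda>v. (c * ker (s + 1) c v - s * ker s c v) / (1 - z * of_real v) + z * (ker (s + 1) (c + 1) v / (1 - z * of_real v)\<^sup>2))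
     has_integral ker (s + 1) (c + 1) 1 / (1 - z * of_real 1) - ker (s + 1) (c + 1) 0 / (1 - z * of_real 0)) {0..1}"
  proof (rule fundamental_theorem_of_calculus_interior)
    show "continuous_on {0..1} (\<lambda>v. ker (s + 1) (c + 1) v / (1 - z * of_real v))"
      by (intro continuous_intros) (use assms nz in auto)
    fix v :: real assume "v \<in> {0<..<1}"
    then have v: "0 < v" "v < 1" by auto
    have n: "1 - z * of_real v \<noteq> 0" using nz v by simp
    have "((\<lambda>v. 1 / (1 - z * of_real v)) has_vector_derivative z / (1 - z * of_real v)\<^sup>2) (at v)"
    proof -
      have "((\<lambda>w. 1 / (1 - z * w)) has_field_derivative z / (1 - z * of_real v)\<^sup>2) (at (of_real v))"
        using n by (auto intro!: derivative_eq_intros simp: power2_eq_square)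
      from has_vector_derivative_real_field[OF this] show ?thesis by simp
    qed
    from has_vector_derivative_mult[OF vector_derivative_ker[OF v, of s c] this]
    show "((\<lambda>v. ker (s + 1) (c + 1) v / (1 - z * of_real v)) has_vector_derivative
       (c * ker (s + 1) c v - s * ker s c v) / (1 - z * of_real v) + z * (ker (s + 1) (c + 1) v / (1 - z * of_real v)\<^sup>2)) (at v)"
      by (simp add: mult.commute add.commute)
  qed simp
  then have "integral {0..1} (\<lambda>v. (c * ker (s + 1) c v - s * ker s c v) / (1 - z * of_real v) + z * (ker (s + 1) (c + 1) v / (1 - z * of_real v)\<^sup>2)) = 0"
    by (simp add: integral_unique)
  moreover have "((\<lambda>v. (c * (ker (s + 1) c v / (1 - z * of_real v)) - s * (ker s c v / (1 - z * of_real v))) + z * (ker (s + 1) (c + 1) v / (1 - z * of_real v)\<^sup>2))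
     has_integral (c * kint (s + 1) z c - s * kint s z c)
     + z * integral {0..1} (\<lambda>v. ker (s + 1) (c + 1) v / (1 - z * of_real v)\<^sup>2)) {0..1}"
    using ig[of "s + 1" c 1] ig[of s c 1] ig[of "s + 1" "c + 1" 2] assms
    by (intro has_integral_add has_integral_diff has_integral_mult_right integrable_integral) auto
  ultimately show ?thesis
    by (simp add: diff_divide_distrib integral_unique) (simp add: algebra_simps)
qed

text \<open>The z-derivative of 1/(1 - z v) is v/(1 - z v)^2. Its extra factor v raises c to c + 1
  in the kernel, and the claim becomes \<open>ker_parts\<close>.\<close>

lemma Phi0_dz:
  assumes "1 < Re s" "2 < Re c" "z \<in> slit"
  shows "z * dz Phi0 (s + 1, z, c) + c * Phi0 (s + 1, z, c) = Phi0 (s, z, c)"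
proof -
  obtain r where r: "r > 0" "ball z r \<subseteq> slit" using openE[OF open_slit assms(3)] .
  have nz: "1 - x * of_real v \<noteq> 0" if "x \<in> ball z r" "0 \<le> v" "v \<le> 1" for x v
    using slit_neq[of x v] that r by blast
  have "((\<lambda>w. integral (cbox 0 1) (\<lambda>v. ker (s + 1) c v / (1 - w * of_real v))) has_field_derivative
     integral (cbox 0 1) (\<lambda>v. ker (s + 1) (c + 1) v / (1 - z * of_real v)\<^sup>2)) (at z within ball z r)"
  proof (rule leibniz_rule_field_derivative)
    show "((\<lambda>w. ker (s + 1) c v / (1 - w * of_real v)) has_field_derivative ker (s + 1) (c + 1) v / (1 - x * of_real v)\<^sup>2) (at x within ball z r)"
      if "x \<in> ball z r" "v \<in> cbox 0 1" for x v
      using nz[of x v] that by (auto intro!: derivative_eq_intros simp: ker_add1 power2_eq_square)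
    show "(\<lambda>v. ker (s + 1) c v / (1 - x * of_real v)) integrable_on cbox 0 1" if "x \<in> ball z r" for x
      using ker_divide_integrable[of "s + 1" c x 1] assms that r by auto
    show "continuous_on (ball z r \<times> cbox 0 1) (\<lambda>(x, t). ker (s + 1) (c + 1) t / (1 - x * complex_of_real t)\<^sup>2)"
      unfolding split_beta by (intro continuous_intros) (use assms nz in auto)
  qed (use r in auto)
  then have "((\<lambda>w. integral {0..1} (\<lambda>v. ker (s + 1) c v / (1 - w * of_real v))) has_field_derivative
     integral {0..1} (\<lambda>v. ker (s + 1) (c + 1) v / (1 - z * of_real v)\<^sup>2)) (at z)"
    using at_within_open[of z "ball z r"] r by simp
  from DERIV_cmult[OF this, of "rGamma (s + 1)"]
  have "dz Phi0 (s + 1, z, c) = rGamma (s + 1) * integral {0..1} (\<lambda>v. ker (s + 1) (c + 1) v / (1 - z * of_real v)\<^sup>2)"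
    unfolding dz_def Phi0_def by (simp add: DERIV_imp_deriv)
  then have "z * dz Phi0 (s + 1, z, c) + c * Phi0 (s + 1, z, c) = rGamma (s + 1) *
     (c * kint (s + 1) z c +
     z * integral {0..1} (\<lambda>v. ker (s + 1) (c + 1) v / (1 - z * of_real v)\<^sup>2))"
    by (simp add: Phi0_def algebra_simps)
  also have "\<dots> = Phi0 (s, z, c)"
    unfolding ker_parts[OF assms] by (simp add: Phi0_def rGamma_plus1[of s, symmetric])
  finally show ?thesis .
qed

section \<open>Agreement of the integral with the defining series\<close>

lemma ker_integral_3:
  assumes s: "1 < Re s"
  shows "integral {0..1} (ker s 3) = Gamma s * exp (- s * of_real (ln 3))"
proof -
  let ?J = "\<lambda>n. integral {exp (- real n / 3)..1} (ker s 3)"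
  define f where "f = (\<lambda>t. complex_of_real t powr (s - 1) / of_real (exp t))"
  have fi: "(f has_integral Gamma s) {0..}" unfolding f_def by (rule Gamma_integral_complex) (use s in simp)
  have "f absolutely_integrable_on {0<..}"
    unfolding f_def by (rule absolutely_integrable_Gamma_integral') (use s in simp)
  then have "(\<lambda>t. norm (f t)) integrable_on {0<..}" by (simp add: absolutely_integrable_on_def)
  then have fa: "(\<lambda>t. norm (f t)) integrable_on {0..}"
    by (rule integrable_spike_set) (auto intro: negligible_subset[OF negligible_sing[of 0]])
  have ck: "continuous_on {0..1} (ker s 3)"
    by (intro continuous_intros) (use s in auto)
  have ik: "ker s 3 integrable_on {0..1}" by (rule integrable_continuous_interval[OF ck])
  \<comment> \<open>The substitution v = exp (- t/3) turns v^2 dv into exp (- t) dt up to the factor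
    - 1/3. It is carried out on [0,n], and dominated convergence then gives the full Gamma
    integral.\<close>
  have fn: "(f has_integral exp (s * of_real (ln 3)) * ?J n) {0..real n}" for n
  proof -
    have "((\<lambda>t. (- exp (- t / 3) / 3) *\<^sub>R ker s 3 (exp (- t / 3))) has_integral
       (integral {exp (- 0 / 3)..exp (- real n / 3)} (ker s 3) - integral {exp (- real n / 3)..exp (- 0 / 3)} (ker s 3))) {0..real n}"
    proof (rule has_integral_substitution_general[where s = "{}" and c = 0 and d = 1])
      show "((\<lambda>t. exp (- t / 3)) has_field_derivative - exp (- x / 3) / 3) (at x within {0..real n})" for x
        by (auto intro!: derivative_eq_intros)
    qed (auto intro!: continuous_intros ck)
    \<comment> \<open>The substitution rule returns both orientations; the interval of the wrong one
      is empty, or a single point when n = 0.\<close>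
    moreover have "integral {exp (- 0 / 3)..exp (- real n / 3)} (ker s 3) = 0"
    proof (cases "n = 0")
      case False
      then have "{exp (- 0 / 3)..exp (- real n / 3)} = {}" by simp
      then show ?thesis by (metis integral_empty)
    qed simp
    ultimately have "((\<lambda>t. (- exp (- t / 3) / 3) *\<^sub>R ker s 3 (exp (- t / 3))) has_integral
       - ?J n) {0..real n}" by simp
    from has_integral_mult_right[OF this, of "- exp (s * of_real (ln 3))"]
    have "((\<lambda>t. - exp (s * of_real (ln 3)) * ((- exp (- t / 3) / 3) *\<^sub>R ker s 3 (exp (- t / 3)))) has_integral
       exp (s * of_real (ln 3)) * ?J n) {0..real n}" by simp
    then show ?thesis
    proof (rule has_integral_eq[rotated])
      fix t assume t: "t \<in> {0..real n}"
      show "- exp (s * of_real (ln 3)) * ((- exp (- t / 3) / 3) *\<^sub>R ker s 3 (exp (- t / 3))) = f t"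
      proof (cases "t = 0")
        case False
        then have t: "t > 0" using t by simp
        have 1: "complex_of_real (exp (- t / 3) / 3) = exp (of_real (- t / 3 - ln 3))"
          unfolding exp_of_real by (simp add: exp_diff)
        have 2: "ker s 3 (exp (- t / 3)) = exp ((s - 1) * of_real (ln t - ln 3) + 2 * of_real (- t / 3))"
          using t by (simp add: ker_def ln_div)
        have 3: "f t = exp ((s - 1) * of_real (ln t) - of_real t)"
          using t by (simp add: f_def powr_def exp_diff Ln_of_real flip: exp_of_real)
        have "- exp (s * of_real (ln 3)) * ((- exp (- t / 3) / 3) *\<^sub>R ker s 3 (exp (- t / 3))) =
          exp (s * of_real (ln 3)) * (of_real (exp (- t / 3) / 3) * ker s 3 (exp (- t / 3)))"
          by (simp add: scaleR_conv_of_real)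
        also have "\<dots> = exp (s * of_real (ln 3) + (of_real (- t / 3 - ln 3) + ((s - 1) * of_real (ln t - ln 3) + 2 * of_real (- t / 3))))"
          unfolding 1 2 by (simp only: exp_add)
        also have "\<dots> = f t" unfolding 3 by (rule arg_cong[where f = exp]) (simp add: algebra_simps)
        finally show ?thesis .
      qed (simp add: f_def)
    qed
  qed
  define g where "g = (\<lambda>n::nat. \<lambda>t. if t \<in> {0..real n} then f t else 0)"
  have gint: "(g n has_integral exp (s * of_real (ln 3)) * ?J n) {0..}" for n
    unfolding g_def by (subst has_integral_restrict) (use fn in auto)
  have "(\<lambda>n. integral {0..} (g n)) \<longlonglongrightarrow> integral {0..} f"
  proof (rule dominated_convergence(2))
    show "(\<lambda>t. norm (f t)) integrable_on {0..}" by (rule fa)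
    show "g k integrable_on {0..}" for k using gint by blast
    show "norm (g k x) \<le> norm (f x)" for k x by (simp add: g_def)
    show "(\<lambda>k. g k x) \<longlonglongrightarrow> f x" if "x \<in> {0..}" for x
    proof (rule tendsto_eventually)
      show "\<forall>\<^sub>F k in sequentially. g k x = f x"
        using eventually_ge_at_top[of "nat \<lceil>x\<rceil>"] by eventually_elim (use that in \<open>auto simp: g_def nat_le_iff ceiling_le_iff\<close>)
    qed
  qed
  then have l1: "(\<lambda>n. exp (s * of_real (ln 3)) * ?J n) \<longlonglongrightarrow> Gamma s"
    unfolding integral_unique[OF gint] integral_unique[OF fi] .
  have "continuous_on {0..1} (\<lambda>x. integral {x..1} (ker s 3))"
    by (rule indefinite_integral_continuous_1'[OF ik])
  moreover have "(\<lambda>n. exp (- real n / 3)) \<longlonglongrightarrow> 0" by real_asymp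
  ultimately have "(\<lambda>n. ?J n) \<longlonglongrightarrow> integral {0..1} (ker s 3)"
    by (rule continuous_on_tendsto_compose) auto
  from LIMSEQ_unique[OF tendsto_mult_left[OF this] l1]
  have "exp (s * of_real (ln 3)) * integral {0..1} (ker s 3) = Gamma s" .
  then show ?thesis by (simp add: exp_minus field_simps)
qed

text \<open>The integral times c^s has derivative 0 in c, by \<open>ker_parts\<close> at z = 0. It
  is therefore constant on the half-plane and can be evaluated at the real point c = 3.\<close>

lemma ker_integral:
  assumes s: "1 < Re s" and c: "2 < Re c"
  shows "rGamma s * integral {0..1} (ker s c) = c powr (- s)"
proof -
  define q where "q = (\<lambda>c. integral {0..1} (ker s c) * exp (s * Ln c))"
  have "(q has_field_derivative 0) (at c within half2)" if "c \<in> half2" for c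
  proof -
    have c: "2 < Re c" "c \<noteq> 0" using that by auto
    have "((\<lambda>w. integral (cbox 0 1) (ker s w)) has_field_derivative
       integral (cbox 0 1) (\<lambda>v. - ker (s + 1) c v)) (at c within half2)"
    proof (rule leibniz_rule_field_derivative)
      show "((\<lambda>w. ker s w v) has_field_derivative - ker (s + 1) x v) (at x within half2)" for x v
        by (rule DERIV_ker_c)
      show "ker s x integrable_on cbox 0 1" if "x \<in> half2" for x
        using ker_divide_integrable[of s x 0 1] s that by simp
      show "continuous_on (half2 \<times> cbox 0 1) (\<lambda>(x, t). - ker (s + 1) x t)"
        unfolding split_beta by (intro continuous_intros) (use s in auto)
    qed (use c convex_halfspace_Re_gt in auto)
    then have d1: "((\<lambda>w. integral {0..1} (ker s w)) has_field_derivative - integral {0..1} (ker (s + 1) c)) (at c within half2)"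
      by simp
    have "c \<notin> \<real>\<^sub>\<le>\<^sub>0" using c by (auto simp: complex_nonpos_Reals_iff)
    then have d2: "((\<lambda>w. exp (s * Ln w)) has_field_derivative exp (s * Ln c) * (s / c)) (at c within half2)"
      by (auto intro!: derivative_eq_intros simp: divide_inverse)
    have e: "c * integral {0..1} (ker (s + 1) c) = s * integral {0..1} (ker s c)"
      using ker_parts[OF s c(1), of 0] by simp
    have "- integral {0..1} (ker (s + 1) c) * exp (s * Ln c) + exp (s * Ln c) * (s / c) * integral {0..1} (ker s c) =
      exp (s * Ln c) / c * (s * integral {0..1} (ker s c) - c * integral {0..1} (ker (s + 1) c))"
      using c by (simp add: field_simps)
    also have "\<dots> = 0" by (simp add: e)
    finally show ?thesis using DERIV_mult[OF d1 d2] unfolding q_def by (simp add: mult.commute add.commute)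
  qed
  then obtain k where k: "\<And>c. c \<in> half2 \<Longrightarrow> q c = k"
    using has_field_derivative_zero_constant[OF convex_halfspace_Re_gt, of 2 q] by auto
  have "q c = q 3" using k c by simp
  also have "q 3 = Gamma s * exp (- s * of_real (ln 3)) * exp (s * of_real (ln 3))"
    using ker_integral_3[OF s] Ln_of_real[of 3] by (simp add: q_def)
  also have "\<dots> = Gamma s" by (simp add: exp_minus)
  finally have "integral {0..1} (ker s c) * exp (s * Ln c) = Gamma s" by (simp add: q_def)
  then have "integral {0..1} (ker s c) = Gamma s * exp (- s * Ln c)" by (simp add: exp_minus field_simps)
  moreover have "rGamma s * Gamma s = 1"
  proof -
    have "s \<notin> \<int>\<^sub>\<le>\<^sub>0" using s by (auto elim!: nonpos_Ints_cases)
    then show ?thesis by (simp add: Gamma_def rGamma_eq_zero_iff)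
  qed
  ultimately show ?thesis using c by (auto simp: powr_def)
qed

text \<open>Expand 1/(1 - z v) into a geometric series under the integral. A bound \<open>M\<close>
  of the kernel times 1/(1 - |z|) dominates the partial sums, and the factor v^k of the k-th term
  moves c to c + k.\<close>

lemma Phi0_sums:
  assumes s: "1 < Re s" and c: "2 < Re c" and z: "norm z < 1"
  shows "(\<lambda>n. z ^ n * (of_nat n + c) powr (- s)) sums Phi0 (s,z,c)"
proof -
  have ck: "continuous_on {0..1} (ker s c)"
    by (intro continuous_intros) (use s c in auto)
  have "compact (ker s c ` {0..1})" by (intro compact_continuous_image ck compact_Icc)
  then obtain M where M: "\<And>v. v \<in> {0..1} \<Longrightarrow> norm (ker s c v) \<le> M"
    using compact_imp_bounded bounded_iff by (metis imageI)
  then have M0: "0 \<le> M" using norm_ge_zero by (metis atLeastAtMost_iff order.refl order_trans zero_le_one)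
  have zv: "norm (z * of_real v) \<le> norm z" if "v \<in> {0..1}" for v
    using that by (simp add: norm_mult mult_left_le)
  define f where "f = (\<lambda>n v. \<Sum>k<n. ker s c v * (z * of_real v) ^ k)"
  have trm: "((\<lambda>v. ker s c v * (z * of_real v) ^ k) has_integral z ^ k * integral {0..1} (ker s (c + of_nat k))) {0..1}" for k
  proof -
    have "ker s (c + of_nat k) integrable_on {0..1}"
      using ker_divide_integrable[of s "c + of_nat k" 0 1] s c by simp
    from has_integral_mult_right[OF integrable_integral[OF this], of "z ^ k"]
    show ?thesis by (rule has_integral_eq[rotated]) (simp add: ker_times_power power_mult_distrib)
  qed
  from trm have fint: "(f n has_integral (\<Sum>k<n. z ^ k * integral {0..1} (ker s (c + of_nat k)))) {0..1}" for n
    unfolding f_def by (intro has_integral_sum) auto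
  have "(\<lambda>n. integral {0..1} (f n)) \<longlonglongrightarrow> kint s z c"
  proof (rule dominated_convergence(2))
    show "(\<lambda>v. M * (1 / (1 - norm z))) integrable_on {0..1::real}" by (rule integrable_const_ivl)
    show "f k integrable_on {0..1}" for k using fint by blast
    show "norm (f n v) \<le> M * (1 / (1 - norm z))" if "v \<in> {0..1}" for n v
    proof -
      have "norm (f n v) \<le> (\<Sum>k<n. M * norm z ^ k)"
        unfolding f_def
        by (intro sum_norm_le) (use M0 M[OF that] zv[OF that] in \<open>auto simp: norm_mult norm_power intro!: mult_mono power_mono\<close>)
      also have "\<dots> = M * (\<Sum>k<n. norm z ^ k)" by (simp add: sum_distrib_left)
      also have "\<dots> \<le> M * (1 / (1 - norm z))"
      proof (rule mult_left_mono)
        have "(\<Sum>k<n. norm z ^ k) \<le> (\<Sum>k. norm z ^ k)"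
          using z by (intro sum_le_suminf summable_geometric) auto
        then show "(\<Sum>k<n. norm z ^ k) \<le> 1 / (1 - norm z)" using z by (simp add: suminf_geometric)
        show "0 \<le> M" by (rule M0)
      qed
      finally show ?thesis .
    qed
    show "(\<lambda>n. f n v) \<longlonglongrightarrow> ker s c v / (1 - z * of_real v)" if "v \<in> {0..1}" for v
    proof -
      have "norm (z * of_real v) < 1" using zv[OF that] z by linarith
      from sums_mult[OF geometric_sums[OF this], of "ker s c v"]
      show ?thesis by (simp add: sums_def f_def)
    qed
  qed
  then have "(\<lambda>n. rGamma s * (\<Sum>k<n. z ^ k * integral {0..1} (ker s (c + of_nat k)))) \<longlonglongrightarrow> Phi0 (s,z,c)"
    unfolding integral_unique[OF fint] by (simp add: Phi0_def tendsto_mult_left)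
  moreover have "rGamma s * (\<Sum>k<n. z ^ k * integral {0..1} (ker s (c + of_nat k))) = (\<Sum>k<n. z ^ k * (of_nat k + c) powr (- s))" for n
    unfolding sum_distrib_left
  proof (rule sum.cong[OF refl])
    fix k
    have "rGamma s * integral {0..1} (ker s (c + of_nat k)) = (of_nat k + c) powr (- s)"
      using ker_integral[of s "c + of_nat k"] s c by (simp add: add.commute)
    then show "rGamma s * (z ^ k * integral {0..1} (ker s (c + of_nat k))) = z ^ k * (of_nat k + c) powr (- s)"
      by (simp add: mult.left_commute)
  qed
  ultimately show ?thesis by (simp add: sums_def)
qed

section \<open>Continuation in s\<close>

lemma deriv_eq_on_open:
  assumes "open U" "\<And>y. y \<in> U \<Longrightarrow> f y = g y" "x \<in> U"
  shows "dz f x = dz g x" "dc f x = dc g x"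
proof -
  obtain s z c where x: "x = (s,z,c)" by (cases x)
  obtain r where r: "r > 0" "\<forall>x\<in>cball s r. \<forall>y\<in>cball z r. \<forall>w\<in>cball c r. (x,y,w) \<in> U"
    using open_pt_box[OF assms(1)] assms(3) x by blast
  have "\<forall>\<^sub>F w in nhds z. w \<in> ball z r" "\<forall>\<^sub>F w in nhds c. w \<in> ball c r"
    using r by (intro eventually_nhds_in_open; simp)+
  then have "\<forall>\<^sub>F w in nhds z. f (s,w,c) = g (s,w,c)" "\<forall>\<^sub>F w in nhds c. f (s,z,w) = g (s,z,w)"
    using r assms(2) by (auto elim!: eventually_mono)
  then show "dz f x = dz g x" "dc f x = dc g x"
    by (auto simp: dz_def dc_def x intro!: deriv_cong_ev)
qed

definition Tz :: "(pt \<Rightarrow> complex) \<Rightarrow> pt \<Rightarrow> complex" where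
  "Tz f x = fst (snd x) * dz f x + snd (snd x) * f x"

lemma holo3_Tz: "holo3 f U \<Longrightarrow> holo3 (Tz f) U"
  unfolding Tz_def by (intro holo3_intros holo3_dz) (auto dest: holo3_open)

lemma Tz_cong:
  assumes "open U" "\<And>y. y \<in> U \<Longrightarrow> f y = g y" "x \<in> U"
  shows "Tz f x = Tz g x"
  using deriv_eq_on_open[OF assms] assms by (simp add: Tz_def)

text \<open>The relation \<open>(z \<partial>/\<partial>z + c) f(s + 1, z, c) = f(s, z, c)\<close> moves the half-plane of
  definition in \<open>s\<close> one unit to the left.\<close>

definition s_step :: "(pt \<Rightarrow> complex) \<Rightarrow> pt \<Rightarrow> complex" where
  "s_step f x = Tz f (fst x + 1, snd x)"

text \<open>After n steps the half-plane is Re s > 1 - n. The number of steps varies with the point,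
  and the 2 under the ceiling makes the inequality strict; further steps change nothing, so the
  pieces fit together.\<close>

definition s_extend :: "(pt \<Rightarrow> complex) \<Rightarrow> pt \<Rightarrow> complex" where
  "s_extend f x = (s_step ^^ nat \<lceil>2 - Re (fst x)\<rceil>) f x"

lemma open_half_Times: "open V \<Longrightarrow> open ({s. a < Re s} \<times> V)"
  by (intro open_Times open_halfspace_Re_gt)

context
  fixes f :: "pt \<Rightarrow> complex" and V :: "(complex \<times> complex) set"
  assumes f: "holo3 f (half1 \<times> V)" and V: "open V"
    and rel: "\<And>x. x \<in> half1 \<times> V \<Longrightarrow> Tz f (fst x + 1, snd x) = f x"
begin

text \<open>Stability reproduces itself: since \<open>?f'\<close> agrees with \<open>?f\<close> on
  the old half-plane, both have the same image under \<open>s_step\<close> one unit further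
  left.\<close>

lemma s_step_iterate:
  "holo3 ((s_step ^^ n) f) ({s. 1 - real n < Re s} \<times> V) \<and>
   (\<forall>x\<in>{s. 1 - real n < Re s} \<times> V. (s_step ^^ Suc n) f x = (s_step ^^ n) f x)"
proof (induction n)
  case 0
  then show ?case using f rel by (auto simp: s_step_def)
next
  case (Suc n)
  let ?D = "{s. 1 - real n < Re s} \<times> V" and ?D' = "{s. 1 - real (Suc n) < Re s} \<times> V"
  let ?f = "(s_step ^^ n) f" and ?f' = "(s_step ^^ Suc n) f"
  have "holo3 (\<lambda>x. Tz ?f (fst x + 1, fst (snd x), snd (snd x) + 0)) {x. (fst x + 1, fst (snd x), snd (snd x) + 0) \<in> ?D}"
    by (intro holo3_shift holo3_Tz) (use Suc in blast)
  then have "holo3 ?f' ?D'"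
    by (rule holo3_cong[OF holo3_subset]) (auto simp: s_step_def V open_half_Times)
  moreover have "s_step ?f' x = ?f' x" if "x \<in> ?D'" for x
  proof -
    have m: "(fst x + 1, snd x) \<in> ?D" using that by auto
    have "Tz ?f' (fst x + 1, snd x) = Tz ?f (fst x + 1, snd x)"
      by (rule Tz_cong[OF open_half_Times[OF V] _ m]) (use Suc in blast)
    then show ?thesis by (simp add: s_step_def)
  qed
  ultimately show ?case by simp
qed

lemma s_step_stable:
  assumes "x \<in> {s. 1 - real n < Re s} \<times> V"
  shows "(s_step ^^ (n + k)) f x = (s_step ^^ n) f x"
proof (induction k)
  case (Suc k)
  have "x \<in> {s. 1 - real (n + k) < Re s} \<times> V" using assms by auto
  then have "(s_step ^^ Suc (n + k)) f x = (s_step ^^ (n + k)) f x" using s_step_iterate[of "n + k"] by blast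
  then show ?case using Suc by simp
qed simp

lemma s_extend_eq:
  assumes "x \<in> {s. 1 - real n < Re s} \<times> V"
  shows "s_extend f x = (s_step ^^ n) f x"
proof -
  define m where "m = nat \<lceil>2 - Re (fst x)\<rceil>"
  have "1 - real m < Re (fst x)" unfolding m_def by linarith
  then have m: "x \<in> {s. 1 - real m < Re s} \<times> V" using assms by auto
  show ?thesis
    using s_step_stable[OF m, of "n - m"] s_step_stable[OF assms, of "m - n"] 
    unfolding s_extend_def m_def[symmetric] by (cases "n \<le> m") auto
qed

lemma s_extend_half: "x \<in> half1 \<times> V \<Longrightarrow> s_extend f x = f x"
  using s_extend_eq[of x 0] by simp

lemma ex_half: "\<exists>n. s \<in> {s. 1 - real n < Re s}"
proof -
  have "s \<in> {s. 1 - real (nat \<lceil>2 - Re s\<rceil>) < Re s}" by simp linarith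
  then show ?thesis by blast
qed

lemma holo3_s_extend: "holo3 (s_extend f) (UNIV \<times> V)"
proof (rule holo3_localI)
  show "open (UNIV \<times> V)" using V by (simp add: open_Times)
  fix x :: pt assume x: "x \<in> UNIV \<times> V"
  obtain n where "fst x \<in> {s. 1 - real n < Re s}" using ex_half by blast
  then show "\<exists>W g. x \<in> W \<and> holo3 g W \<and> (\<forall>y\<in>W. s_extend f y = g y)"
    using x s_extend_eq[of _ n] s_step_iterate[of n]
    by (intro exI[of _ "{s. 1 - real n < Re s} \<times> V"] exI[of _ "(s_step ^^ n) f"]) auto
qed

lemma Tz_s_extend:
  assumes x: "x \<in> UNIV \<times> V"
  shows "Tz (s_extend f) x = s_extend f (fst x - 1, snd x)"
proof -
  obtain n where n: "fst x - 1 \<in> {s. 1 - real n < Re s}" using ex_half by blast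
  have m: "(fst x - 1, snd x) \<in> {s. 1 - real (Suc n) < Re s} \<times> V" "x \<in> {s. 1 - real n < Re s} \<times> V"
    using n x by auto
  have "s_extend f (fst x - 1, snd x) = Tz ((s_step ^^ n) f) x"
    using s_extend_eq[OF m(1)] by (simp add: s_step_def)
  also have "\<dots> = Tz (s_extend f) x"
    by (rule Tz_cong[OF open_half_Times[OF V] _ m(2)]) (use s_extend_eq in auto)
  finally show ?thesis by simp
qed

end

text \<open>The identity theorem in s alone, for each fixed pair (z,c). Identities known for Re s >
  1 thereby pass to all s.\<close>

lemma eq_on_half_imp_eq:
  assumes f: "holo3 f (UNIV \<times> V)" and g: "holo3 g (UNIV \<times> V)"
    and eq: "\<And>x. x \<in> half1 \<times> V \<Longrightarrow> f x = g x" and x: "x \<in> UNIV \<times> V"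
  shows "f x = g x"
proof -
  obtain s z c where x': "x = (s,z,c)" "(z,c) \<in> V" using x by (cases x) auto
  have h: "(\<lambda>w. f (w,z,c)) holomorphic_on UNIV" "(\<lambda>w. g (w,z,c)) holomorphic_on UNIV"
    by (intro holomorphic_onI_at holo3_fd[OF f] holo3_fd[OF g]; use x' in auto)+
  have "(2::complex) \<in> half1" by simp
  then have ne: "half1 \<noteq> {}" by blast
  show ?thesis unfolding x'(1)
    by (rule analytic_continuation_open[where s = half1 and s' = UNIV and f = "\<lambda>w. f (w,z,c)"])
       (use eq h x' ne open_halfspace_Re_gt in auto)
qed

definition Phi :: "pt \<Rightarrow> complex" where "Phi = s_extend Phi0"

lemma open_slit_half: "open (slit \<times> half2)"
  by (intro open_Times open_slit open_halfspace_Re_gt)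

lemma Phi0_rel: "x \<in> half1 \<times> slit \<times> half2 \<Longrightarrow> Tz Phi0 (fst x + 1, snd x) = Phi0 x"
  using Phi0_dz by (auto simp: Tz_def)

lemma holo3_Phi: "holo3 Phi (UNIV \<times> slit \<times> half2)"
  and Phi_eq_Phi0: "x \<in> half1 \<times> slit \<times> half2 \<Longrightarrow> Phi x = Phi0 x"
  and Tz_Phi: "x \<in> UNIV \<times> slit \<times> half2 \<Longrightarrow> Tz Phi x = Phi (fst x - 1, snd x)"
  unfolding Phi_def
  using holo3_s_extend[OF holo3_Phi0 open_slit_half Phi0_rel] s_extend_half[OF holo3_Phi0 open_slit_half Phi0_rel]
    Tz_s_extend[OF holo3_Phi0 open_slit_half Phi0_rel] by blast+

lemma dc_Phi:
  assumes x: "x \<in> UNIV \<times> slit \<times> half2"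
  shows "dc Phi x = - fst x * Phi (fst x + 1, snd x)"
proof (rule eq_on_half_imp_eq[OF _ _ _ x])
  show "holo3 (dc Phi) (UNIV \<times> slit \<times> half2)" by (rule holo3_dc[OF holo3_Phi])
  have o: "open ((UNIV::complex set) \<times> slit \<times> half2)" using holo3_Phi holo3_open by blast
  have "holo3 (\<lambda>x. Phi (fst x + 1, fst (snd x), snd (snd x) + 0)) (UNIV \<times> slit \<times> half2)"
    by (rule holo3_subset[OF holo3_shift[OF holo3_Phi] o]) auto
  then show "holo3 (\<lambda>x. - fst x * Phi (fst x + 1, snd x)) (UNIV \<times> slit \<times> half2)"
    by (intro holo3_intros o) simp
  fix x assume x: "x \<in> half1 \<times> slit \<times> half2"
  then obtain s z c where x': "x = (s,z,c)" "1 < Re s" "z \<in> slit" "2 < Re c" by (cases x) auto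
  have "dc Phi x = dc Phi0 x"
    by (rule deriv_eq_on_open(2)[OF open_half_Times[OF open_slit_half] _ x]) (use Phi_eq_Phi0 in blast)
  also have "\<dots> = - s * Phi0 (s + 1, z, c)"
    using DERIV_imp_deriv[OF Phi0_dc[OF x'(2,4,3)]] by (simp add: dc_def x')
  also have "\<dots> = - fst x * Phi (fst x + 1, snd x)"
    using x' Phi_eq_Phi0[of "(s+1,z,c)"] by simp
  finally show "dc Phi x = - fst x * Phi (fst x + 1, snd x)" .
qed

section \<open>The branch across the cut\<close>

text \<open>Up to sign this is 2 pi i times the residue of the integrand at v = 1/z, divided by
  Gamma(s): the function 2 pi i (log z)^(s - 1) z^(- c) / Gamma(s) with principal logarithms, used
  where Re z > 1.\<close>

definition cut_jump :: "pt \<Rightarrow> complex" where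
  "cut_jump x = 2 * of_real pi * \<i> * (rGamma (fst x) * exp ((fst x - 1) * Ln (Ln (fst (snd x))) - snd (snd x) * Ln (fst (snd x))))"

text \<open>Continuation of \<open>ker\<close> to complex v. For Re w > 0 and |w| < 1 the number -
  Ln w has positive real part, so both principal logarithms are holomorphic there.\<close>

definition kerc :: "complex \<Rightarrow> complex \<Rightarrow> complex \<Rightarrow> complex" where
  "kerc s c w = exp ((s - 1) * Ln (- Ln w) + (c - 1) * Ln w)"

definition kerc_deriv :: "complex \<Rightarrow> complex \<Rightarrow> complex \<Rightarrow> complex" where
  "kerc_deriv s c w = kerc s c w * ((s - 1) / (w * Ln w) + (c - 1) / w)"

lemma unit_half_Ln:
  assumes "0 < Re w" "norm w < 1"
  shows "w \<noteq> 0" "w \<notin> \<real>\<^sub>\<le>\<^sub>0" "0 < Re (- Ln w)" "- Ln w \<notin> \<real>\<^sub>\<le>\<^sub>0" "Ln w \<noteq> 0"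
proof -
  show w: "w \<noteq> 0" using assms by auto
  show "w \<notin> \<real>\<^sub>\<le>\<^sub>0" using assms by (auto simp: complex_nonpos_Reals_iff)
  have "ln (norm w) < 0" using w assms by simp
  then show r: "0 < Re (- Ln w)" using w by simp
  then show "- Ln w \<notin> \<real>\<^sub>\<le>\<^sub>0" "Ln w \<noteq> 0" by (auto simp: complex_nonpos_Reals_iff)
qed

lemma kerc_of_real: "0 < v \<Longrightarrow> v < 1 \<Longrightarrow> kerc s c (of_real v) = ker s c v"
proof -
  assume v: "0 < v" "v < 1"
  have "Ln (- Ln (of_real v)) = of_real (ln (- ln v))"
    using v Ln_of_real[of "- ln v"] by (simp add: Ln_of_real)
  then show ?thesis using v by (simp add: kerc_def ker_def Ln_of_real)
qed

lemma DERIV_kerc: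
  assumes "0 < Re w" "norm w < 1"
  shows "(kerc s c has_field_derivative kerc_deriv s c w) (at w)"
  unfolding kerc_def kerc_deriv_def using unit_half_Ln[OF assms]
  by (auto intro!: derivative_eq_intros simp: field_simps)

lemma holo3_kerc_kd:
  assumes w: "holo3 w U" and uw: "\<And>x. x \<in> U \<Longrightarrow> 0 < Re (w x) \<and> norm (w x) < 1"
  shows "holo3 (\<lambda>x. kerc (fst x) (snd (snd x)) (w x)) U"
    and "holo3 (\<lambda>x. kerc_deriv (fst x) (snd (snd x)) (w x)) U"
proof -
  have n: "w x \<noteq> 0" "w x \<notin> \<real>\<^sub>\<le>\<^sub>0" "- Ln (w x) \<notin> \<real>\<^sub>\<le>\<^sub>0" "Ln (w x) \<noteq> 0" if "x \<in> U" for x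
    using unit_half_Ln uw[OF that] by blast+
  show 1: "holo3 (\<lambda>x. kerc (fst x) (snd (snd x)) (w x)) U"
    unfolding kerc_def by (intro holo3_intros holo3_Ln w holo3_open[OF w] n)
  show "holo3 (\<lambda>x. kerc_deriv (fst x) (snd (snd x)) (w x)) U"
    unfolding kerc_deriv_def by (intro holo3_intros holo3_Ln w holo3_open[OF w] 1) (use n in auto)
qed

lemma continuous_on_kerc_deriv:
  assumes "continuous_on A f" "continuous_on A g" "continuous_on A w"
    and uw: "\<And>x. x \<in> A \<Longrightarrow> 0 < Re (w x) \<and> norm (w x) < 1"
  shows "continuous_on A (\<lambda>x. kerc_deriv (f x) (g x) (w x))"
proof -
  have n: "w x \<noteq> 0" "w x \<notin> \<real>\<^sub>\<le>\<^sub>0" "- Ln (w x) \<notin> \<real>\<^sub>\<le>\<^sub>0" "Ln (w x) \<noteq> 0" if "x \<in> A" for x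
    using unit_half_Ln uw[OF that] by blast+
  show ?thesis
    unfolding kerc_deriv_def kerc_def by (intro continuous_intros assms n) (use n in auto)
qed

text \<open>The mean of the derivative over the segment from p to v is the difference quotient in a
  form that stays holomorphic through v = p. This removes the pole.\<close>

lemma kerc_diff_quotient:
  assumes B: "convex B" "\<And>w. w \<in> B \<Longrightarrow> 0 < Re w \<and> norm w < 1" and pv: "p \<in> B" "v \<in> B"
  shows "(v - p) * integral {0..1} (\<lambda>t. kerc_deriv s c (p + of_real t * (v - p))) = kerc s c v - kerc s c p"
proof -
  have m: "p + of_real t * (v - p) \<in> B" if "t \<in> {0..1}" for t
    using convexD_alt[OF B(1) pv, of t] that by (simp add: scaleR_conv_of_real algebra_simps)
  have "((\<lambda>t. (v - p) * kerc_deriv s c (p + of_real t * (v - p))) has_integral kerc s c (p + of_real 1 * (v - p)) - kerc s c (p + of_real 0 * (v - p))) {0..1}"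
  proof (rule fundamental_theorem_of_calculus)
    fix t :: real assume t: "t \<in> {0..1}"
    have "((\<lambda>t. p + of_real t * (v - p)) has_vector_derivative (v - p)) (at t within {0..1})"
      by (auto intro!: derivative_eq_intros)
    moreover have "(kerc s c has_field_derivative kerc_deriv s c (p + of_real t * (v - p))) (at (p + of_real t * (v - p)) within (\<lambda>t. p + of_real t * (v - p)) ` {0..1})"
      using DERIV_kerc m[OF t] B(2) by (blast intro: has_field_derivative_at_within)
    ultimately show "((\<lambda>t. kerc s c (p + of_real t * (v - p))) has_vector_derivative (v - p) * kerc_deriv s c (p + of_real t * (v - p))) (at t within {0..1})"
      using field_vector_diff_chain_within[of "\<lambda>t. p + of_real t * (v - p)"] by (simp add: o_def)
  qed simp
  from integral_unique[OF this] show ?thesis by simp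
qed

lemma cut_integral_Ln:
  assumes "Im p \<noteq> 0" "a \<le> b"
  shows "((\<lambda>v. 1 / (of_real v - p)) has_integral Ln (of_real b - p) - Ln (of_real a - p)) {a..b}"
proof (rule fundamental_theorem_of_calculus[OF assms(2)])
  fix v :: real
  have n: "of_real v - p \<notin> \<real>\<^sub>\<le>\<^sub>0" using assms by (auto simp: complex_nonpos_Reals_iff)
  have "((\<lambda>w. Ln (w - p)) has_field_derivative 1 / (of_real v - p)) (at (of_real v))"
    using n by (auto intro!: derivative_eq_intros simp: divide_inverse)
  from has_vector_derivative_real_field[OF this]
  show "((\<lambda>v. Ln (of_real v - p)) has_vector_derivative 1 / (of_real v - p)) (at v within {a..b})"
    by (rule has_vector_derivative_at_within)
qed

text \<open>When p crosses the real axis to the right of a, \<open>Ln (a - p)\<close> jumps while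
  \<open>Ln (p - a)\<close> does not; the term with i pi carries the whole jump.\<close>

lemma Ln_flip:
  assumes "Im p \<noteq> 0"
  shows "Ln (of_real a - p) = Ln (p - of_real a) + (if Im p > 0 then - (\<i> * of_real pi) else \<i> * of_real pi)"
proof -
  have "p - of_real a \<noteq> 0" using assms by auto
  from Ln_minus[OF this] show ?thesis using assms by (auto split: if_splits)
qed

text \<open>The pole p = 1/z stays near v0 = 1/x0, so only a middle interval [a,b] needs care. There
  kerc(v) = kerc(p) + (v - p) q: the part with q gives a holomorphic integral, and the other part
  gives log(b - p) - log(a - p), whose two boundary values differ by 2 pi i. Keeping the value from
  above the cut defines \<open>L\<close>.\<close>

lemma branch_exists:
  fixes x0 :: real
  assumes x0: "x0 > 1"
  shows "\<exists>r L. 0 < r \<and> r \<le> x0 - 1 \<and> holo3 L (half1 \<times> ball (of_real x0) r \<times> half2) \<and>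
    (\<forall>x\<in>half1 \<times> ball (of_real x0) r \<times> half2. (Im (fst (snd x)) > 0 \<longrightarrow> L x = Phi0 x) \<and>
       (Im (fst (snd x)) < 0 \<longrightarrow> L x = Phi0 x + cut_jump x))"
proof -
  define v0 where "v0 = 1 / x0"
  have v0: "0 < v0" "v0 < 1" using x0 by (auto simp: v0_def)
  \<comment> \<open>This radius keeps the disc \<open>B\<close> inside the region where
    \<open>kerc\<close> is holomorphic. The points a and b lie at distance e/2 from v0 and p lies
    closer, so a < Re p < b and all segments from p to [a,b] stay in \<open>B\<close>.\<close>
  define e where "e = min v0 (1 - v0) / 2"
  have e: "0 < e" "e < v0" "v0 + e < 1" using v0 by (auto simp: e_def min_def field_simps)
  define a b where "a = v0 - e / 2" and "b = v0 + e / 2"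
  have ab: "0 < a" "a < b" "b < 1" "a \<le> b" using e by (auto simp: a_def b_def)
  define B where "B = ball (complex_of_real v0) e"
  have B: "0 < Re w \<and> norm w < 1" if "w \<in> B" for w
  proof -
    have "norm (w - of_real v0) < e" using that by (simp add: B_def dist_norm norm_minus_commute)
    moreover have "\<bar>Re (w - of_real v0)\<bar> \<le> norm (w - of_real v0)" by (rule abs_Re_le_cmod)
    moreover have "norm w \<le> norm (w - of_real v0) + norm (complex_of_real v0)" by (metis diff_add_cancel norm_triangle_ineq)
    ultimately show ?thesis using e v0 by auto
  qed
  have cB: "convex B" by (simp add: B_def)
  have "isCont inverse (complex_of_real x0)" using x0 by (intro continuous_intros) auto
  moreover have "inverse (complex_of_real x0) = of_real v0" by (simp add: v0_def inverse_eq_divide)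
  ultimately obtain d where d: "d > 0" "\<And>z. dist z (complex_of_real x0) < d \<Longrightarrow> dist (inverse z) (complex_of_real v0) < e / 2"
    unfolding continuous_at_eps_delta using half_gt_zero[OF e(1)] by metis
  \<comment> \<open>The bound x0 - 1 keeps Re z > 1, where \<open>cut_jump\<close> is
    holomorphic.\<close>
  define r where "r = min d (x0 - 1)"
  have r: "r > 0" "r \<le> x0 - 1" using d x0 by (auto simp: r_def)
  define D where "D = ball (complex_of_real x0) r"
  have D: "1 < Re z" "dist (inverse z) (of_real v0) < e / 2" "inverse z \<in> B" if "z \<in> D" for z
  proof -
    have m: "dist z (of_real x0) < r" using that by (simp add: D_def dist_commute)
    then show "dist (inverse z) (of_real v0) < e / 2" using d(2) by (simp add: r_def)
    then show "inverse z \<in> B" using e by (simp add: B_def dist_commute)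
    have "\<bar>Re (z - of_real x0)\<bar> \<le> norm (z - of_real x0)" by (rule abs_Re_le_cmod)
    then show "1 < Re z" using m r by (auto simp: dist_norm)
  qed
  define U where "U = half1 \<times> D \<times> half2"
  have oU: "open U" unfolding U_def D_def by (intro open_Times open_halfspace_Re_gt open_ball)
  have UD: "fst (snd x) \<in> D" if "x \<in> U" for x using that by (auto simp: U_def)
  have nD: "z \<noteq> 0" if "z \<in> D" for z using D(1)[OF that] by auto
  have ho: "holo3 (\<lambda>x. inverse (fst (snd x))) U"
    by (intro holo3_inverse holo3_coord oU) (use UD nD in auto)
  have vB: "of_real v \<in> B" if "v \<in> {a..b}" for v
    using that e by (auto simp: B_def a_def b_def dist_norm abs_if simp flip: of_real_diff)
  have seg: "inverse z + of_real t * (of_real v - inverse z) \<in> B" if "z \<in> D" "t \<in> {0..1}" "v \<in> {a..b}" for z t v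
    using convexD_alt[OF cB D(3)[OF that(1)] vB[OF that(3)], of t] that(2)
    by (simp add: scaleR_conv_of_real algebra_simps)
  define K where "K = (\<lambda>x v t. kerc_deriv (fst x) (snd (snd x)) (inverse (fst (snd x)) + of_real t * (of_real v - inverse (fst (snd x)))))"
  define q where "q = (\<lambda>x v. integral {0..1} (K x v))"
  have cK: "continuous_on ((U \<times> {a..b}) \<times> {0..1}) (\<lambda>(y,t). K (fst y) (snd y) t)"
    unfolding K_def split_beta
  proof (rule continuous_on_kerc_deriv, goal_cases)
    case 3
    then show ?case by (intro continuous_intros) (use nD UD in auto)
  next
    case (4 y)
    then have y: "fst (fst y) \<in> U" "snd (fst y) \<in> {a..b}" "snd y \<in> {0..1}" by auto
    then show ?case using B[OF seg[OF UD[OF y(1)] y(3,2)]] by blast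
  qed (intro continuous_intros)+
  have "continuous_on (U \<times> {a..b}) (\<lambda>y. integral (cbox 0 1) (K (fst y) (snd y)))"
    by (rule integral_continuous_on_param) (use cK in simp)
  then have cq: "continuous_on (U \<times> {a..b}) (\<lambda>(x,v). q x v)" by (simp add: q_def case_prod_unfold)
  have hq: "holo3 (\<lambda>x. q x v) U" if v: "v \<in> {a..b}" for v
    unfolding q_def
  proof (rule holo3_integral[OF oU])
    have "continuous_on (U \<times> {0..1}) (\<lambda>y. (\<lambda>(y,t). K (fst y) (snd y) t) ((fst y, v), snd y))"
      by (rule continuous_on_compose2[OF cK], intro continuous_intros) (use v in auto)
    then show "continuous_on (U \<times> {0..1}) (\<lambda>(x,t). K x v t)" by (simp add: case_prod_unfold)
    show "holo3 (\<lambda>x. K x v t) U" if "t \<in> {0..1}" for t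
      unfolding K_def by (intro holo3_kerc_kd holo3_intros ho oU) (use seg[OF UD that v] B in blast)
  qed
  define I2 where "I2 = (\<lambda>x. integral {a..b} (q x))"
  have hI2: "holo3 I2 U" unfolding I2_def by (rule holo3_integral[OF oU cq hq])
  have Dne: "1 - z * of_real v \<noteq> 0" if "z \<in> D" "v \<le> a \<or> b \<le> v" for z v
  proof
    assume "1 - z * of_real v = 0"
    then have "inverse z = of_real v" using nD[OF that(1)] by (simp add: field_simps)
    then have "\<bar>v - v0\<bar> < e / 2" using D(2)[OF that(1)] by (simp add: dist_norm flip: of_real_diff)
    then show False using that(2) unfolding a_def b_def by linarith
  qed
  define A where "A = (\<lambda>l u x. integral {l..u} (\<lambda>v. ker (fst x) (snd (snd x)) v / (1 - fst (snd x) * of_real v)))"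
  have hA: "holo3 (A 0 a) U" "holo3 (A b 1) U"
    unfolding A_def U_def by (rule holo3_ker_integral; use ab Dne in \<open>auto simp: D_def\<close>)+
  define p where "p = (\<lambda>x::pt. inverse (fst (snd x)))"
  define lg where "lg = (\<lambda>x. Ln (of_real b - p x) - Ln (p x - of_real a))"
  have pr: "Re (of_real b - p x) > 0" "Re (p x - of_real a) > 0" if "x \<in> U" for x
  proof -
    have "\<bar>Re (p x - of_real v0)\<bar> < e / 2"
      using D(2)[OF UD[OF that]] abs_Re_le_cmod[of "p x - of_real v0"] by (simp add: p_def dist_norm)
    then have "\<bar>Re (p x) - v0\<bar> < e / 2" by simp
    then have "v0 - e / 2 < Re (p x)" "Re (p x) < v0 + e / 2" by linarith+
    then show "Re (of_real b - p x) > 0" "Re (p x - of_real a) > 0" by (simp_all add: a_def b_def)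
  qed
  have hp: "holo3 p U" using ho by (simp add: p_def)
  have hlg: "holo3 lg U"
    unfolding lg_def by (intro holo3_intros holo3_Ln hp oU) (use pr in \<open>force simp: complex_nonpos_Reals_iff\<close>)+
  have hkp: "holo3 (\<lambda>x. kerc (fst x) (snd (snd x)) (p x)) U"
    by (rule holo3_kerc_kd[OF hp]) (use B[OF D(3)[OF UD]] in \<open>simp only: p_def\<close>)
  \<comment> \<open>The correction - i pi belongs to Im p < 0, that is to Im z > 0, so
    \<open>L\<close> continues the values from above the cut.\<close>
  define L where "L = (\<lambda>x. rGamma (fst x) * (A 0 a x + A b 1 x - p x * (I2 x + kerc (fst x) (snd (snd x)) (p x) * (lg x - \<i> * of_real pi))))"
  have hL: "holo3 L U"
    unfolding L_def by (intro holo3_intros holo3_rGamma hA hp hI2 hkp hlg oU)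
  have Phi0_eq: "Phi0 x = rGamma (fst x) * (A 0 a x + A b 1 x - p x * (I2 x + kerc (fst x) (snd (snd x)) (p x) *
      (lg x + (if Im (p x) > 0 then \<i> * of_real pi else - (\<i> * of_real pi)))))"
    if x: "x \<in> U" and im: "Im (fst (snd x)) \<noteq> 0" for x
  proof -
    obtain s z c where x': "x = (s,z,c)" by (cases x)
    have sc: "1 < Re s" "z \<in> D" "2 < Re c" using x by (auto simp: U_def x')
    have z: "z \<in> slit" "z \<noteq> 0" using im nD sc by (auto simp: x')
    have imp: "Im (p x) \<noteq> 0" 
    proof -
      have "(Re z)\<^sup>2 + (Im z)\<^sup>2 > 0" using im by (simp add: x' sum_power2_gt_zero_iff)
      then show ?thesis using im by (auto simp: p_def x')
    qed
    have ii: "(\<lambda>v. ker s c v / (1 - z * of_real v)) integrable_on {l..u}" if "0 \<le> l" "u \<le> 1" for l u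
      by (rule integrable_subinterval_real[of _ 0 1]) (use ker_divide_integrable[of s c z 1] sc z that in auto)
    have "A 0 1 x = A 0 a x + A a 1 x" "A a 1 x = A a b x + A b 1 x"
      unfolding A_def x' using ii[of 0 1] ii[of a 1] ab by (simp_all add: Henstock_Kurzweil_Integration.integral_combine)
    moreover have "A a b x = - p x * (I2 x + kerc s c (p x) * (Ln (of_real b - p x) - Ln (of_real a - p x)))"
    proof -
      have i1: "((\<lambda>v. kerc s c (p x) * (1 / (of_real v - p x))) has_integral kerc s c (p x) * (Ln (of_real b - p x) - Ln (of_real a - p x))) {a..b}"
        by (intro has_integral_mult_right cut_integral_Ln imp ab)
      have i2: "(q x has_integral I2 x) {a..b}"
      proof -
        have "continuous_on {a..b} (\<lambda>v. (\<lambda>(x,v). q x v) (x, v))"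
          by (rule continuous_on_compose2[OF cq], intro continuous_intros) (use x in auto)
        then show ?thesis unfolding I2_def by (intro integrable_integral integrable_continuous_interval) simp
      qed
      have "((\<lambda>v. - p x * (q x v + kerc s c (p x) * (1 / (of_real v - p x)))) has_integral
         - p x * (I2 x + kerc s c (p x) * (Ln (of_real b - p x) - Ln (of_real a - p x)))) {a..b}"
        by (rule has_integral_mult_right[OF has_integral_add[OF i2 i1]])
      then have "((\<lambda>v. ker s c v / (1 - z * of_real v)) has_integral
         - p x * (I2 x + kerc s c (p x) * (Ln (of_real b - p x) - Ln (of_real a - p x)))) {a..b}"
      proof (rule has_integral_eq[rotated])
        fix v assume v: "v \<in> {a..b}"
        have "Im (of_real v - p x) \<noteq> 0" using imp by simp
        then have vp: "of_real v - p x \<noteq> 0" by (metis zero_complex.simps(2))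
        have "(of_real v - p x) * q x v = kerc s c (of_real v) - kerc s c (p x)"
          unfolding q_def K_def using kerc_diff_quotient[OF cB B, of "p x" "of_real v" s c] D(3)[OF sc(2)] vB[OF v]
          by (simp add: p_def x')
        then have "q x v + kerc s c (p x) * (1 / (of_real v - p x)) = kerc s c (of_real v) / (of_real v - p x)"
          using vp by (simp add: field_simps)
        moreover have "- p x / (of_real v - p x) = 1 / (1 - z * of_real v)"
          using vp z slit_neq[OF z(1), of v] v ab by (simp add: p_def x' field_simps)
        moreover have "- p x * (kerc s c (of_real v) / (of_real v - p x)) = kerc s c (of_real v) * (- p x / (of_real v - p x))" by simp
        moreover have "kerc s c (of_real v) = ker s c v" using v ab by (intro kerc_of_real) auto
        ultimately show "- p x * (q x v + kerc s c (p x) * (1 / (of_real v - p x))) = ker s c v / (1 - z * of_real v)"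
          by (metis mult.right_neutral times_divide_eq_right)
      qed
      then show ?thesis unfolding A_def x' by (simp add: integral_unique)
    qed
    ultimately have "A 0 1 x = A 0 a x + A b 1 x - p x * (I2 x + kerc s c (p x) * (Ln (of_real b - p x) - Ln (of_real a - p x)))"
      by simp
    moreover have "Phi0 x = rGamma s * A 0 1 x" by (simp add: Phi0_def A_def x')
    moreover have "Ln (of_real b - p x) - Ln (of_real a - p x) = lg x + (if Im (p x) > 0 then \<i> * of_real pi else - (\<i> * of_real pi))"
      unfolding Ln_flip[OF imp, of a] lg_def by simp
    ultimately show ?thesis by (simp only: x' fst_conv snd_conv)
  qed
  have Imp: "Im (p x) > 0 \<longleftrightarrow> Im (fst (snd x)) < 0" if "x \<in> U" "Im (fst (snd x)) \<noteq> 0" for x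
  proof -
    have "(Re (fst (snd x)))\<^sup>2 + (Im (fst (snd x)))\<^sup>2 > 0" using that(2) by (simp add: sum_power2_gt_zero_iff)
    then show ?thesis by (simp add: p_def zero_less_divide_iff divide_less_0_iff)
  qed
  have "L x = Phi0 x" if "x \<in> U" "Im (fst (snd x)) > 0" for x
    using Phi0_eq[of x] Imp[of x] that by (simp add: L_def)
  moreover have "L x = Phi0 x + cut_jump x" if "x \<in> U" "Im (fst (snd x)) < 0" for x
  proof -
    obtain s z c where x': "x = (s,z,c)" by (cases x)
    have z: "z \<noteq> 0" "z \<notin> \<real>\<^sub>\<le>\<^sub>0" using D(1)[OF UD[OF that(1)]] by (auto simp: x' complex_nonpos_Reals_iff)
    \<comment> \<open>Up to sign the residue at the pole. As Re z > 1, log p = - log z, and this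
      turns it into the powers in \<open>cut_jump\<close>.\<close>
    have "p x * kerc s c (p x) = exp ((s - 1) * Ln (Ln z) - c * Ln z)"
    proof -
      have "p x = exp (- Ln z)" using z by (simp add: p_def x' exp_minus)
      moreover have "Ln (p x) = - Ln z" using z by (simp add: p_def x' Ln_inverse)
      ultimately have "p x * kerc s c (p x) = exp (- Ln z + ((s - 1) * Ln (Ln z) + (c - 1) * - Ln z))"
        unfolding kerc_def by (simp only: exp_add minus_minus)
      then show ?thesis by (simp add: algebra_simps)
    qed
    then have "cut_jump x = rGamma s * (p x * kerc s c (p x)) * (2 * of_real pi * \<i>)"
      by (simp add: cut_jump_def x' mult_ac)
    moreover have "Phi0 x = rGamma s * (A 0 a x + A b 1 x - p x * (I2 x + kerc s c (p x) * (lg x + \<i> * of_real pi)))"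
      using Phi0_eq[of x] Imp[of x] that by (simp add: x')
    ultimately show ?thesis by (simp add: L_def x' algebra_simps)
  qed
  ultimately show ?thesis
    using r hL unfolding U_def D_def by (intro exI[of _ r] exI[of _ L]) auto
qed

lemma holo3_cut_jump: "holo3 cut_jump (UNIV \<times> {z. 1 < Re z} \<times> UNIV)"
proof -
  let ?U = "(UNIV :: complex set) \<times> {z. 1 < Re z} \<times> (UNIV :: complex set)"
  have o: "open ?U" by (intro open_Times open_halfspace_Re_gt open_UNIV)
  have L: "holo3 (\<lambda>x. Ln (fst (snd x))) ?U"
    by (intro holo3_Ln holo3_coord o) (auto simp: complex_nonpos_Reals_iff)
  have p: "Re (Ln (fst (snd x))) > 0" if "x \<in> ?U" for x
  proof -
    have "1 < Re (fst (snd x))" using that by auto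
    then have "1 < norm (fst (snd x))" using complex_Re_le_cmod[of "fst (snd x)"] by linarith
    then show ?thesis by (subst Re_Ln) (auto intro: ln_gt_zero)
  qed
  have LL: "holo3 (\<lambda>x. Ln (Ln (fst (snd x)))) ?U"
    by (rule holo3_Ln[OF L]) (use p in \<open>force simp: complex_nonpos_Reals_iff\<close>)
  show ?thesis
    unfolding cut_jump_def by (intro holo3_intros holo3_rGamma o L LL)
qed

abbreviation cut_branch :: "complex set \<Rightarrow> (pt \<Rightarrow> complex) \<Rightarrow> bool" where
  "cut_branch D P \<equiv> \<forall>x\<in>UNIV \<times> D \<times> half2. (Im (fst (snd x)) > 0 \<longrightarrow> P x = Phi x) \<and>
     (Im (fst (snd x)) < 0 \<longrightarrow> P x = Phi x + cut_jump x)"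

text \<open>Above the cut the branch is \<open>Phi0\<close> and satisfies the relation in s; the
  identity theorem spreads the relation over the disc, so the branch extends to all s. Its
  descriptions above and below the cut extend separately.\<close>

lemma full_branch_exists:
  fixes x0 :: real
  assumes x0: "x0 > 1"
  shows "\<exists>r L. 0 < r \<and> r \<le> x0 - 1 \<and> holo3 L (UNIV \<times> ball (of_real x0) r \<times> half2) \<and>
    (cut_branch (ball (of_real x0) r) L)"
proof -
  obtain r L0 where r: "0 < r" "r \<le> x0 - 1" and L0: "holo3 L0 (half1 \<times> ball (of_real x0) r \<times> half2)"
    and up: "\<And>x. x \<in> half1 \<times> ball (of_real x0) r \<times> half2 \<Longrightarrow> Im (fst (snd x)) > 0 \<Longrightarrow> L0 x = Phi0 x"
    and lo: "\<And>x. x \<in> half1 \<times> ball (of_real x0) r \<times> half2 \<Longrightarrow> Im (fst (snd x)) < 0 \<Longrightarrow> L0 x = Phi0 x + cut_jump x"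
    using branch_exists[OF x0] by blast
  let ?B = "ball (complex_of_real x0) r"
  have Bre: "1 < Re z" if "z \<in> ?B" for z
    using that r abs_Re_le_cmod[of "of_real x0 - z"] by (auto simp: dist_norm)
  have oB: "open (?B \<times> half2)" by (intro open_Times open_halfspace_Re_gt open_ball)
  define P where "P = ?B \<inter> {z. Im z > 0}"
  define M where "M = ?B \<inter> {z. Im z < 0}"
  have oP: "open P" "open M" unfolding P_def M_def by (intro open_Int open_ball open_halfspace_Im_gt open_halfspace_Im_lt)+
  have oPU: "open (UNIV \<times> P \<times> half2)" "open (half1 \<times> P \<times> half2)" "open (UNIV \<times> M \<times> half2)"
    by (intro open_Times open_halfspace_Re_gt oP open_UNIV)+
  have rel: "Tz L0 (fst x + 1, snd x) = L0 x" if x: "x \<in> half1 \<times> ?B \<times> half2" for x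
  proof -
    define h where "h = (\<lambda>x. Tz L0 (fst x + 1, fst (snd x), snd (snd x) + 0) - L0 x)"
    have "holo3 h (half1 \<times> ?B \<times> half2)"
      unfolding h_def
      by (rule holo3_diff[OF holo3_subset[OF holo3_shift[OF holo3_Tz[OF L0]]] L0]) (use holo3_open[OF L0] in auto)
    moreover have "convex (half1 \<times> ?B \<times> half2)"
      by (intro convex_Times convex_halfspace_Re_gt convex_ball)
    moreover define a where "a = (2::complex, of_real x0 + \<i> * of_real (r / 2), 3::complex)"
    have aP: "a \<in> half1 \<times> P \<times> half2" using r by (auto simp: a_def P_def dist_norm norm_mult)
    then have "a \<in> half1 \<times> ?B \<times> half2" by (auto simp: P_def)
    moreover have "h y = 0" if y: "y \<in> half1 \<times> P \<times> half2" for y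
    proof -
      have m: "(fst y + 1, snd y) \<in> half1 \<times> P \<times> half2" using y by auto
      have "Tz L0 (fst y + 1, snd y) = Tz Phi0 (fst y + 1, snd y)"
        by (rule Tz_cong[OF oPU(2) _ m]) (use up in \<open>auto simp: P_def\<close>)
      also have "\<dots> = Phi0 y" by (rule Phi0_rel) (use y in \<open>auto simp: P_def\<close>)
      also have "\<dots> = L0 y" using up[of y] y by (auto simp: P_def)
      finally show ?thesis by (simp add: h_def)
    qed
    then have "\<forall>\<^sub>F y in nhds a. h y = 0"
      unfolding eventually_nhds using oPU(2) aP by blast
    ultimately have "h x = 0" using holo3_zero_convex[of h] x by blast
    then show ?thesis by (simp add: h_def)
  qed
  note sx = holo3_s_extend[OF L0 oB rel] s_extend_half[OF L0 oB rel]
  have 1: "s_extend L0 x = Phi x" if "x \<in> UNIV \<times> ?B \<times> half2" "Im (fst (snd x)) > 0" for x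
  proof (rule eq_on_half_imp_eq)
    show "x \<in> UNIV \<times> P \<times> half2" using that by (auto simp: P_def)
    show "holo3 (s_extend L0) (UNIV \<times> P \<times> half2)" by (rule holo3_subset[OF sx(1) oPU(1)]) (auto simp: P_def)
    show "holo3 Phi (UNIV \<times> P \<times> half2)" by (rule holo3_subset[OF holo3_Phi oPU(1)]) (auto simp: P_def)
    show "s_extend L0 y = Phi y" if "y \<in> half1 \<times> P \<times> half2" for y
      using that up[of y] sx(2)[of y] Phi_eq_Phi0[of y] by (auto simp: P_def)
  qed
  have 2: "s_extend L0 x = Phi x + cut_jump x" if "x \<in> UNIV \<times> ?B \<times> half2" "Im (fst (snd x)) < 0" for x
  proof (rule eq_on_half_imp_eq)
    show "x \<in> UNIV \<times> M \<times> half2" using that by (auto simp: M_def)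
    show "holo3 (s_extend L0) (UNIV \<times> M \<times> half2)" by (rule holo3_subset[OF sx(1) oPU(3)]) (auto simp: M_def)
    show "holo3 (\<lambda>x. Phi x + cut_jump x) (UNIV \<times> M \<times> half2)"
      by (rule holo3_add[OF holo3_subset[OF holo3_Phi oPU(3)] holo3_subset[OF holo3_cut_jump oPU(3)]]) (use Bre in \<open>auto simp: M_def\<close>)
    show "s_extend L0 y = Phi y + cut_jump y" if "y \<in> half1 \<times> M \<times> half2" for y
      using that lo[of y] sx(2)[of y] Phi_eq_Phi0[of y] by (auto simp: M_def)
  qed
  show ?thesis
    by (intro exI[of _ r] exI[of _ "s_extend L0"] conjI ballI impI) (use r sx(1) 1 2 in auto)
qed

section \<open>The principal branch\<close>

text \<open>The first m terms of the series are split off so that the tail has its parameter c + m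
  in the half-plane Re > 2; for c in the strip, m >= 2 is enough.\<close>

definition Fm :: "nat \<Rightarrow> pt \<Rightarrow> complex" where
  "Fm m x = (\<Sum>k<m. fst (snd x) ^ k * exp (- fst x * Ln (snd (snd x) + of_nat k))) +
     fst (snd x) ^ m * Phi (fst x, fst (snd x), snd (snd x) + of_nat m)"

abbreviation strip :: "complex set" where "strip \<equiv> {c. 0 < Re c \<and> Re c < 1}"

lemma open_strip: "open strip"
  by (intro open_Collect_conj open_Collect_less continuous_intros)

lemma Fm_holo3:
  assumes m: "m \<ge> 2"
  shows "holo3 (Fm m) (UNIV \<times> slit \<times> strip)"
proof -
  let ?U = "(UNIV::complex set) \<times> slit \<times> strip"
  have o: "open ?U" by (intro open_Times open_slit open_strip open_UNIV)
  have "holo3 (\<lambda>x. Phi (fst x + 0, fst (snd x), snd (snd x) + of_nat m)) ?U"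
    by (rule holo3_subset[OF holo3_shift[OF holo3_Phi] o]) (use m in auto)
  then show ?thesis
    unfolding Fm_def by (intro holo3_intros holo3_Ln o) (auto simp: complex_nonpos_Reals_iff)
qed

lemma Fm_series:
  assumes m: "m \<ge> 2" and x: "x \<in> RR"
  shows "Fm m x = Phi_series x"
proof -
  obtain s z c where x': "x = (s,z,c)" by (cases x)
  have h: "1 < Re s" "norm z < 1" "0 < Re c" "Re c < 1" using x by (auto simp: RR_def x')
  have zs: "z \<in> slit" using h abs_Re_le_cmod[of z] by auto
  define a where "a = (\<lambda>n. z ^ n * (of_nat n + c) powr (- s))"
  have "(\<lambda>n. z ^ n * (of_nat n + (c + of_nat m)) powr (- s)) sums Phi0 (s, z, c + of_nat m)"
    by (rule Phi0_sums) (use h m in auto)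
  from sums_mult[OF this, of "z ^ m"]
  have "(\<lambda>n. a (n + m)) sums (z ^ m * Phi0 (s, z, c + of_nat m))"
    by (simp add: a_def power_add algebra_simps)
  then have "a sums (z ^ m * Phi0 (s, z, c + of_nat m) + (\<Sum>k<m. a k))"
    by (simp add: sums_iff_shift)
  moreover have "a k = z ^ k * exp (- s * Ln (c + of_nat k))" for k
  proof -
    have "Re (of_nat k + c) > 0" using h by simp
    then have "of_nat k + c \<noteq> 0" by (metis less_irrefl zero_complex.simps(1))
    then show ?thesis by (simp add: a_def powr_def add.commute)
  qed
  moreover have "Phi (s, z, c + of_nat m) = Phi0 (s, z, c + of_nat m)"
    by (rule Phi_eq_Phi0) (use h m zs in auto)
  ultimately have "a sums Fm m x" by (simp add: Fm_def x' add.commute)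
  then show ?thesis by (simp add: Phi_series_def x' a_def sums_iff)
qed

lemma DD_Times: "DD = UNIV \<times> (- (complex_of_real ` {0..})) \<times> strip"
proof -
  have "z \<in> complex_of_real ` {0..} \<longleftrightarrow> Im z = 0 \<and> Re z \<ge> 0" for z
    by (auto simp: image_iff complex_eq_iff intro!: bexI[of _ "Re z"])
  then show ?thesis by (auto simp: DD_def)
qed

lemma connected_DD: "connected DD"
proof -
  have "connected (- (complex_of_real ` {0..}))"
    by (intro starlike_imp_connected starlike_slotted_complex_plane_right)
  moreover have "strip = {c. 0 < Re c} \<inter> {c. Re c < 1}" by auto
  then have "convex strip" by (simp add: convex_Int convex_halfspace_Re_gt convex_halfspace_Re_lt)
  ultimately show ?thesis
    unfolding DD_Times by (intro connected_Times connected_UNIV) (auto intro: convex_connected)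
qed

lemma open_DD: "open DD"
proof -
  have "DD = {x. Im (fst (snd x)) \<noteq> 0 \<or> Re (fst (snd x)) < 0} \<inter> {x. 0 < Re (snd (snd x))} \<inter> {x. Re (snd (snd x)) < 1}"
    by (auto simp: DD_def)
  also have "open \<dots>"
    by (intro open_Int open_Collect_disj open_Collect_neq open_Collect_less continuous_intros)
  finally show ?thesis .
qed

lemma DD_subset: "DD \<subseteq> UNIV \<times> slit \<times> strip"
  by (auto simp: DD_def)

lemma open_RR: "open RR"
proof -
  have "RR = {x. 1 < Re (fst x)} \<inter> {x. norm (fst (snd x)) < 1} \<inter> {x. 0 < Re (snd (snd x))} \<inter> {x. Re (snd (snd x)) < 1}"
    by (auto simp: RR_def)
  also have "open \<dots>"
    by (intro open_Int open_Collect_less continuous_intros)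
  finally show ?thesis .
qed

text \<open>\<open>PhiD\<close> is a choice among continuations of the series: \<open>Fm m\<close>
  shows that there is one, and connectedness of \<open>DD\<close> that any two agree.\<close>

lemma PhiD_eq_Fm:
  assumes m: "m \<ge> 2" and x: "x \<in> DD"
  shows "PhiD x = Fm m x"
proof -
  let ?P = "\<lambda>F. holo3 F DD \<and> (\<forall>x\<in>DD \<inter> RR. F x = Phi_series x)"
  have Fm: "?P (Fm m)" using holo3_subset[OF Fm_holo3[OF m] open_DD DD_subset] Fm_series[OF m] by blast
  from someI[of ?P, OF this] have P: "?P PhiD" unfolding PhiD_def .
  have h: "holo3 (\<lambda>x. PhiD x - Fm m x) DD" using Fm P by (intro holo3_diff) auto
  define a where "a = (2::complex, -1/2::complex, 1/2::complex)"
  have a: "a \<in> DD \<inter> RR" by (simp add: a_def DD_def RR_def)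
  have "\<forall>\<^sub>F y in nhds a. y \<in> DD \<inter> RR"
    using a open_DD open_RR by (intro eventually_nhds_in_open) auto
  then have "\<forall>\<^sub>F y in nhds a. PhiD y - Fm m y = 0"
    by eventually_elim (use P Fm in auto)
  from holo3_zero_connected[OF h connected_DD _ x this] a show ?thesis by simp
qed

section \<open>Germs and analytic continuation along paths\<close>

text \<open>Equality on a neighbourhood in (z,c) and for all s. Shifts of s respect this relation,
  which would fail for germs at points (s,z,c).\<close>

definition germ_eq :: "complex \<times> complex \<Rightarrow> (pt \<Rightarrow> complex) \<Rightarrow> (pt \<Rightarrow> complex) \<Rightarrow> bool" where
  "germ_eq y F G \<longleftrightarrow> (\<forall>\<^sub>F q in nhds y. \<forall>s. F (s,q) = G (s,q))"

lemma germ_eq_refl [simp]: "germ_eq y F F"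
  by (simp add: germ_eq_def)

lemma germ_eq_sym: "germ_eq y F G \<Longrightarrow> germ_eq y G F"
  unfolding germ_eq_def by (erule eventually_mono) auto

lemma germ_eq_trans: "germ_eq y F G \<Longrightarrow> germ_eq y G H \<Longrightarrow> germ_eq y F H"
  unfolding germ_eq_def by (erule (1) eventually_elim2) auto

lemma germ_eq_add: "germ_eq y F G \<Longrightarrow> germ_eq y F' G' \<Longrightarrow> germ_eq y (\<lambda>x. F x + F' x) (\<lambda>x. G x + G' x)"
  unfolding germ_eq_def by (erule (1) eventually_elim2) auto

lemma germ_eq_openI:
  assumes "open W" "y \<in> W" "\<And>s q. q \<in> W \<Longrightarrow> F (s,q) = G (s,q)"
  shows "germ_eq y F G"
  unfolding germ_eq_def eventually_nhds using assms by blast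

lemma germ_eq_nearby: "germ_eq y F G \<Longrightarrow> \<exists>W. open W \<and> y \<in> W \<and> (\<forall>y'\<in>W. germ_eq y' F G)"
  unfolding germ_eq_def by (subst (asm) eventually_eventually[symmetric]) (auto simp: eventually_nhds)

section \<open>Germs built from logarithms\<close>

lemma eventually_nhds_fst: "(\<forall>\<^sub>F z in nhds (fst y). P z) \<Longrightarrow> (\<forall>\<^sub>F q in nhds y. P (fst q))"
  by (erule eventually_compose_filterlim) (intro tendsto_fst filterlim_ident)

lemma eventually_nhds_snd: "(\<forall>\<^sub>F z in nhds (snd y). P z) \<Longrightarrow> (\<forall>\<^sub>F q in nhds y. P (snd q))"
  by (erule eventually_compose_filterlim) (intro tendsto_snd filterlim_ident)

text \<open>A convex set carries some logarithm of \<open>f\<close>, and an additive constant makes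
  it equal to \<open>l\<close> at \<open>y\<close>. Near \<open>y\<close> the two logarithms differ
  by less than 2 pi, so they coincide there and not just at \<open>y\<close>.\<close>

lemma log_extend:
  assumes S: "convex S" "open S" "y \<in> S" and f: "f holomorphic_on S" "\<And>z. z \<in> S \<Longrightarrow> f z \<noteq> 0"
    and W: "open W" "y \<in> W" "l holomorphic_on W" "\<And>z. z \<in> W \<Longrightarrow> z \<in> S \<Longrightarrow> exp (l z) = f z"
  obtains g where "g holomorphic_on S" "\<And>z. z \<in> S \<Longrightarrow> exp (g z) = f z" "\<forall>\<^sub>F z in nhds y. g z = l z"
proof -
  obtain g0 where g0: "g0 holomorphic_on S" "\<And>z. z \<in> S \<Longrightarrow> f z = exp (g0 z)"
    using contractible_imp_holomorphic_log[OF f(1) convex_imp_contractible[OF S(1)] f(2)] by blast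
  define g where "g = (\<lambda>z. g0 z + (l y - g0 y))"
  have e1: "exp (l y - g0 y) = 1" using W S g0(2)[of y] f(2)[of y] by (simp add: exp_diff)
  have g: "g holomorphic_on S" "\<And>z. z \<in> S \<Longrightarrow> exp (g z) = f z"
    using g0 e1 by (auto simp: g_def exp_add intro!: holomorphic_intros)
  define d where "d = (\<lambda>z. g z - l z)"
  have "isCont d y" unfolding d_def
    using holomorphic_on_imp_continuous_on[OF g(1)] holomorphic_on_imp_continuous_on[OF W(3)] S W
    by (auto intro!: continuous_intros simp: continuous_on_eq_continuous_at)
  then have "(d \<longlongrightarrow> d y) (nhds y)"
    unfolding isCont_def tendsto_at_iff_tendsto_nhds .
  then have "((\<lambda>z. g z - l z) \<longlongrightarrow> 0) (nhds y)" by (simp add: g_def d_def)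
  then have "\<forall>\<^sub>F z in nhds y. dist (g z - l z) 0 < 2 * pi" by (rule tendstoD) simp
  moreover have "\<forall>\<^sub>F z in nhds y. z \<in> S \<inter> W" using S W by (intro eventually_nhds_in_open) auto
  ultimately have "\<forall>\<^sub>F z in nhds y. g z = l z"
  proof eventually_elim
    case (elim z)
    then have "exp (g z) = exp (l z)" using g(2) W(4) by simp
    moreover have "\<bar>Im (g z) - Im (l z)\<bar> < 2 * pi"
      using elim abs_Im_le_cmod[of "g z - l z"] by (simp add: dist_norm)
    ultimately show ?case by (rule exp_complex_eqI[rotated])
  qed
  then show thesis using that g by blast
qed

text \<open>The germs generated by the two multivalued functions by which branches of \<open>\<Phi>\<close> can differ.\<close>

inductive jump_germ :: "complex \<times> complex \<Rightarrow> (pt \<Rightarrow> complex) \<Rightarrow> bool" where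
  jump_germ_zero: "jump_germ y (\<lambda>x. 0)"
| jump_germ_cong: "jump_germ y F \<Longrightarrow> germ_eq y F G \<Longrightarrow> jump_germ y G"
| jump_germ_add: "jump_germ y F \<Longrightarrow> jump_germ y G \<Longrightarrow> jump_germ y (\<lambda>x. F x + G x)"
| jump_germ_z: "open W \<Longrightarrow> fst y \<in> W \<Longrightarrow> l holomorphic_on W \<Longrightarrow> m holomorphic_on W \<Longrightarrow>
    (\<And>z. z \<in> W \<Longrightarrow> exp (l z) = z \<and> exp (m z) = l z) \<Longrightarrow>
    jump_germ y (\<lambda>x. k * (rGamma (fst x) * exp ((fst x - 1) * m (fst (snd x)) - snd (snd x) * l (fst (snd x)))))"
| jump_germ_c: "open W \<Longrightarrow> snd y \<in> W \<Longrightarrow> l holomorphic_on W \<Longrightarrow>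
    (\<And>c. c \<in> W \<Longrightarrow> exp (l c) = c + of_nat n) \<Longrightarrow>
    jump_germ y (\<lambda>x. fst (snd x) ^ n * exp (- fst x * l (snd (snd x))))"

text \<open>The germs are made from logarithms of z, of log z and of c + n. These extend over a
  convex box: 0 is excluded for z, 1 is excluded as the only place where a branch of log z can
  vanish, and integers are excluded for c.\<close>

lemma jump_germ_extend:
  assumes "jump_germ y F" and y: "fst y \<in> Bz" "snd y \<in> Bc"
    and Bz: "open Bz" "convex Bz" "0 \<notin> Bz" "1 \<notin> Bz" and Bc: "open Bc" "convex Bc" "Bc \<inter> \<int> = {}"
  shows "\<exists>G. holo3 G (UNIV \<times> Bz \<times> Bc) \<and> germ_eq y G F \<and> (\<forall>y'\<in>Bz \<times> Bc. jump_germ y' G)"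
  using assms(1) y
proof (induction rule: jump_germ.induct)
  case (jump_germ_zero y)
  then show ?case
    by (intro exI[of _ "\<lambda>x. 0"]) (auto intro!: jump_germ.jump_germ_zero holo3_const open_Times Bz Bc)
next
  case (jump_germ_cong y F G)
  then show ?case using germ_eq_trans by blast
next
  case (jump_germ_add y F G)
  then obtain F' G' where "holo3 F' (UNIV \<times> Bz \<times> Bc)" "germ_eq y F' F" "\<forall>y'\<in>Bz \<times> Bc. jump_germ y' F'"
    "holo3 G' (UNIV \<times> Bz \<times> Bc)" "germ_eq y G' G" "\<forall>y'\<in>Bz \<times> Bc. jump_germ y' G'" by blast
  then show ?case
    by (intro exI[of _ "\<lambda>x. F' x + G' x"]) (auto intro!: jump_germ.jump_germ_add holo3_add germ_eq_add)
next
  case (jump_germ_z W y l m k)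
  let ?U = "(UNIV :: complex set) \<times> Bz \<times> Bc"
  have oU: "open ?U" by (intro open_Times Bz Bc open_UNIV)
  obtain l' where l': "l' holomorphic_on Bz" "\<And>z. z \<in> Bz \<Longrightarrow> exp (l' z) = z" "\<forall>\<^sub>F z in nhds (fst y). l' z = l z"
    by (rule log_extend[of Bz "fst y" "\<lambda>z. z" W l]) (use jump_germ_z Bz in auto)
  have nz: "l' z \<noteq> 0" if "z \<in> Bz" for z
  proof
    assume "l' z = 0"
    then have "z = 1" using l'(2)[OF that] by simp
    then show False using that Bz by simp
  qed
  obtain W' where W': "open W'" "fst y \<in> W'" "\<And>z. z \<in> W' \<Longrightarrow> l' z = l z"
    using l'(3) unfolding eventually_nhds by blast
  obtain m' where m': "m' holomorphic_on Bz" "\<And>z. z \<in> Bz \<Longrightarrow> exp (m' z) = l' z" "\<forall>\<^sub>F z in nhds (fst y). m' z = m z"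
  proof (rule log_extend[of Bz "fst y" l' "W \<inter> W'" m])
    show "m holomorphic_on W \<inter> W'" using jump_germ_z.hyps(4) by (rule holomorphic_on_subset) auto
  qed (use jump_germ_z Bz W' l' nz in auto)
  let ?G = "\<lambda>x. k * (rGamma (fst x) * exp ((fst x - 1) * m' (fst (snd x)) - snd (snd x) * l' (fst (snd x))))"
  have "holo3 (\<lambda>x. m' (fst (snd x))) ?U" "holo3 (\<lambda>x. l' (fst (snd x))) ?U"
    by (rule holo3_compose[OF holo3_coord(2)[OF oU] m'(1) Bz(1)] holo3_compose[OF holo3_coord(2)[OF oU] l'(1) Bz(1)]; auto)+
  then have "holo3 ?G ?U" by (intro holo3_intros holo3_rGamma oU)
  moreover have "germ_eq y ?G (\<lambda>x. k * (rGamma (fst x) * exp ((fst x - 1) * m (fst (snd x)) - snd (snd x) * l (fst (snd x)))))"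
    using eventually_nhds_fst[OF l'(3)] eventually_nhds_fst[OF m'(3)] unfolding germ_eq_def
    by eventually_elim simp
  moreover have "jump_germ y' ?G" if "y' \<in> Bz \<times> Bc" for y'
    by (rule jump_germ.jump_germ_z[of Bz]) (use that Bz l' m' in auto)
  ultimately show ?case by blast
next
  case (jump_germ_c W y l n)
  let ?U = "(UNIV :: complex set) \<times> Bz \<times> Bc"
  have oU: "open ?U" by (intro open_Times Bz Bc open_UNIV)
  have nz: "c + of_nat n \<noteq> 0" if "c \<in> Bc" for c
  proof
    assume "c + of_nat n = 0"
    then have "c = of_int (- int n)" by (simp add: eq_neg_iff_add_eq_0)
    then have "c \<in> \<int>" by (metis Ints_of_int)
    then show False using that Bc by blast
  qed
  obtain l' where l': "l' holomorphic_on Bc" "\<And>c. c \<in> Bc \<Longrightarrow> exp (l' c) = c + of_nat n" "\<forall>\<^sub>F c in nhds (snd y). l' c = l c"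
    by (rule log_extend[of Bc "snd y" "\<lambda>c. c + of_nat n" W l]) (use jump_germ_c Bc nz in \<open>auto intro!: holomorphic_intros\<close>)
  let ?G = "\<lambda>x. fst (snd x) ^ n * exp (- fst x * l' (snd (snd x)))"
  have "holo3 (\<lambda>x. l' (snd (snd x))) ?U"
    by (rule holo3_compose[OF holo3_coord(3)[OF oU] l'(1) Bc(1)]) auto
  then have "holo3 ?G ?U" by (intro holo3_intros oU)
  moreover have "germ_eq y ?G (\<lambda>x. fst (snd x) ^ n * exp (- fst x * l (snd (snd x))))"
    using eventually_nhds_snd[OF l'(3)] unfolding germ_eq_def by eventually_elim simp
  moreover have "jump_germ y' ?G" if "y' \<in> Bz \<times> Bc" for y'
    by (rule jump_germ.jump_germ_c[of Bc]) (use that Bc l' in auto)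
  ultimately show ?case by blast
qed

section \<open>Charts in z and their comparison\<close>

definition is_chart :: "complex \<Rightarrow> real \<Rightarrow> (pt \<Rightarrow> complex) \<Rightarrow> bool" where
  "is_chart z0 r P \<longleftrightarrow> r > 0 \<and> 0 \<notin> ball z0 r \<and> 1 \<notin> ball z0 r \<and> holo3 P (UNIV \<times> ball z0 r \<times> half2) \<and>
    (ball z0 r \<subseteq> slit \<and> P = Phi \<or>
     (\<exists>x0>1. z0 = of_real x0 \<and> (\<forall>z\<in>ball z0 r. 1 < Re z) \<and>
       (cut_branch (ball z0 r) P)))"

text \<open>At a point of the slit plane a small disc carries \<open>Phi\<close> itself. At a real
  point beyond 1 the disc carries the branch that equals \<open>Phi\<close> above the cut. Only
  centres on the cut use the second kind, and charts of the first kind stay inside the slit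
  plane.\<close>

lemma chart_exists:
  assumes "z0 \<noteq> 0" "z0 \<noteq> 1"
  shows "\<exists>r P. is_chart z0 r P"
proof (cases "z0 \<in> slit")
  case True
  then have "open (slit - {0})" "z0 \<in> slit - {0}" using open_slit assms by (auto intro: open_delete)
  then obtain r where r: "r > 0" "ball z0 r \<subseteq> slit - {0}" using openE by blast
  have "holo3 Phi (UNIV \<times> ball z0 r \<times> half2)"
    by (rule holo3_subset[OF holo3_Phi]) (use r in \<open>auto intro!: open_Times open_halfspace_Re_gt\<close>)
  moreover have "0 \<notin> ball z0 r" "ball z0 r \<subseteq> slit" using r(2) by (auto simp del: mem_ball)
  moreover have "1 \<notin> slit" by simp
  then have "1 \<notin> ball z0 r" using r(2) by (auto simp del: mem_ball)
  ultimately show ?thesis using r unfolding is_chart_def by blast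
next
  case False
  define x0 where "x0 = Re z0"
  have z0: "z0 = of_real x0" using False by (simp add: x0_def complex_eq_iff)
  have "x0 \<ge> 1" using False by (simp add: x0_def)
  moreover have "x0 \<noteq> 1" using assms(2) by (metis z0 of_real_1)
  ultimately have x0: "x0 > 1" by simp
  obtain r L where r: "0 < r" "r \<le> x0 - 1" and L: "holo3 L (UNIV \<times> ball (of_real x0) r \<times> half2)"
    "cut_branch (ball (of_real x0) r) L"
    using full_branch_exists[OF x0] by blast
  have B: "1 < Re z" if "z \<in> ball z0 r" for z
    using that r abs_Re_le_cmod[of "of_real x0 - z"] by (auto simp: dist_norm z0)
  have "1 \<notin> ball z0 r" "0 \<notin> ball z0 r" using B[of 1] B[of 0] by (auto simp del: mem_ball)
  then show ?thesis using r L B x0 z0 unfolding is_chart_def by blast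
qed

text \<open>Charts of the same kind agree. From a chart on the cut to one off it, k is 0 above and -
  1 below. The alternative \<open>1 < Re z1\<close> records that a nonzero multiple of
  \<open>cut_jump\<close> occurs only where that function is holomorphic.\<close>

lemma chart_compare:
  assumes P: "is_chart z0 r P" and P1: "is_chart z1 r1 P1" and z1: "z1 \<in> ball z0 r" and c: "c \<in> half2"
  shows "\<exists>k. (k = 0 \<or> 1 < Re z1) \<and> germ_eq (z1,c) P1 (\<lambda>x. P x + k * cut_jump x)"
proof -
  have z1': "z1 \<in> ball z1 r1" using P1 by (simp add: is_chart_def)
  consider (a) "ball z0 r \<subseteq> slit" "P = Phi" | (b) x0 where "x0 > 1" "z0 = of_real x0" "\<forall>z\<in>ball z0 r. 1 < Re z"
    "cut_branch (ball z0 r) P"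
    using P unfolding is_chart_def by blast
  then show ?thesis
  proof cases
    case a
    then have "z1 \<in> slit" using z1 by blast
    then have "P1 = Phi" using P1 unfolding is_chart_def by auto
    then show ?thesis using a by (intro exI[of _ 0]) simp
  next
    case b
    have re: "1 < Re z1" using b z1 by blast
    consider (a1) "ball z1 r1 \<subseteq> slit" "P1 = Phi" | (b1) x1 where "x1 > 1" "z1 = of_real x1"
      "cut_branch (ball z1 r1) P1"
      using P1 unfolding is_chart_def by blast
    then show ?thesis
    proof cases
      case a1
      then have "z1 \<in> slit" using z1' by blast
      then consider "Im z1 > 0" | "Im z1 < 0" using re by (auto simp: neq_iff)
      then show ?thesis
      proof cases
        case 1
        have "germ_eq (z1,c) P1 (\<lambda>x. P x + 0 * cut_jump x)"
          by (rule germ_eq_openI[of "(ball z0 r \<inter> {z. Im z > 0}) \<times> half2"])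
             (use b 1 z1 c a1 in \<open>auto intro!: open_Times open_Int open_halfspace_Re_gt open_halfspace_Im_gt\<close>)
        then show ?thesis by blast
      next
        case 2
        have "germ_eq (z1,c) P1 (\<lambda>x. P x + (- 1) * cut_jump x)"
          by (rule germ_eq_openI[of "(ball z0 r \<inter> {z. Im z < 0}) \<times> half2"])
             (use b 2 z1 c a1 in \<open>auto intro!: open_Times open_Int open_halfspace_Re_gt open_halfspace_Im_lt\<close>)
        then show ?thesis using re by blast
      qed
    next
      case b1
      define W where "W = ball z0 r \<inter> ball z1 r1"
      have W: "open W" "convex W" "z1 \<in> W" using z1 z1' by (auto simp: W_def convex_Int)
      let ?U = "(UNIV::complex set) \<times> W \<times> half2"
      have U: "open ?U" "convex ?U" using W
        by (auto intro!: open_Times convex_Times open_halfspace_Re_gt convex_halfspace_Re_gt)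
      have "holo3 P (UNIV \<times> ball z0 r \<times> half2)" "holo3 P1 (UNIV \<times> ball z1 r1 \<times> half2)"
        using P P1 by (simp_all add: is_chart_def)
      then have h: "holo3 (\<lambda>x. P1 x - P x) ?U"
        by (intro holo3_diff; elim holo3_subset[OF _ U(1)]) (auto simp: W_def)
      obtain e where e: "e > 0" "ball z1 e \<subseteq> W" using W openE by blast
      \<comment> \<open>A nearby point above the cut, where both branches equal \<open>Phi\<close>;
        from there the identity theorem reaches the whole intersection.\<close>
      define w where "w = z1 + \<i> * of_real (e / 2)"
      have w: "w \<in> W" "Im w > 0"
      proof -
        have "w \<in> ball z1 e" using e by (simp add: w_def dist_norm norm_mult)
        then show "w \<in> W" using e by blast
        show "Im w > 0" using e b1 by (simp add: w_def)
      qed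
      let ?S = "(UNIV::complex set) \<times> (W \<inter> {z. Im z > 0}) \<times> half2"
      have "open ?S" using W by (auto intro!: open_Times open_Int open_halfspace_Re_gt open_halfspace_Im_gt)
      moreover have aS: "(0,w,c) \<in> ?S" using w c by auto
      ultimately have "\<forall>\<^sub>F x in nhds (0,w,c). x \<in> ?S" by (rule eventually_nhds_in_open)
      then have ev: "\<forall>\<^sub>F x in nhds (0,w,c). P1 x - P x = 0"
        by eventually_elim (use b b1 in \<open>auto simp: W_def\<close>)
      have eq: "P1 x - P x = 0" if "x \<in> ?U" for x
        by (rule holo3_zero_convex[OF h U(2) _ that ev]) (use aS in auto)
      have "germ_eq (z1,c) P1 (\<lambda>x. P x + 0 * cut_jump x)"
      proof (rule germ_eq_openI[of "W \<times> half2"])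
        show "open (W \<times> half2)" using W by (auto intro!: open_Times open_halfspace_Re_gt)
        show "P1 (s,q) = P (s,q) + 0 * cut_jump (s,q)" if "q \<in> W \<times> half2" for s q
          using eq[of "(s,q)"] that by auto
      qed (use W c in auto)
      then show ?thesis by blast
    qed
  qed
qed

definition chart :: "complex \<Rightarrow> real \<times> (pt \<Rightarrow> complex)" where
  "chart z0 = (SOME p. is_chart z0 (fst p) (snd p))"

definition rz :: "complex \<Rightarrow> real" where "rz z0 = fst (chart z0)"
definition Pz :: "complex \<Rightarrow> pt \<Rightarrow> complex" where "Pz z0 = snd (chart z0)"

lemma is_chart_chart: "z0 \<noteq> 0 \<Longrightarrow> z0 \<noteq> 1 \<Longrightarrow> is_chart z0 (rz z0) (Pz z0)"
  using chart_exists[of z0] someI_ex[of "\<lambda>p. is_chart z0 (fst p) (snd p)"]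
  unfolding rz_def Pz_def chart_def by force

section \<open>Local branches on boxes in (z,c) after the shift of c by m\<close>

definition Qm :: "nat \<Rightarrow> (complex \<times> complex) set" where
  "Qm m = {(z,c). z \<noteq> 0 \<and> z \<noteq> 1 \<and> c \<notin> \<int> \<and> Re c + real m > 2}"

definition rc :: "nat \<Rightarrow> complex \<Rightarrow> real" where
  "rc m c0 = (SOME r. r > 0 \<and> ball c0 r \<subseteq> {c. c \<notin> \<int> \<and> Re c + real m > 2})"

lemma rc:
  assumes "c0 \<notin> \<int>" "Re c0 + real m > 2"
  shows "rc m c0 > 0" "ball c0 (rc m c0) \<subseteq> {c. c \<notin> \<int> \<and> Re c + real m > 2}"
proof -
  have "open (- (\<int> :: complex set) \<inter> {c. Re c + real m > 2})"
    by (intro open_Int open_Compl closed_Ints open_Collect_less continuous_intros)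
  then have "\<exists>r. r > 0 \<and> ball c0 r \<subseteq> {c. c \<notin> \<int> \<and> Re c + real m > 2}"
    using openE[of "- \<int> \<inter> {c. Re c + real m > 2}" c0] assms by (auto simp: Int_def Compl_eq)
  from someI_ex[OF this] show "rc m c0 > 0" "ball c0 (rc m c0) \<subseteq> {c. c \<notin> \<int> \<and> Re c + real m > 2}"
    unfolding rc_def by blast+
qed

definition Bm :: "nat \<Rightarrow> complex \<times> complex \<Rightarrow> (complex \<times> complex) set" where
  "Bm m p = ball (fst p) (rz (fst p)) \<times> ball (snd p) (rc m (snd p))"

definition Pm :: "nat \<Rightarrow> complex \<times> complex \<Rightarrow> pt \<Rightarrow> complex" where
  "Pm m p x = fst (snd x) ^ m * Pz (fst p) (fst x, fst (snd x), snd (snd x) + of_nat m)"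

text \<open>The class of germs that is closed under continuation: the branch of the shifted tail
  chosen at \<open>y\<close>, plus a jump germ. The bookkeeping of the monodromy disappears in the
  existential quantifier.\<close>

definition Gm :: "nat \<Rightarrow> complex \<times> complex \<Rightarrow> (pt \<Rightarrow> complex) \<Rightarrow> bool" where
  "Gm m y F \<longleftrightarrow> (\<exists>A. jump_germ y A \<and> germ_eq y F (\<lambda>x. Pm m y x + A x))"

lemma Bm_facts:
  assumes "p \<in> Qm m"
  shows "open (Bm m p)" "p \<in> Bm m p" "Bm m p \<subseteq> Qm m"
    "0 \<notin> ball (fst p) (rz (fst p))" "1 \<notin> ball (fst p) (rz (fst p))" "ball (snd p) (rc m (snd p)) \<inter> \<int> = {}"
proof -
  have p: "fst p \<noteq> 0" "fst p \<noteq> 1" "snd p \<notin> \<int>" "Re (snd p) + real m > 2" using assms by (auto simp: Qm_def)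
  have ch: "is_chart (fst p) (rz (fst p)) (Pz (fst p))" using p is_chart_chart by blast
  show "open (Bm m p)" unfolding Bm_def by (intro open_Times open_ball)
  show z: "0 \<notin> ball (fst p) (rz (fst p))" "1 \<notin> ball (fst p) (rz (fst p))" using ch unfolding is_chart_def by blast+
  have r: "rz (fst p) > 0" using ch unfolding is_chart_def by blast
  show "p \<in> Bm m p" using r rc(1)[OF p(3,4)] by (cases p) (simp add: Bm_def)
  show "ball (snd p) (rc m (snd p)) \<inter> \<int> = {}" using rc(2)[OF p(3,4)] by blast
  show "Bm m p \<subseteq> Qm m"
  proof
    fix q assume q: "q \<in> Bm m p"
    have q': "fst q \<in> ball (fst p) (rz (fst p))" "snd q \<in> ball (snd p) (rc m (snd p))" using q by (auto simp: Bm_def)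
    have "fst q \<noteq> 0" using z(1) q'(1) by metis
    moreover have "fst q \<noteq> 1" using z(2) q'(1) by metis
    moreover have "snd q \<notin> \<int> \<and> Re (snd q) + real m > 2" using subsetD[OF rc(2)[OF p(3,4)] q'(2)] by simp
    ultimately show "q \<in> Qm m" by (cases q) (simp add: Qm_def)
  qed
qed

lemma holo3_Pm:
  assumes p: "p \<in> Qm m"
  shows "holo3 (Pm m p) (UNIV \<times> Bm m p)"
proof -
  have o: "open ((UNIV::complex set) \<times> Bm m p)" using Bm_facts(1)[OF p] by (intro open_Times open_UNIV)
  have "is_chart (fst p) (rz (fst p)) (Pz (fst p))" using p is_chart_chart by (auto simp: Qm_def)
  then have h: "holo3 (Pz (fst p)) (UNIV \<times> ball (fst p) (rz (fst p)) \<times> half2)" by (simp add: is_chart_def)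
  have m: "Re (snd q) + real m > 2" if "q \<in> Bm m p" for q using Bm_facts(3)[OF p] that by (auto simp: Qm_def)
  have "holo3 (\<lambda>x. Pz (fst p) (fst x + 0, fst (snd x), snd (snd x) + of_nat m)) (UNIV \<times> Bm m p)"
    by (rule holo3_subset[OF holo3_shift[OF h] o]) (use m in \<open>auto simp: Bm_def\<close>)
  then show ?thesis unfolding Pm_def by (intro holo3_intros o) simp
qed

text \<open>Since z^m z^(- (c + m)) = z^(- c), the jump of the shifted tail is the jump at c itself
  and so is a generating germ.\<close>

lemma jump_germ_cut:
  assumes "k = 0 \<or> 1 < Re (fst y)"
  shows "jump_germ y (\<lambda>x. fst (snd x) ^ m * (k * cut_jump (fst x, fst (snd x), snd (snd x) + of_nat m)))"
proof (cases "k = 0")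
  case True
  then show ?thesis by (simp add: jump_germ_zero)
next
  case False
  then have re: "1 < Re (fst y)" using assms by simp
  let ?W = "{z. 1 < Re z}"
  let ?F = "\<lambda>x. (k * (2 * of_real pi * \<i>)) * (rGamma (fst x) * exp ((fst x - 1) * Ln (Ln (fst (snd x))) - snd (snd x) * Ln (fst (snd x))))"
  have n: "z \<notin> \<real>\<^sub>\<le>\<^sub>0" "z \<noteq> 0" "Ln z \<notin> \<real>\<^sub>\<le>\<^sub>0" "Ln z \<noteq> 0" if "z \<in> ?W" for z
  proof -
    have z: "1 < norm z" using that complex_Re_le_cmod[of z] by simp
    show "z \<notin> \<real>\<^sub>\<le>\<^sub>0" "z \<noteq> 0" using that by (auto simp: complex_nonpos_Reals_iff)
    have "Re (Ln z) > 0" using z by (subst Re_Ln) (auto intro: ln_gt_zero)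
    then show "Ln z \<notin> \<real>\<^sub>\<le>\<^sub>0" "Ln z \<noteq> 0" by (auto simp: complex_nonpos_Reals_iff)
  qed
  have "jump_germ y ?F"
  proof (rule jump_germ_z)
    show "Ln holomorphic_on ?W" "(\<lambda>z. Ln (Ln z)) holomorphic_on ?W"
      using n by (auto intro!: holomorphic_intros)
    show "exp (Ln z) = z \<and> exp (Ln (Ln z)) = Ln z" if "z \<in> ?W" for z using n[OF that] by simp
  qed (use re open_halfspace_Re_gt in auto)
  moreover have "germ_eq y ?F (\<lambda>x. fst (snd x) ^ m * (k * cut_jump (fst x, fst (snd x), snd (snd x) + of_nat m)))"
  proof (rule germ_eq_openI[of "?W \<times> UNIV"])
    fix s q assume "q \<in> ?W \<times> (UNIV::complex set)"
    then obtain z c where q: "q = (z,c)" "z \<in> ?W" by auto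
    have "z ^ m = exp (of_nat m * Ln z)" using n[OF q(2)] by (simp add: exp_of_nat_mult)
    then have "z ^ m * exp ((s - 1) * Ln (Ln z) - (c + of_nat m) * Ln z) = exp ((s - 1) * Ln (Ln z) - c * Ln z)"
      by (simp add: algebra_simps flip: exp_add)
    then have "z ^ m * (k * (2 * of_real pi * \<i> * (rGamma s * exp ((s - 1) * Ln (Ln z) - (c + of_nat m) * Ln z)))) =
       (k * (2 * of_real pi * \<i>)) * (rGamma s * exp ((s - 1) * Ln (Ln z) - c * Ln z))"
      by (metis (no_types, opaque_lifting) mult.assoc mult.left_commute)
    then show "?F (s,q) = fst (snd (s,q)) ^ m * (k * cut_jump (fst (s,q), fst (snd (s,q)), snd (snd (s,q)) + of_nat m))"
      by (auto simp: cut_jump_def q)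
  qed (use re in \<open>auto intro!: open_Times open_halfspace_Re_gt simp: mem_Times_iff\<close>)
  ultimately show ?thesis by (rule jump_germ_cong)
qed

text \<open>Both directions are recorded because jump germs are closed under sums while their
  definition has no clause for negation; here the sign is absorbed by the constant k.\<close>

lemma Pm_compare:
  assumes p: "p \<in> Qm m" and y: "y \<in> Bm m p"
  shows "\<exists>A. jump_germ y A \<and> germ_eq y (Pm m y) (\<lambda>x. Pm m p x + A x)"
    and "\<exists>A. jump_germ y A \<and> germ_eq y (Pm m p) (\<lambda>x. Pm m y x + A x)"
proof -
  have yQ: "y \<in> Qm m" using Bm_facts(3)[OF p] y by blast
  have ch: "is_chart (fst p) (rz (fst p)) (Pz (fst p))" "is_chart (fst y) (rz (fst y)) (Pz (fst y))"
    using p yQ is_chart_chart by (auto simp: Qm_def)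
  have "fst y \<in> ball (fst p) (rz (fst p))" "snd y + of_nat m \<in> half2"
    using y yQ by (auto simp: Bm_def Qm_def)
  from chart_compare[OF ch this] obtain k where k: "k = 0 \<or> 1 < Re (fst y)"
    "germ_eq (fst y, snd y + of_nat m) (Pz (fst y)) (\<lambda>x. Pz (fst p) x + k * cut_jump x)" by blast
  have "filterlim (\<lambda>q. (fst q, snd q + of_nat m)) (nhds (fst y, snd y + of_nat m)) (nhds y)"
    by (intro tendsto_intros tendsto_fst tendsto_snd filterlim_ident)
  from eventually_compose_filterlim[OF k(2)[unfolded germ_eq_def] this]
  have ev: "\<forall>\<^sub>F q in nhds y. \<forall>s. Pz (fst y) (s, fst q, snd q + of_nat m) =
     Pz (fst p) (s, fst q, snd q + of_nat m) + k * cut_jump (s, fst q, snd q + of_nat m)" .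
  define A where "A = (\<lambda>k (x::pt). fst (snd x) ^ m * (k * cut_jump (fst x, fst (snd x), snd (snd x) + of_nat m)))"
  have "germ_eq y (Pm m y) (\<lambda>x. Pm m p x + A k x)"
    unfolding germ_eq_def using ev by eventually_elim (simp add: Pm_def A_def algebra_simps)
  moreover have "germ_eq y (Pm m p) (\<lambda>x. Pm m y x + A (- k) x)"
    unfolding germ_eq_def using ev by eventually_elim (simp add: Pm_def A_def algebra_simps)
  moreover have "jump_germ y (A k)" "jump_germ y (A (- k))" unfolding A_def by (rule jump_germ_cut; use k in auto)+
  ultimately show "\<exists>A. jump_germ y A \<and> germ_eq y (Pm m y) (\<lambda>x. Pm m p x + A x)"
    "\<exists>A. jump_germ y A \<and> germ_eq y (Pm m p) (\<lambda>x. Pm m y x + A x)" by blast+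
qed

text \<open>Rewritten with the branch at the centre \<open>p\<close>, the germ differs from that
  branch by a jump germ, which extends over the box. Comparison in the other direction puts the
  result into the class at every point of the box.\<close>

lemma Gm_extend:
  assumes p: "p \<in> Qm m" and y: "y \<in> Bm m p" and F: "Gm m y F"
  shows "\<exists>G. holo3 G (UNIV \<times> Bm m p) \<and> germ_eq y G F \<and> (\<forall>y'\<in>Bm m p. Gm m y' G)"
proof -
  obtain A where A: "jump_germ y A" "germ_eq y F (\<lambda>x. Pm m y x + A x)" using F by (auto simp: Gm_def)
  obtain A1 where A1: "jump_germ y A1" "germ_eq y (Pm m y) (\<lambda>x. Pm m p x + A1 x)" using Pm_compare(1)[OF p y] by blast
  have "jump_germ y (\<lambda>x. A1 x + A x)" using A A1 by (intro jump_germ_add)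
  from jump_germ_extend[OF this, of "ball (fst p) (rz (fst p))" "ball (snd p) (rc m (snd p))"]
  obtain A' where A': "holo3 A' (UNIV \<times> Bm m p)" "germ_eq y A' (\<lambda>x. A1 x + A x)" "\<forall>y'\<in>Bm m p. jump_germ y' A'"
    using Bm_facts(4-6)[OF p] y by (auto simp: Bm_def simp del: mem_ball)
  define G where "G = (\<lambda>x. Pm m p x + A' x)"
  have "holo3 G (UNIV \<times> Bm m p)" unfolding G_def by (intro holo3_add holo3_Pm p A')
  moreover have "germ_eq y G F"
  proof -
    have "germ_eq y G (\<lambda>x. Pm m p x + (A1 x + A x))" unfolding G_def by (intro germ_eq_add germ_eq_refl A')
    also have "(\<lambda>x. Pm m p x + (A1 x + A x)) = (\<lambda>x. (Pm m p x + A1 x) + A x)" by (simp add: add.assoc)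
    finally have "germ_eq y G (\<lambda>x. (Pm m p x + A1 x) + A x)" .
    moreover have "germ_eq y (\<lambda>x. (Pm m p x + A1 x) + A x) (\<lambda>x. Pm m y x + A x)"
      by (intro germ_eq_add germ_eq_refl germ_eq_sym[OF A1(2)])
    ultimately show ?thesis using A(2) germ_eq_trans germ_eq_sym by meson
  qed
  moreover have "Gm m y' G" if y': "y' \<in> Bm m p" for y'
  proof -
    obtain A2 where A2: "jump_germ y' A2" "germ_eq y' (Pm m p) (\<lambda>x. Pm m y' x + A2 x)" using Pm_compare(2)[OF p y'] by blast
    have "germ_eq y' G (\<lambda>x. (Pm m y' x + A2 x) + A' x)" unfolding G_def by (intro germ_eq_add germ_eq_refl A2)
    also have "(\<lambda>x. (Pm m y' x + A2 x) + A' x) = (\<lambda>x. Pm m y' x + (A2 x + A' x))" by (simp add: add.assoc)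
    finally show ?thesis unfolding Gm_def using jump_germ_add[OF A2(1)] A'(3) y' by blast
  qed
  ultimately show ?thesis by blast
qed

text \<open>The split-off terms z^k (c + k)^(- s) are jump germs at the base point, and the chart at
  - 1 has to be \<open>Phi\<close> because - 1 is not a real number beyond 1.\<close>

lemma base_in_Gm:
  assumes m: "m \<ge> 2"
  shows "Gm m (-1, 1/2) PhiD"
proof -
  let ?y = "(-1, 1/2) :: complex \<times> complex"
  have "is_chart (-1) (rz (-1)) (Pz (-1))" by (rule is_chart_chart) auto
  then have P: "Pz (-1) = Phi"
    unfolding is_chart_def
    by (auto simp: complex_eq_iff)
  define A where "A = (\<lambda>n (x::pt). \<Sum>k<n. fst (snd x) ^ k * exp (- fst x * Ln (snd (snd x) + of_nat k)))"
  have "jump_germ ?y (A n)" for n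
  proof (induction n)
    case 0
    then show ?case by (simp add: A_def jump_germ_zero)
  next
    case (Suc n)
    have "jump_germ ?y (\<lambda>x. fst (snd x) ^ n * exp (- fst x * Ln (snd (snd x) + of_nat n)))"
    proof (rule jump_germ_c[of "{c. 0 < Re c}" ?y "\<lambda>c. Ln (c + of_nat n)" n])
      show "(\<lambda>c. Ln (c + of_nat n)) holomorphic_on {c. 0 < Re c}"
        by (auto intro!: holomorphic_intros simp: complex_nonpos_Reals_iff)
      show "exp (Ln (c + of_nat n)) = c + of_nat n" if "c \<in> {c. 0 < Re c}" for c
      proof -
        have "Re (c + of_nat n) > 0" using that by simp
        then have "c + of_nat n \<noteq> 0" by (metis less_irrefl zero_complex.simps(1))
        then show ?thesis by simp
      qed
    qed (auto simp: open_halfspace_Re_gt)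
    from jump_germ_add[OF Suc this] show ?case by (simp add: A_def)
  qed
  moreover have "germ_eq ?y PhiD (\<lambda>x. Pm m ?y x + A m x)"
  proof (rule germ_eq_openI[of "(- (complex_of_real ` {0..})) \<times> strip"])
    have "- (complex_of_real ` {0..}) = {z. Im z \<noteq> 0 \<or> Re z < 0}"
      by (auto simp: image_iff complex_eq_iff)
    moreover have "open {z. Im z \<noteq> 0 \<or> Re z < 0}"
      by (intro open_Collect_disj open_Collect_neq open_Collect_less continuous_intros)
    ultimately show "open ((- (complex_of_real ` {0..})) \<times> strip)" by (intro open_Times open_strip) simp
    show "?y \<in> (- (complex_of_real ` {0..})) \<times> strip" by (auto simp: complex_eq_iff)
    show "PhiD (s,q) = Pm m ?y (s,q) + A m (s,q)" if "q \<in> (- (complex_of_real ` {0..})) \<times> strip" for s q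
      using PhiD_eq_Fm[OF m, of "(s,q)"] that by (simp add: DD_Times Fm_def Pm_def A_def P)
  qed
  ultimately show ?thesis unfolding Gm_def by blast
qed

text \<open>For any class \<open>G\<close> whose germs extend over the box \<open>B p\<close> and
  stay in the class there. Bolzano's interval argument leaves only short intervals, on which a
  single function on one box provides all germs.\<close>

lemma continue_along:
  fixes h :: "real \<Rightarrow> complex \<times> complex"
  assumes h: "continuous_on {0..1} h" and hQ: "\<And>t. t \<in> {0..1} \<Longrightarrow> h t \<in> Q"
    and B: "\<And>p. p \<in> Q \<Longrightarrow> open (B p)" "\<And>p. p \<in> Q \<Longrightarrow> p \<in> B p"
    and ext: "\<And>p y F. p \<in> Q \<Longrightarrow> y \<in> B p \<Longrightarrow> G y F \<Longrightarrow>
      \<exists>F'. holo3 F' (UNIV \<times> B p) \<and> germ_eq y F' F \<and> (\<forall>y'\<in>B p. G y' F')"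
    and F: "G (h 0) F"
  shows "\<exists>f. germ_eq (h 0) (f 0) F \<and> (\<forall>t\<in>{0..1}. holo3 (f t) (UNIV \<times> B (h t))) \<and>
    (\<forall>t\<in>{0..1}. \<exists>\<delta>>0. \<forall>t'\<in>{0..1}. \<bar>t' - t\<bar> < \<delta> \<longrightarrow> h t' \<in> B (h t) \<and> germ_eq (h t') (f t) (f t'))"
proof -
  define El where "El = (\<lambda>p F. holo3 F (UNIV \<times> B p) \<and> G p F)"
  define comp where "comp = (\<lambda>a b (f :: real \<Rightarrow> pt \<Rightarrow> complex) t. \<exists>\<delta>>0. \<forall>t'\<in>{a..b}. \<bar>t' - t\<bar> < \<delta> \<longrightarrow> h t' \<in> B (h t) \<and> germ_eq (h t') (f t) (f t'))"
  define fam where "fam = (\<lambda>a b f. (\<forall>t\<in>{a..b}. El (h t) (f t) \<and> comp a b f t))"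
  \<comment> \<open>Any starting element is allowed and is kept exactly as \<open>f a\<close>, so
    that a family on [b,c] can start with the element in which the family on [a,b] ends.\<close>
  define P where "P = (\<lambda>a b. 0 \<le> a \<and> b \<le> 1 \<longrightarrow> (\<forall>F. El (h a) F \<longrightarrow> (\<exists>f. f a = F \<and> fam a b f)))"
  have near: "\<exists>d>0. \<forall>t'\<in>{0..1}. \<bar>t' - t\<bar> < d \<longrightarrow> h t' \<in> W" if tW: "t \<in> {0..1}" "open W" "h t \<in> W" for t W
  proof -
    obtain e where e: "e > 0" "ball (h t) e \<subseteq> W" using openE[OF tW(2,3)] .
    obtain d where d: "d > 0" "\<forall>t'\<in>{0..1}. dist t' t < d \<longrightarrow> dist (h t') (h t) < e"
      using h tW(1) e(1) unfolding continuous_on_iff by blast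
    have "h t' \<in> W" if "t' \<in> {0..1}" "\<bar>t' - t\<bar> < d" for t'
      using subsetD[OF e(2), of "h t'"] d(2) that by (simp add: dist_real_def dist_commute)
    then show ?thesis using d(1) by blast
  qed
  have "P 0 1"
  proof (rule Bolzano)
    fix a b c :: real assume ab: "P a b" and bc: "P b c" and le: "a \<le> b" "b \<le> c"
    show "P a c"
      unfolding P_def
    proof (intro impI allI)
      fix F assume r: "0 \<le> a \<and> c \<le> 1" and F: "El (h a) F"
      obtain f where f: "f a = F" "fam a b f" using ab r le F unfolding P_def by force
      have "El (h b) (f b)" using f le by (auto simp: fam_def)
      then obtain f' where f': "f' b = f b" "fam b c f'" using bc r le unfolding P_def by force
      define g where "g = (\<lambda>t. if t \<le> b then f t else f' t)"
      have g1: "g t = f t" if "t \<le> b" for t using that by (simp add: g_def)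
      have g2: "g t = f' t" if "t \<ge> b" for t using that f'(1) by (auto simp: g_def)
      have "comp a c g t" if t: "t \<in> {a..c}" for t
      proof -
        consider "t < b" | "t = b" | "t > b" by linarith
        then show ?thesis
        proof cases
          case 1
          then obtain d where d: "d > 0" "\<forall>t'\<in>{a..b}. \<bar>t' - t\<bar> < d \<longrightarrow> h t' \<in> B (h t) \<and> germ_eq (h t') (f t) (f t')"
            using f(2) t unfolding fam_def comp_def by force
          show ?thesis unfolding comp_def
            by (rule exI[of _ "min d (b - t)"]) (use d 1 t in \<open>auto simp: g1\<close>)
        next
          \<comment> \<open>At the joint both families have the same element, so the two one-sided
            compatibilities concern one function.\<close>
          case 2
          obtain d where d: "d > 0" "\<forall>t'\<in>{a..b}. \<bar>t' - b\<bar> < d \<longrightarrow> h t' \<in> B (h b) \<and> germ_eq (h t') (f b) (f t')"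
            using f(2) le unfolding fam_def comp_def by force
          obtain d' where d': "d' > 0" "\<forall>t'\<in>{b..c}. \<bar>t' - b\<bar> < d' \<longrightarrow> h t' \<in> B (h b) \<and> germ_eq (h t') (f' b) (f' t')"
            using f'(2) le unfolding fam_def comp_def by force
          have "h t' \<in> B (h b) \<and> germ_eq (h t') (g b) (g t')" if "t' \<in> {a..c}" "\<bar>t' - b\<bar> < min d d'" for t'
            using d(2) d'(2) that by (cases "t' \<le> b") (auto simp: g1 g2 f'(1))
          then show ?thesis unfolding comp_def 2 using d d' by (intro exI[of _ "min d d'"]) auto
        next
          case 3
          then obtain d where d: "d > 0" "\<forall>t'\<in>{b..c}. \<bar>t' - t\<bar> < d \<longrightarrow> h t' \<in> B (h t) \<and> germ_eq (h t') (f' t) (f' t')"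
            using f'(2) t unfolding fam_def comp_def by force
          show ?thesis unfolding comp_def
            by (rule exI[of _ "min d (t - b)"]) (use d 3 t in \<open>auto simp: g2\<close>)
        qed
      qed
      moreover have "El (h t) (g t)" if "t \<in> {a..c}" for t
        using f(2) f'(2) that unfolding fam_def by (cases "t \<le> b") (auto simp: g1 g2)
      moreover have "g a = F" using le f(1) by (simp add: g1)
      ultimately show "\<exists>f. f a = F \<and> fam a c f" unfolding fam_def by blast
    qed
  next
    fix x :: real assume x: "0 \<le> x" "x \<le> 1"
    then have hx: "h x \<in> Q" using hQ by simp
    obtain d where d: "d > 0" "\<forall>t'\<in>{0..1}. \<bar>t' - x\<bar> < d \<longrightarrow> h t' \<in> B (h x)"
      using near[of x "B (h x)"] x B hx by auto
    have "P a b" if ab: "a \<le> x" "x \<le> b" "b - a < d" for a b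
      unfolding P_def
    proof (intro impI allI)
      fix F assume r: "0 \<le> a \<and> b \<le> 1" and F: "El (h a) F"
      have mem: "h t \<in> B (h x)" "t \<in> {0..1}" if "t \<in> {a..b}" for t using d(2) ab r that by auto
      obtain F' where F': "germ_eq (h a) F' F" "\<forall>y'\<in>B (h x). G y' F'"
        using ext[OF hx mem(1)[of a]] F ab unfolding El_def by force
      \<comment> \<open>\<open>F'\<close> lives on the box of \<open>h x\<close>; its germ at
        \<open>h t\<close> is extended anew over the box of \<open>h t\<close>, which an element at
        that parameter must have as domain.\<close>
      have "\<exists>f0. El (h t) f0 \<and> germ_eq (h t) f0 F'" if "t \<in> {a..b}" for t
        using ext[of "h t" "h t" F'] F'(2) mem[OF that] hQ[of t] B(2)[of "h t"] unfolding El_def by blast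
      then obtain f0 where f0: "\<And>t. t \<in> {a..b} \<Longrightarrow> El (h t) (f0 t) \<and> germ_eq (h t) (f0 t) F'" by metis
      \<comment> \<open>The value at a is reset to the prescribed \<open>F\<close>, whose germ at
        \<open>h a\<close> agrees with that of \<open>F'\<close>.\<close>
      define f where "f = (\<lambda>t. if t = a then F else f0 t)"
      have f: "El (h t) (f t)" "germ_eq (h t) (f t) F'" if "t \<in> {a..b}" for t
        using f0[OF that] F F'(1) germ_eq_sym by (auto simp: f_def)
      have "comp a b f t" if t: "t \<in> {a..b}" for t
      proof -
        obtain W where W: "open W" "h t \<in> W" "\<forall>y'\<in>W. germ_eq y' (f t) F'" using germ_eq_nearby[OF f(2)[OF t]] by blast
        have "open (W \<inter> B (h t))" "h t \<in> W \<inter> B (h t)" using W B(1)[OF hQ[OF mem(2)[OF t]]] B(2)[OF hQ[OF mem(2)[OF t]]] by (blast intro: open_Int)+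
        from near[OF mem(2)[OF t] this] obtain d where d: "d > 0" "\<forall>t'\<in>{0..1}. \<bar>t' - t\<bar> < d \<longrightarrow> h t' \<in> W \<inter> B (h t)"
          by blast
        have "germ_eq (h t') (f t) (f t')" if "t' \<in> {a..b}" "h t' \<in> W" for t'
          using W(3) that f(2)[OF that(1)] germ_eq_sym germ_eq_trans by meson
        then show ?thesis unfolding comp_def using d mem(2) by (intro exI[of _ d]) auto
      qed
      then show "\<exists>f. f a = F \<and> fam a b f" using f by (intro exI[of _ f]) (auto simp: fam_def f_def)
    qed
    then show "\<exists>d>0. \<forall>a b. a \<le> x \<and> x \<le> b \<and> b - a < d \<longrightarrow> P a b" using d by blast
  qed simp
  moreover obtain F0 where F0: "holo3 F0 (UNIV \<times> B (h 0))" "germ_eq (h 0) F0 F" "G (h 0) F0"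
    using ext[of "h 0" "h 0" F] hQ[of 0] B[of "h 0"] F by auto
  ultimately obtain f where "f 0 = F0" "fam 0 1 f" unfolding P_def El_def by force
  then show ?thesis using F0 by (intro exI[of _ f]) (auto simp: fam_def El_def comp_def)
qed

text \<open>A continuation in the sense of \<open>cont_along\<close> whose elements are entire in s
  on cylinders and whose compatibility holds for all s at once.\<close>

definition tube :: "(real \<Rightarrow> pt \<Rightarrow> complex) \<Rightarrow> (real \<Rightarrow> (complex \<times> complex) set) \<Rightarrow> (real \<Rightarrow> pt) \<Rightarrow> bool" where
  "tube f V g \<longleftrightarrow> (\<forall>t\<in>{0..1}. holo3 (f t) (UNIV \<times> V t) \<and> open (V t) \<and> snd (g t) \<in> V t) \<and>
    (\<forall>t\<in>{0..1}. \<exists>\<delta>>0. \<forall>t'\<in>{0..1}. \<bar>t' - t\<bar> < \<delta> \<longrightarrow> snd (g t') \<in> V t \<and> germ_eq (snd (g t')) (f t) (f t'))"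

lemma tube_exists:
  assumes g: "adm g"
  shows "\<exists>f V. tube f V g \<and> germ_eq (snd x0) (f 0) PhiD"
proof -
  have pg: "continuous_on {0..1} g" "g ` {0..1} \<subseteq> NN" "g 0 = x0"
    using g by (auto simp: adm_def path_def path_image_def pathstart_def)
  have ch: "continuous_on {0..1} (\<lambda>t. snd (g t))" by (intro continuous_intros pg)
  have "compact ((\<lambda>t. Re (snd (snd (g t)))) ` {0..1})"
    by (intro compact_continuous_image continuous_intros pg compact_Icc)
  then have "bounded ((\<lambda>t. Re (snd (snd (g t)))) ` {0..1})" by (rule compact_imp_bounded)
  then obtain M where "\<forall>x\<in>(\<lambda>t. Re (snd (snd (g t)))) ` {0..1}. norm x \<le> M" unfolding bounded_iff by blast
  then have M: "\<bar>Re (snd (snd (g t)))\<bar> \<le> M" if "t \<in> {0..1}" for t using that by simp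
  \<comment> \<open>One shift for the whole path: Re c >= - M along it gives Re c + m > 2. The
    summand 3 also secures m >= 2, which the base point needs.\<close>
  define m where "m = nat \<lceil>M\<rceil> + 3"
  have m: "m \<ge> 2" "real m > M + 2" unfolding m_def by linarith+
  have Q: "snd (g t) \<in> Qm m" if "t \<in> {0..1}" for t
  proof -
    have "g t \<in> NN" using pg that by blast
    moreover have "Re (snd (snd (g t))) + real m > 2" using M[OF that] m by linarith
    ultimately show ?thesis by (auto simp: NN_def Qm_def)
  qed
  have "Gm m (snd (g 0)) PhiD" using base_in_Gm[OF m(1)] pg(3) by (simp add: x0_def)
  from continue_along[where Q = "Qm m" and B = "Bm m" and G = "Gm m", OF ch Q _ _ Gm_extend this]
  obtain f where "germ_eq (snd (g 0)) (f 0) PhiD" "\<forall>t\<in>{0..1}. holo3 (f t) (UNIV \<times> Bm m (snd (g t)))"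
    "\<forall>t\<in>{0..1}. \<exists>\<delta>>0. \<forall>t'\<in>{0..1}. \<bar>t' - t\<bar> < \<delta> \<longrightarrow> snd (g t') \<in> Bm m (snd (g t)) \<and> germ_eq (snd (g t')) (f t) (f t')"
    using Bm_facts(1,2) by blast
  then show ?thesis
    using Bm_facts(1,2)[OF Q] pg(3) by (intro exI[of _ f] exI[of _ "\<lambda>t. Bm m (snd (g t))"]) (simp add: tube_def)
qed

lemma germ_eq_ball: "germ_eq (snd x) F G \<Longrightarrow> \<exists>e>0. \<forall>y\<in>ball x e. F y = G y"
proof -
  assume "germ_eq (snd x) F G"
  then have "\<forall>\<^sub>F q in nhds (snd x). \<forall>s. F (s,q) = G (s,q)" by (simp add: germ_eq_def)
  then have "\<forall>\<^sub>F y in nhds x. \<forall>s. F (s, snd y) = G (s, snd y)"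
    by (rule eventually_compose_filterlim) (intro tendsto_snd filterlim_ident)
  then obtain e where e: "e > 0" "\<forall>y. dist y x < e \<longrightarrow> (\<forall>s. F (s, snd y) = G (s, snd y))"
    unfolding eventually_nhds_metric by blast
  have "F y = G y" if "y \<in> ball x e" for y
    using e(2) that by (metis dist_commute mem_ball prod.collapse)
  then show ?thesis using e by blast
qed

lemma tube_cont_along:
  assumes T: "tube f V g" and st: "germ_eq (snd (g 0)) (f 0) F"
  shows "cont_along F g (f 1 (g 1))"
  unfolding cont_along_def
proof (intro exI[of _ f] exI[of _ "\<lambda>t. UNIV \<times> V t"] conjI ballI)
  show "holo3 (f t) (UNIV \<times> V t)" "g t \<in> UNIV \<times> V t" if "t \<in> {0..1}" for t
    using T that by (auto simp: tube_def mem_Times_iff)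
  show "\<exists>e>0. \<forall>y\<in>ball (g 0) e. f 0 y = F y" using germ_eq_ball[OF st] .
  fix t :: real assume t: "t \<in> {0..1}"
  obtain d where d: "d > 0" "\<forall>t'\<in>{0..1}. \<bar>t' - t\<bar> < d \<longrightarrow> snd (g t') \<in> V t \<and> germ_eq (snd (g t')) (f t) (f t')"
    using T t unfolding tube_def by blast
  have "g t' \<in> UNIV \<times> V t \<and> (\<exists>e>0. \<forall>y\<in>ball (g t') e. y \<in> UNIV \<times> V t \<and> y \<in> UNIV \<times> V t' \<and> f t y = f t' y)"
    if t': "t' \<in> {0..1}" "\<bar>t' - t\<bar> < d" for t'
  proof -
    have m: "snd (g t') \<in> V t" "germ_eq (snd (g t')) (f t) (f t')" "snd (g t') \<in> V t'" "open (V t)" "open (V t')"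
      using d t' T t by (auto simp: tube_def)
    obtain e where e: "e > 0" "\<forall>y\<in>ball (g t') e. f t y = f t' y" using germ_eq_ball[OF m(2)] by blast
    have "open (UNIV \<times> (V t \<inter> V t'))" using m by (intro open_Times open_Int open_UNIV)
    moreover have "g t' \<in> UNIV \<times> (V t \<inter> V t')" using m by (simp add: mem_Times_iff)
    ultimately obtain e' where e': "e' > 0" "ball (g t') e' \<subseteq> UNIV \<times> (V t \<inter> V t')" by (rule openE)
    show ?thesis
    proof (intro conjI exI[of _ "min e e'"] ballI)
      fix y assume "y \<in> ball (g t') (min e e')"
      then have "y \<in> ball (g t') e" "y \<in> ball (g t') e'" by auto
      then show "y \<in> UNIV \<times> V t" "y \<in> UNIV \<times> V t'" "f t y = f t' y" using e(2) e'(2) by auto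
    qed (use e e' m in \<open>auto simp: mem_Times_iff\<close>)
  qed
  then show "\<exists>\<delta>>0. \<forall>t'\<in>{0..1}. \<bar>t' - t\<bar> < \<delta> \<longrightarrow> g t' \<in> UNIV \<times> V t \<and>
     (\<exists>e>0. \<forall>y\<in>ball (g t') e. y \<in> UNIV \<times> V t \<and> y \<in> UNIV \<times> V t' \<and> f t y = f t' y)"
    using d(1) by blast
qed simp

text \<open>Agreement of the germs of \<open>f t\<close> and \<open>f' t\<close> is carried along by
  Bolzano's argument: on a short interval each family is represented by one function on a common
  ball, where the identity theorem applies.\<close>

lemma cont_along_unique:
  assumes g: "path g" and v: "cont_along F g v" and v': "cont_along F g v'"
  shows "v = v'"
proof -
  obtain f U where f: "\<forall>t\<in>{0..1}. holo3 (f t) (U t) \<and> g t \<in> U t"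
    "\<forall>t\<in>{0..1}. \<exists>\<delta>>0. \<forall>t'\<in>{0..1}. \<bar>t' - t\<bar> < \<delta> \<longrightarrow>
         g t' \<in> U t \<and> (\<exists>e>0. \<forall>y\<in>ball (g t') e. y \<in> U t \<and> y \<in> U t' \<and> f t y = f t' y)"
    "\<exists>e>0. \<forall>y\<in>ball (g 0) e. f 0 y = F y" "v = f 1 (g 1)"
    using v unfolding cont_along_def by blast
  obtain f' U' where f': "\<forall>t\<in>{0..1}. holo3 (f' t) (U' t) \<and> g t \<in> U' t"
    "\<forall>t\<in>{0..1}. \<exists>\<delta>>0. \<forall>t'\<in>{0..1}. \<bar>t' - t\<bar> < \<delta> \<longrightarrow>
         g t' \<in> U' t \<and> (\<exists>e>0. \<forall>y\<in>ball (g t') e. y \<in> U' t \<and> y \<in> U' t' \<and> f' t y = f' t' y)"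
    "\<exists>e>0. \<forall>y\<in>ball (g 0) e. f' 0 y = F y" "v' = f' 1 (g 1)"
    using v' unfolding cont_along_def by blast
  define eqv where "eqv = (\<lambda>x (A :: pt \<Rightarrow> complex) B. \<forall>\<^sub>F y in nhds x. A y = B y)"
  have ball_eqv: "eqv x A B" if "\<exists>e>0. \<forall>y\<in>ball x e. A y = B y" for x A B
  proof -
    from that obtain e where "e > 0" "\<forall>y\<in>ball x e. A y = B y" by blast
    then show ?thesis unfolding eqv_def eventually_nhds by (intro exI[of _ "ball x e"]) auto
  qed
  have sy: "eqv x B A" if "eqv x A B" for x A B using that unfolding eqv_def by (rule eventually_mono) simp
  have tr: "eqv x A C" if "eqv x A B" "eqv x B C" for x A B C
    using that unfolding eqv_def by eventually_elim simp
  define P where "P = (\<lambda>a b. 0 \<le> a \<and> b \<le> 1 \<longrightarrow> eqv (g a) (f a) (f' a) \<longrightarrow> eqv (g b) (f b) (f' b))"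
  have "P 0 1"
  proof (rule Bolzano)
    show "P a c" if "P a b" "P b c" "a \<le> b" "b \<le> c" for a b c using that unfolding P_def by auto
  next
    fix x :: real assume x: "0 \<le> x" "x \<le> 1"
    obtain d1 where d1: "d1 > 0" "\<And>t'. t' \<in> {0..1} \<Longrightarrow> \<bar>t' - x\<bar> < d1 \<Longrightarrow> eqv (g t') (f x) (f t')"
      using bspec[OF f(2), of x] x ball_eqv by (metis atLeastAtMost_iff)
    obtain d2 where d2: "d2 > 0" "\<And>t'. t' \<in> {0..1} \<Longrightarrow> \<bar>t' - x\<bar> < d2 \<Longrightarrow> eqv (g t') (f' x) (f' t')"
      using bspec[OF f'(2), of x] x ball_eqv by (metis atLeastAtMost_iff)
    have "open (U x \<inter> U' x)" "g x \<in> U x \<inter> U' x" using bspec[OF f(1), of x] bspec[OF f'(1), of x] x holo3_open by auto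
    then obtain r where r: "r > 0" "ball (g x) r \<subseteq> U x \<inter> U' x" by (rule openE)
    have "continuous_on {0..1} g" using g by (simp add: path_def)
    then obtain d3 where d3: "d3 > 0" "\<And>t'. t' \<in> {0..1} \<Longrightarrow> \<bar>t' - x\<bar> < d3 \<Longrightarrow> g t' \<in> ball (g x) r"
      using x r(1) unfolding continuous_on_iff by (metis atLeastAtMost_iff dist_commute dist_real_def mem_ball)
    have h: "holo3 (\<lambda>y. f x y - f' x y) (ball (g x) r)"
      by (intro holo3_diff; rule holo3_subset[where U = "U x"] holo3_subset[where U = "U' x"])
         (use bspec[OF f(1), of x] bspec[OF f'(1), of x] x r in auto)
    have "P a b" if ab: "a \<le> x" "x \<le> b" "b - a < min d1 (min d2 d3)" for a b
      unfolding P_def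
    proof (intro impI)
      assume r01: "0 \<le> a \<and> b \<le> 1" and e: "eqv (g a) (f a) (f' a)"
      have a: "a \<in> {0..1}" "\<bar>a - x\<bar> < d1" "\<bar>a - x\<bar> < d2" "\<bar>a - x\<bar> < d3" using ab r01 by auto
      have b: "b \<in> {0..1}" "\<bar>b - x\<bar> < d1" "\<bar>b - x\<bar> < d2" "\<bar>b - x\<bar> < d3" using ab r01 by auto
      have "eqv (g a) (f x) (f' x)" using tr[OF tr[OF d1(2)[OF a(1,2)] e] sy[OF d2(2)[OF a(1,3)]]] .
      then have z: "\<forall>\<^sub>F y in nhds (g a). f x y - f' x y = 0" unfolding eqv_def by (rule eventually_mono) simp
      have "f x y = f' x y" if "y \<in> ball (g x) r" for y
        using holo3_zero_convex[OF h convex_ball d3(2)[OF a(1,4)] that z] by simp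
      moreover have "\<forall>\<^sub>F y in nhds (g b). y \<in> ball (g x) r" using d3(2)[OF b(1,4)] by (intro eventually_nhds_in_open open_ball)
      ultimately have "eqv (g b) (f x) (f' x)" unfolding eqv_def by (auto elim!: eventually_mono simp del: mem_ball)
      then show "eqv (g b) (f b) (f' b)" using tr[OF tr[OF sy[OF d1(2)[OF b(1,2)]]] d2(2)[OF b(1,3)]] by blast
    qed
    then show "\<exists>d>0. \<forall>a b. a \<le> x \<and> x \<le> b \<and> b - a < d \<longrightarrow> P a b"
      using d1(1) d2(1) d3(1) by (intro exI[of _ "min d1 (min d2 d3)"]) auto
  qed simp
  moreover have "eqv (g 0) (f 0) (f' 0)" using tr[OF ball_eqv[OF f(3)] sy[OF ball_eqv[OF f'(3)]]] .
  ultimately have "eqv (g 1) (f 1) (f' 1)" by (simp add: P_def)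
  then show ?thesis unfolding eqv_def f(4) f'(4) by (rule eventually_nhds_x_imp_x)
qed

lemma Ztilde_tube:
  assumes "path g" "tube f V g" "germ_eq (snd (g 0)) (f 0) PhiD"
  shows "Ztilde g = f 1 (g 1)"
  unfolding Ztilde_def
  using tube_cont_along[OF assms(2,3)] cont_along_unique[OF assms(1)] by (intro the_equality) blast+

text \<open>The tube of \<open>g\<close>, reparametrised by \<open>ph\<close>, is a tube for
  \<open>k\<close>: the (z,c)-projection of \<open>k\<close> follows that of \<open>g\<close> until
  \<open>ph\<close> reaches 1 and then remains in the last domain. The s-coordinate of
  \<open>k\<close> is free, which is what permits steps in s.\<close>

lemma tube_stay:
  assumes T: "tube f V g" and st: "germ_eq (snd (g 0)) (f 0) PhiD" and k: "path k"
    and ph: "continuous_on {0..1} ph" "ph 0 = 0" "ph 1 = 1" "\<And>t. t \<in> {0..1} \<Longrightarrow> ph t \<in> {0..1}"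
    and eq: "\<And>t. t \<in> {0..1} \<Longrightarrow> ph t < 1 \<Longrightarrow> snd (k t) = snd (g (ph t))"
    and in1: "\<And>t. t \<in> {0..1} \<Longrightarrow> ph t = 1 \<Longrightarrow> snd (k t) \<in> V 1"
  shows "Ztilde k = f 1 (k 1)"
proof -
  have "tube (\<lambda>t. f (ph t)) (\<lambda>t. V (ph t)) k"
    unfolding tube_def
  proof (intro conjI ballI)
    fix t :: real assume t: "t \<in> {0..1}"
    have p: "ph t \<in> {0..1}" using ph(4) t by blast
    show "holo3 (f (ph t)) (UNIV \<times> V (ph t))" "open (V (ph t))" using T p unfolding tube_def by blast+
    show "snd (k t) \<in> V (ph t)"
      using T p eq[OF t] in1[OF t] unfolding tube_def by (cases "ph t = 1") auto
    obtain d where d: "d > 0" "\<forall>t'\<in>{0..1}. \<bar>t' - ph t\<bar> < d \<longrightarrow> snd (g t') \<in> V (ph t) \<and> germ_eq (snd (g t')) (f (ph t)) (f t')"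
      using T p unfolding tube_def by blast
    \<comment> \<open>Before the end of \<open>g\<close> the radius is reduced so that no nearby
      parameter has \<open>ph\<close> equal to 1, where \<open>k\<close> may have left
      \<open>g\<close>.\<close>
    define d' where "d' = (if ph t < 1 then min d (1 - ph t) else d)"
    have d': "d' > 0" "d' \<le> d" using d by (auto simp: d'_def)
    obtain e where e: "e > 0" "\<forall>t'\<in>{0..1}. dist t' t < e \<longrightarrow> dist (ph t') (ph t) < d'"
      using ph(1) t d'(1) unfolding continuous_on_iff by blast
    have "snd (k t') \<in> V (ph t) \<and> germ_eq (snd (k t')) (f (ph t)) (f (ph t'))" if t': "t' \<in> {0..1}" "\<bar>t' - t\<bar> < e" for t'
    proof -
      have q: "ph t' \<in> {0..1}" "\<bar>ph t' - ph t\<bar> < d'" using e t' ph(4) by (auto simp: dist_real_def)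
      show ?thesis
      proof (cases "ph t' < 1")
        case True
        then show ?thesis using d(2) q d' eq[OF t'(1)] by auto
      next
        case False
        then have q1: "ph t' = 1" using q by simp
        then have "ph t = 1" using q(2) p by (auto simp: d'_def split: if_splits)
        then show ?thesis using q1 in1[OF t'(1)] by simp
      qed
    qed
    then show "\<exists>\<delta>>0. \<forall>t'\<in>{0..1}. \<bar>t' - t\<bar> < \<delta> \<longrightarrow> snd (k t') \<in> V (ph t) \<and> germ_eq (snd (k t')) (f (ph t)) (f (ph t'))"
      using e(1) by blast
  qed
  moreover have "germ_eq (snd (k 0)) (f (ph 0)) PhiD" using st eq[of 0] ph(2) by simp
  ultimately have "Ztilde k = (\<lambda>t. f (ph t)) 1 (k 1)" using Ztilde_tube[OF k] by blast
  then show ?thesis by (simp add: ph(3))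
qed

section \<open>The differential-difference equations\<close>

text \<open>The two differential-difference equations at a point. The third equation of the system
  follows from them and is derived only at the end.\<close>

definition rel_at :: "(pt \<Rightarrow> complex) \<Rightarrow> pt \<Rightarrow> bool" where
  "rel_at f x \<longleftrightarrow> Tz f x = f (fst x - 1, snd x) \<and> dc f x = - fst x * f (fst x + 1, snd x)"

definition Rel :: "(pt \<Rightarrow> complex) \<Rightarrow> complex \<times> complex \<Rightarrow> bool" where
  "Rel f y \<longleftrightarrow> (\<forall>\<^sub>F q in nhds y. \<forall>s. rel_at f (s,q))"

lemma rel_at_cong:
  assumes "open W" "\<And>s q. q \<in> W \<Longrightarrow> F (s,q) = G (s,q)" "q \<in> W"
  shows "rel_at F (s,q) \<longleftrightarrow> rel_at G (s,q)"
proof -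
  have "open ((UNIV::complex set) \<times> W)" using assms(1) by (intro open_Times open_UNIV)
  moreover have "F y = G y" if "y \<in> UNIV \<times> W" for y using that assms(2) by (cases y) auto
  moreover have "(s,q) \<in> UNIV \<times> W" using assms(3) by simp
  ultimately have "Tz F (s,q) = Tz G (s,q)" "dc F (s,q) = dc G (s,q)"
    using Tz_cong[of "UNIV \<times> W" F G] deriv_eq_on_open(2)[of "UNIV \<times> W" F G] by blast+
  then show ?thesis using assms(2,3) by (simp add: rel_at_def)
qed

lemma Rel_cong:
  assumes "germ_eq y F G" "Rel G y"
  shows "Rel F y"
proof -
  obtain W where W: "open W" "y \<in> W" "\<forall>q\<in>W. \<forall>s. F (s,q) = G (s,q)"
    using assms(1) unfolding germ_eq_def eventually_nhds by blast
  then have "\<forall>\<^sub>F q in nhds y. q \<in> W" by (intro eventually_nhds_in_open)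
  with assms(2) show ?thesis
    unfolding Rel_def by eventually_elim (use rel_at_cong[of W F G] W in blast)
qed

text \<open>The defects \<open>R1\<close> and \<open>R2\<close> of the two equations are holomorphic
  on the cylinder, so their vanishing near one pair (z,c) spreads by the identity theorem.\<close>

lemma rel_at_convex:
  assumes f: "holo3 f (UNIV \<times> W)" and W: "convex W" "a \<in> W" and R: "Rel f a" and x: "x \<in> UNIV \<times> W"
  shows "rel_at f x"
proof -
  define R1 where "R1 = (\<lambda>x. Tz f x - f (fst x + (- 1), fst (snd x), snd (snd x) + 0))"
  define R2 where "R2 = (\<lambda>x. dc f x - (- fst x) * f (fst x + 1, fst (snd x), snd (snd x) + 0))"
  have o: "open ((UNIV::complex set) \<times> W)" using f holo3_open by blast
  have sh: "holo3 (\<lambda>x. f (fst x + b, fst (snd x), snd (snd x) + 0)) (UNIV \<times> W)" for b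
    by (rule holo3_subset[OF holo3_shift[OF f] o]) auto
  have h: "holo3 R1 (UNIV \<times> W)" "holo3 R2 (UNIV \<times> W)"
    unfolding R1_def R2_def by (intro holo3_intros holo3_Tz holo3_dc sh f o)+
  have "\<forall>\<^sub>F y in nhds (0::complex, a). \<forall>s. rel_at f (s, snd y)"
  proof (rule eventually_compose_filterlim[OF R[unfolded Rel_def]])
    show "filterlim snd (nhds a) (nhds (0::complex, a))"
      using tendsto_snd[OF filterlim_ident[of "nhds (0::complex, a)"]] by simp
  qed
  then have ev: "\<forall>\<^sub>F y in nhds (0, a). R1 y = 0" "\<forall>\<^sub>F y in nhds (0, a). R2 y = 0"
    by (auto elim!: eventually_mono simp: R1_def R2_def rel_at_def)
  have c: "convex ((UNIV::complex set) \<times> W)" using W by (intro convex_Times convex_UNIV)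
  have m: "(0,a) \<in> (UNIV::complex set) \<times> W" using W by simp
  have "R1 x = 0" "R2 x = 0"
    using holo3_zero_convex[OF h(1) c m x ev(1)] holo3_zero_convex[OF h(2) c m x ev(2)] by auto
  then show ?thesis by (simp add: R1_def R2_def rel_at_def eq_neg_iff_add_eq_0)
qed

text \<open>The interval argument again: on a short interval one element represents the whole
  family, and the equations spread over a ball containing the projected path.\<close>

lemma Rel_tube:
  assumes g: "path g" and T: "tube f V g" and R0: "Rel (f 0) (snd (g 0))"
  shows "Rel (f 1) (snd (g 1))"
proof -
  define P where "P = (\<lambda>a b. 0 \<le> a \<and> b \<le> 1 \<longrightarrow> Rel (f a) (snd (g a)) \<longrightarrow> Rel (f b) (snd (g b)))"
  have "P 0 1"
  proof (rule Bolzano)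
    show "P a c" if "P a b" "P b c" "a \<le> b" "b \<le> c" for a b c using that unfolding P_def by auto
  next
    fix x :: real assume x: "0 \<le> x" "x \<le> 1"
    then have xm: "x \<in> {0..1}" by simp
    have V: "holo3 (f x) (UNIV \<times> V x)" "open (V x)" "snd (g x) \<in> V x" using T xm unfolding tube_def by blast+
    obtain d1 where d1: "d1 > 0" "\<And>t'. t' \<in> {0..1} \<Longrightarrow> \<bar>t' - x\<bar> < d1 \<Longrightarrow> germ_eq (snd (g t')) (f x) (f t')"
      using T xm unfolding tube_def by blast
    obtain r where r: "r > 0" "ball (snd (g x)) r \<subseteq> V x" using openE[OF V(2,3)] .
    have "continuous_on {0..1} (\<lambda>t. snd (g t))" using g unfolding path_def by (intro continuous_intros)
    then obtain d2 where d2: "d2 > 0" "\<And>t'. t' \<in> {0..1} \<Longrightarrow> \<bar>t' - x\<bar> < d2 \<Longrightarrow> snd (g t') \<in> ball (snd (g x)) r"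
      using xm r(1) unfolding continuous_on_iff by (metis dist_commute dist_real_def mem_ball)
    have h: "holo3 (f x) (UNIV \<times> ball (snd (g x)) r)"
      by (rule holo3_subset[OF V(1)]) (use r in \<open>auto intro!: open_Times\<close>)
    have "P a b" if ab: "a \<le> x" "x \<le> b" "b - a < min d1 d2" for a b
      unfolding P_def
    proof (intro impI)
      assume r01: "0 \<le> a \<and> b \<le> 1" and e: "Rel (f a) (snd (g a))"
      have a: "a \<in> {0..1}" "\<bar>a - x\<bar> < d1" "\<bar>a - x\<bar> < d2" using ab r01 by auto
      have b: "b \<in> {0..1}" "\<bar>b - x\<bar> < d1" "\<bar>b - x\<bar> < d2" using ab r01 by auto
      have "Rel (f x) (snd (g a))" using Rel_cong[OF d1(2)[OF a(1,2)] e] .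
      then have "rel_at (f x) y" if "y \<in> UNIV \<times> ball (snd (g x)) r" for y
        using rel_at_convex[OF h convex_ball d2(2)[OF a(1,3)]] that by blast
      moreover have "\<forall>\<^sub>F q in nhds (snd (g b)). q \<in> ball (snd (g x)) r"
        using d2(2)[OF b(1,3)] by (intro eventually_nhds_in_open open_ball)
      ultimately have "Rel (f x) (snd (g b))"
        unfolding Rel_def by (auto elim!: eventually_mono simp del: mem_ball)
      then show "Rel (f b) (snd (g b))" using Rel_cong[OF germ_eq_sym[OF d1(2)[OF b(1,2)]]] by blast
    qed
    then show "\<exists>d>0. \<forall>a b. a \<le> x \<and> x \<le> b \<and> b - a < d \<longrightarrow> P a b"
      using d1(1) d2(1) by (intro exI[of _ "min d1 d2"]) auto
  qed simp
  then show ?thesis using R0 by (simp add: P_def)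
qed

section \<open>The equations for the principal branch\<close>

lemma rel_at_DERIV:
  assumes "((\<lambda>w. f (s,w,c)) has_field_derivative a) (at z)" "((\<lambda>w. f (s,z,w)) has_field_derivative b) (at c)"
    and "z * a + c * f (s,z,c) = f (s - 1,z,c)" "b = - s * f (s + 1,z,c)"
  shows "rel_at f (s,z,c)"
  using assms DERIV_imp_deriv[OF assms(1)] DERIV_imp_deriv[OF assms(2)]
  by (simp add: rel_at_def Tz_def dz_def dc_def)

lemma rel_at_add:
  assumes "holo3 f U" "holo3 g U" "x \<in> U" "rel_at f x" "rel_at g x"
  shows "rel_at (\<lambda>x. f x + g x) x"
proof -
  obtain s z c where x: "x = (s,z,c)" by (cases x)
  show ?thesis unfolding x
    by (rule rel_at_DERIV, rule DERIV_add[OF holo3_DERIV(1)[OF assms(1)] holo3_DERIV(1)[OF assms(2)]],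
        use assms x in simp, use assms x in simp,
        rule DERIV_add[OF holo3_DERIV(2)[OF assms(1)] holo3_DERIV(2)[OF assms(2)]])
       (use assms(3-5) in \<open>auto simp: x rel_at_def Tz_def algebra_simps\<close>)
qed

lemma rel_at_diff:
  assumes "holo3 f U" "holo3 g U" "x \<in> U" "rel_at f x" "rel_at g x"
  shows "rel_at (\<lambda>x. f x - g x) x"
proof -
  obtain s z c where x: "x = (s,z,c)" by (cases x)
  show ?thesis unfolding x
    by (rule rel_at_DERIV, rule DERIV_diff[OF holo3_DERIV(1)[OF assms(1)] holo3_DERIV(1)[OF assms(2)]],
        use assms x in simp, use assms x in simp,
        rule DERIV_diff[OF holo3_DERIV(2)[OF assms(1)] holo3_DERIV(2)[OF assms(2)]])
       (use assms(3-5) in \<open>auto simp: x rel_at_def Tz_def algebra_simps\<close>)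
qed

lemma mult_power_pred: "(z::complex) * (of_nat k * z ^ (k - 1)) = of_nat k * z ^ k"
  by (cases k) simp_all

text \<open>Each term of the series satisfies the equations by itself: z d/dz multiplies z^k by k,
  so the operator multiplies the term by c + k, which lowers s by one.\<close>

lemma rel_at_term:
  assumes "0 < Re c"
  shows "rel_at (\<lambda>x. fst (snd x) ^ k * exp (- fst x * Ln (snd (snd x) + of_nat k))) (s,z,c)"
proof -
  have re: "Re (c + of_nat k) > 0" using assms by simp
  then have n: "c + of_nat k \<notin> \<real>\<^sub>\<le>\<^sub>0" by (simp add: complex_nonpos_Reals_iff)
  then have n0: "c + of_nat k \<noteq> 0" by auto
  define E where "E = exp (- s * Ln (c + of_nat k))"
  have E1: "exp (- (s - 1) * Ln (c + of_nat k)) = (c + of_nat k) * E"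
    using n0 by (simp add: E_def exp_diff exp_minus algebra_simps exp_add field_simps)
  have E2: "exp (- (s + 1) * Ln (c + of_nat k)) = E / (c + of_nat k)"
    using n0 by (simp add: E_def exp_diff exp_minus algebra_simps exp_add field_simps)
  show ?thesis
  proof (rule rel_at_DERIV)
    show "((\<lambda>w. fst (snd (s,w,c)) ^ k * exp (- fst (s,w,c) * Ln (snd (snd (s,w,c)) + of_nat k))) has_field_derivative
       (of_nat k * z ^ (k - 1)) * E) (at z)"
      unfolding E_def by (auto intro!: derivative_eq_intros)
    show "((\<lambda>w. fst (snd (s,z,w)) ^ k * exp (- fst (s,z,w) * Ln (snd (snd (s,z,w)) + of_nat k))) has_field_derivative
       - s * (z ^ k * (E / (c + of_nat k)))) (at c)"
      unfolding E_def using n n0 by (auto intro!: derivative_eq_intros simp: field_simps)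
    show "z * (of_nat k * z ^ (k - 1) * E) + c * (fst (snd (s,z,c)) ^ k * exp (- fst (s,z,c) * Ln (snd (snd (s,z,c)) + of_nat k))) =
      fst (snd (s - 1,z,c)) ^ k * exp (- fst (s - 1,z,c) * Ln (snd (snd (s - 1,z,c)) + of_nat k))"
    proof -
      have "z * (of_nat k * z ^ (k - 1) * E) = of_nat k * z ^ k * E" using mult_power_pred[of z k] by (metis mult.assoc)
      then show ?thesis unfolding fst_conv snd_conv E_def[symmetric] E1 by (simp add: algebra_simps)
    qed
    show "- s * (z ^ k * (E / (c + of_nat k))) = - s * (fst (snd (s + 1,z,c)) ^ k * exp (- fst (s + 1,z,c) * Ln (snd (snd (s + 1,z,c)) + of_nat k)))"
      using E2 by simp
  qed
qed

text \<open>The factor z^m contributes m under z d/dz and so turns c into c + m, the parameter at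
  which \<open>Phi\<close> satisfies its own equations.\<close>

lemma rel_at_Phi_shift:
  assumes "z \<in> slit" "2 < Re (c + of_nat m)"
  shows "rel_at (\<lambda>x. fst (snd x) ^ m * Phi (fst x, fst (snd x), snd (snd x) + of_nat m)) (s,z,c)"
proof -
  have mem: "(s, z, c + of_nat m) \<in> UNIV \<times> slit \<times> half2" using assms by simp
  show ?thesis
  proof (rule rel_at_DERIV)
    show "((\<lambda>w. fst (snd (s,w,c)) ^ m * Phi (fst (s,w,c), fst (snd (s,w,c)), snd (snd (s,w,c)) + of_nat m)) has_field_derivative
      z ^ m * dz Phi (s, z, c + of_nat m) + (of_nat m * z ^ (m - 1)) * Phi (s, z, c + of_nat m)) (at z)"
      using holo3_DERIV(1)[OF holo3_Phi mem] by (auto intro!: derivative_eq_intros)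
    have "((\<lambda>w. Phi (s, z, w + of_nat m)) has_field_derivative dc Phi (s, z, c + of_nat m)) (at c)"
      using holo3_DERIV(2)[OF holo3_Phi mem] by (simp add: DERIV_shift)
    then show "((\<lambda>w. fst (snd (s,z,w)) ^ m * Phi (fst (s,z,w), fst (snd (s,z,w)), snd (snd (s,z,w)) + of_nat m)) has_field_derivative
      z ^ m * dc Phi (s, z, c + of_nat m)) (at c)"
      by (auto intro!: DERIV_cmult)
    have T: "z * dz Phi (s, z, c + of_nat m) + (c + of_nat m) * Phi (s, z, c + of_nat m) = Phi (s - 1, z, c + of_nat m)"
      using Tz_Phi[OF mem] by (simp add: Tz_def)
    have "z * (z ^ m * dz Phi (s, z, c + of_nat m) + of_nat m * z ^ (m - 1) * Phi (s, z, c + of_nat m)) =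
      z ^ m * (z * dz Phi (s, z, c + of_nat m)) + (z * (of_nat m * z ^ (m - 1))) * Phi (s, z, c + of_nat m)"
      by (simp only: algebra_simps)
    then show "z * (z ^ m * dz Phi (s, z, c + of_nat m) + of_nat m * z ^ (m - 1) * Phi (s, z, c + of_nat m)) +
      c * (fst (snd (s,z,c)) ^ m * Phi (fst (s,z,c), fst (snd (s,z,c)), snd (snd (s,z,c)) + of_nat m)) =
      fst (snd (s - 1,z,c)) ^ m * Phi (fst (s - 1,z,c), fst (snd (s - 1,z,c)), snd (snd (s - 1,z,c)) + of_nat m)"
      unfolding mult_power_pred by (simp add: algebra_simps flip: T)
    show "z ^ m * dc Phi (s, z, c + of_nat m) =
      - s * (fst (snd (s + 1,z,c)) ^ m * Phi (fst (s + 1,z,c), fst (snd (s + 1,z,c)), snd (snd (s + 1,z,c)) + of_nat m))"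
      using dc_Phi[OF mem] by simp
  qed
qed

lemma Rel_PhiD: "Rel PhiD (snd x0)"
proof -
  let ?W = "slit \<times> strip"
  let ?t = "\<lambda>k x. fst (snd x) ^ k * exp (- fst x * Ln (snd (snd x) + of_nat k))"
  let ?p = "\<lambda>x. fst (snd x) ^ 2 * Phi (fst x, fst (snd x), snd (snd x) + of_nat 2)"
  have o: "open ((UNIV::complex set) \<times> ?W)" by (intro open_Times open_slit open_strip open_UNIV)
  have ht: "holo3 (?t k) (UNIV \<times> ?W)" for k
    by (intro holo3_intros holo3_Ln o) (auto simp: complex_nonpos_Reals_iff)
  have "holo3 (\<lambda>x. Phi (fst x + 0, fst (snd x), snd (snd x) + of_nat 2)) (UNIV \<times> ?W)"
    by (rule holo3_subset[OF holo3_shift[OF holo3_Phi] o]) auto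
  then have hp: "holo3 ?p (UNIV \<times> ?W)" by (intro holo3_intros o) simp
  \<comment> \<open>Two split-off terms, since 2 is the least shift allowed on the strip.\<close>
  have Fm2: "Fm 2 = (\<lambda>x. (?t 0 x + ?t 1 x) + ?p x)"
    by (simp add: Fm_def fun_eq_iff numeral_2_eq_2)
  have r: "rel_at (Fm 2) x" if x: "x \<in> UNIV \<times> ?W" for x
    unfolding Fm2
  proof (rule rel_at_add[OF holo3_add[OF ht ht] hp x])
    obtain s z c where x': "x = (s,z,c)" "z \<in> slit" "0 < Re c" using x by (cases x) auto
    show "rel_at (\<lambda>x. ?t 0 x + ?t 1 x) x"
      by (rule rel_at_add[OF ht ht x]; unfold x'(1); rule rel_at_term[OF x'(3)])
    show "rel_at ?p x" unfolding x'(1) by (rule rel_at_Phi_shift) (use x' in auto)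
  qed
  have y: "snd x0 \<in> {z. Im z \<noteq> 0 \<or> Re z < 0} \<times> strip" by (simp add: x0_def)
  have oW: "open ({z. Im z \<noteq> 0 \<or> Re z < 0} \<times> strip)"
    by (intro open_Times open_strip open_Collect_disj open_Collect_neq open_Collect_less continuous_intros)
  have "germ_eq (snd x0) PhiD (Fm 2)"
    by (rule germ_eq_openI[OF oW y]) (auto intro!: PhiD_eq_Fm simp: DD_def)
  moreover have "Rel (Fm 2) (snd x0)"
    unfolding Rel_def using eventually_nhds_in_open[OF oW y] by (rule eventually_mono) (use r in auto)
  ultimately show ?thesis by (rule Rel_cong)
qed

section \<open>Paths extended by short segments\<close>

definition follows :: "real \<Rightarrow> (real \<Rightarrow> pt) \<Rightarrow> (complex \<times> complex) set \<Rightarrow> (real \<Rightarrow> pt) \<Rightarrow> bool" where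
  "follows N g W k \<longleftrightarrow> N \<ge> 1 \<and> path k \<and>
     (\<forall>t\<in>{0..1}. (N * t < 1 \<longrightarrow> k t = g (N * t)) \<and> (1 \<le> N * t \<longrightarrow> snd (k t) \<in> W))"

lemma followsD:
  assumes "follows N g W k"
  shows "N \<ge> 1" "path k" "t \<in> {0..1} \<Longrightarrow> N * t < 1 \<Longrightarrow> k t = g (N * t)"
    "t \<in> {0..1} \<Longrightarrow> 1 \<le> N * t \<Longrightarrow> snd (k t) \<in> W"
  using assms unfolding follows_def by blast+

lemma follows_self: "path g \<Longrightarrow> snd (g 1) \<in> W \<Longrightarrow> follows 1 g W g"
  unfolding follows_def by (auto dest!: antisym)

lemma follows_start: "follows N g W k \<Longrightarrow> k 0 = g 0"
  unfolding follows_def by force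

lemma follows_end: "follows N g W k \<Longrightarrow> snd (k 1) \<in> W"
  unfolding follows_def by force

text \<open>\<open>ext\<close> runs through \<open>k\<close> at double speed, and the added segment
  has its (z,c)-part in the convex set \<open>W\<close>. Starting from N = 1, one extension gives 2
  and two give 4, which covers the iterated derivatives.\<close>

lemma follows_ext:
  assumes k: "follows N g W k" and W: "convex W" and d: "snd (k 1 + d) \<in> W"
  shows "follows (2 * N) g W (ext k d)"
proof -
  note N = followsD(1)[OF k] and pk = followsD(2)[OF k] and k1 = followsD(3)[OF k] and k2 = followsD(4)[OF k]
  have e: "ext k d t = (if t \<le> 1/2 then k (2 * t) else linepath (k 1) (k 1 + d) (2 * t - 1))" for t
    by (simp add: ext_def joinpaths_def pathfinish_def)
  have "path (ext k d)" unfolding ext_def by (intro path_join_imp pk path_linepath) simp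
  moreover have "ext k d t = g (2 * N * t)" if t: "t \<in> {0..1}" "2 * N * t < 1" for t
  proof -
    have "1 * t \<le> N * t" using N t by (intro mult_right_mono) auto
    then have "t \<le> 1/2" using t by simp
    then show ?thesis using k1[of "2 * t"] t by (simp add: e mult_ac)
  qed
  moreover have "snd (ext k d t) \<in> W" if t: "t \<in> {0..1}" "1 \<le> 2 * N * t" for t
  proof (cases "t \<le> 1/2")
    case True
    then show ?thesis using k2[of "2 * t"] t by (simp add: e mult_ac)
  next
    case False
    have "snd (linepath (k 1) (k 1 + d) (2 * t - 1)) = (1 - (2 * t - 1)) *\<^sub>R snd (k 1) + (2 * t - 1) *\<^sub>R snd (k 1 + d)"
      by (simp add: linepath_def)
    also have "\<dots> \<in> W" by (rule convexD_alt[OF W follows_end[OF k] d]) (use False t in auto)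
    finally show ?thesis using False by (simp add: e)
  qed
  ultimately show ?thesis using N unfolding follows_def by simp
qed

lemma ext_end: "ext k d 1 = k 1 + d"
  by (simp add: ext_def joinpaths_def pathfinish_def linepath_def)

lemma Ztilde_follows:
  assumes T: "tube f V g" "germ_eq (snd (g 0)) (f 0) PhiD" and k: "follows N g W k" and W: "W \<subseteq> V 1"
  shows "Ztilde k = f 1 (k 1)"
proof -
  note N = followsD(1)[OF k] and pk = followsD(2)[OF k] and k1 = followsD(3)[OF k] and k2 = followsD(4)[OF k]
  show ?thesis
  \<comment> \<open>Time along \<open>g\<close> at speed N, stopped at its end.\<close>
  proof (rule tube_stay[OF T pk, where ph = "\<lambda>t. min 1 (N * t)"])
    show "continuous_on {0..1} (\<lambda>t. min 1 (N * t))" by (intro continuous_intros)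
    show "snd (k t) = snd (g (min 1 (N * t)))" if "t \<in> {0..1}" "min 1 (N * t) < 1" for t
      using k1[OF that(1)] that(2) by (simp add: min_def split: if_splits)
    show "snd (k t) \<in> V 1" if "t \<in> {0..1}" "min 1 (N * t) = 1" for t
      using k2[OF that(1)] that(2) W by (auto simp: min_def split: if_splits)
  qed (use N in auto)
qed

text \<open>\<open>tau\<close> takes up the first half of both concatenations, so time is unchanged
  on [0,1/2] and then runs at speed N up to the cap 1.\<close>

lemma Ztilde_join_follows:
  assumes T: "tube f V (tau +++ g)" "germ_eq (snd (tau 0)) (f 0) PhiD" and k: "follows N g W k" and W: "W \<subseteq> V 1"
    and tau: "path tau" "tau 1 = g 0"
  shows "Ztilde (tau +++ k) = f 1 (k 1)"
proof -
  note N = followsD(1)[OF k] and pk = followsD(2)[OF k] and k1 = followsD(3)[OF k] and k2 = followsD(4)[OF k]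
  define ph where "ph = (\<lambda>t. min 1 (t + (N - 1) * max 0 (t - 1/2)))"
  have ph1: "ph t = t" if "t \<le> 1/2" for t using that by (simp add: ph_def)
  have ph2: "ph t = min 1 (1/2 + N * (t - 1/2))" if "1/2 < t" for t using that by (simp add: ph_def algebra_simps)
  have j: "(tau +++ k') t = (if t \<le> 1/2 then tau (2 * t) else k' (2 * t - 1))" for k' :: "real \<Rightarrow> pt" and t
    by (simp add: joinpaths_def)
  have "Ztilde (tau +++ k) = f 1 ((tau +++ k) 1)"
  proof (rule tube_stay[OF T(1), where ph = ph])
    show "germ_eq (snd ((tau +++ g) 0)) (f 0) PhiD" using T(2) by (simp add: j)
    show "path (tau +++ k)"
      using follows_start[OF k] tau by (intro path_join_imp pk) (auto simp: pathstart_def pathfinish_def)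
    show "continuous_on {0..1} ph" unfolding ph_def by (intro continuous_intros)
    show "ph 0 = 0" by (simp add: ph1)
    show "ph 1 = 1" using N by (simp add: ph2)
    show "ph t \<in> {0..1}" if "t \<in> {0..1}" for t using that N by (simp add: ph_def)
    fix t :: real assume t: "t \<in> {0..1}"
    show "snd ((tau +++ k) t) = snd ((tau +++ g) (ph t))" if p: "ph t < 1"
    proof (cases "t \<le> 1/2")
      case True
      then show ?thesis by (simp add: ph1 j)
    next
      case False
      then have e: "ph t = 1/2 + N * (t - 1/2)" using p ph2[of t] by simp
      have pos: "N * (t - 1/2) > 0" using False N by simp
      have a: "N * (2 * t - 1) = 2 * ph t - 1" unfolding e by (simp add: algebra_simps)
      have "k (2 * t - 1) = g (N * (2 * t - 1))" by (rule k1) (use False t p a in auto)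
      then show ?thesis using False pos a by (simp add: j e)
    qed
    show "snd ((tau +++ k) t) \<in> V 1" if p: "ph t = 1"
    proof -
      have f: "1/2 < t" using p ph1[of t] by (cases "t \<le> 1/2") auto
      then have "1 \<le> 1/2 + N * (t - 1/2)" using p ph2[of t] by (simp add: min_def split: if_splits)
      then have "1 \<le> N * (2 * t - 1)" by (simp add: algebra_simps)
      then have "snd (k (2 * t - 1)) \<in> W" by (intro k2) (use f t in auto)
      then show ?thesis using f W by (auto simp: j)
    qed
  qed
  then show ?thesis by (simp add: j)
qed

section \<open>From local function elements to the system on the cover\<close>

lemma DERIV_at_shift:
  "(F has_field_derivative D) (at w) \<Longrightarrow> ((\<lambda>h. F (w + h)) has_field_derivative D) (at (0::complex))"
  using DERIV_shift[of F D 0 w] by (simp add: add.commute)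

text \<open>On paths that end near \<open>g\<close>, \<open>G\<close> is one holomorphic function
  \<open>H\<close> of the end point, so derivatives along extensions are partial derivatives of
  \<open>H\<close>. The third equation comes from differentiating \<open>dc H = - s H(s + 1)\<close>
  in z and using the first equation at s + 1.\<close>

lemma system_at:
  assumes g: "path g" and p: "pathfinish g = (s,z,c)" and W: "open W" "convex W" "(z,c) \<in> W"
    and H: "holo3 H (UNIV \<times> W)" and rel: "\<And>x. x \<in> UNIV \<times> W \<Longrightarrow> rel_at H x"
    and GH: "\<And>N k. follows N g W k \<Longrightarrow> G k = H (k 1)"
  shows "(\<lambda>h. G (ext g (0, h, 0))) field_differentiable (at 0) \<and>
        (\<lambda>h. G (ext g (0, 0, h))) field_differentiable (at 0) \<and>
        (\<lambda>h. Dc G (ext g (0, h, 0))) field_differentiable (at 0) \<and>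
        z * Dz G g + c * G g = G (ext g (-1, 0, 0)) \<and>
        Dc G g = - s * G (ext g (1, 0, 0)) \<and>
        z * Dz (Dc G) g + c * Dc G g = - s * G g"
proof -
  have g1: "g 1 = (s,z,c)" using p by (simp add: pathfinish_def)
  have f0: "follows 1 g W g" by (rule follows_self[OF g]) (use g1 W in simp)
  have G0: "G g = H (s,z,c)" using GH[OF f0] g1 by simp
  have G1: "G (ext g d) = H ((s,z,c) + d)" if "(z,c) + snd d \<in> W" for d
    using GH[OF follows_ext[OF f0 W(2), of d]] that by (simp add: ext_end g1)
  \<comment> \<open>Double extensions occur because \<open>Dz (Dc G)\<close> evaluates
    \<open>Dc G\<close> on paths that are already extended.\<close>
  have G2: "G (ext (ext g d) d') = H ((s,z,c) + d + d')" if "(z,c) + snd d \<in> W" "(z,c) + snd d + snd d' \<in> W" for d d'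
  proof -
    have "follows (2 * 1) g W (ext g d)" by (rule follows_ext[OF f0 W(2)]) (use that g1 in simp)
    from GH[OF follows_ext[OF this W(2), of d']] show ?thesis using that by (simp add: ext_end g1)
  qed
  have op: "open {h. (z + h, c) \<in> W}"
    using open_vimage[OF W(1), of "\<lambda>h. (z + h, c)"] by (simp add: vimage_def continuous_intros)
  have oc: "open {h. (z', c + h) \<in> W}" for z'
    using open_vimage[OF W(1), of "\<lambda>h. (z', c + h)"] by (simp add: vimage_def continuous_intros)
  have mem: "(s',z',c') \<in> UNIV \<times> W" if "(z',c') \<in> W" for s' z' c' using that by simp
  have Dz1: "((\<lambda>h. G (ext g (0, h, 0))) has_field_derivative dz H (s,z,c)) (at 0)"
  proof (rule has_field_derivative_transform_within_open[OF _ op])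
    show "((\<lambda>h. H (s, z + h, c)) has_field_derivative dz H (s,z,c)) (at 0)"
      by (rule DERIV_at_shift[OF holo3_DERIV(1)[OF H mem[OF W(3)]]])
  qed (use W G1 in auto)
  have Dc2: "((\<lambda>h'. G (ext g (0, 0, h'))) has_field_derivative dc H (s,z,c)) (at 0)"
  proof (rule has_field_derivative_transform_within_open[OF _ oc[of z]])
    show "((\<lambda>h. H (s, z, c + h)) has_field_derivative dc H (s,z,c)) (at 0)"
      by (rule DERIV_at_shift[OF holo3_DERIV(2)[OF H mem[OF W(3)]]])
  qed (use W G1 in auto)
  have Dc3: "Dc G (ext g (0, h, 0)) = dc H (s, z + h, c)" if h: "(z + h, c) \<in> W" for h
    unfolding Dc_def
  proof (rule DERIV_imp_deriv, rule has_field_derivative_transform_within_open[OF _ oc[of "z + h"]])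
    show "((\<lambda>h'. H (s, z + h, c + h')) has_field_derivative dc H (s, z + h, c)) (at 0)"
      by (rule DERIV_at_shift[OF holo3_DERIV(2)[OF H mem[OF h]]])
  qed (use h G2 in auto)
  have Dzc: "((\<lambda>h. Dc G (ext g (0, h, 0))) has_field_derivative dz (dc H) (s,z,c)) (at 0)"
  proof (rule has_field_derivative_transform_within_open[OF _ op])
    show "((\<lambda>h. dc H (s, z + h, c)) has_field_derivative dz (dc H) (s,z,c)) (at 0)"
      by (rule DERIV_at_shift[OF holo3_DERIV(1)[OF holo3_dc[OF H] mem[OF W(3)]]])
  qed (use W Dc3 in auto)
  have e1: "Dz G g = dz H (s,z,c)" "Dc G g = dc H (s,z,c)" "Dz (Dc G) g = dz (dc H) (s,z,c)"
    using DERIV_imp_deriv[OF Dz1] DERIV_imp_deriv[OF Dc2] DERIV_imp_deriv[OF Dzc] by (simp_all add: Dz_def Dc_def)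
  have r: "z * dz H (s',z,c) + c * H (s',z,c) = H (s' - 1,z,c)" "dc H (s',z,c) = - s' * H (s' + 1,z,c)" for s'
    using rel[OF mem[OF W(3), of s']] by (simp_all add: rel_at_def Tz_def)
  have "dz (dc H) (s,z,c) = - s * dz H (s + 1,z,c)"
  proof -
    have "((\<lambda>w. dc H (s,w,c)) has_field_derivative - s * dz H (s + 1,z,c)) (at z)"
    proof (rule has_field_derivative_transform_within_open)
      show "((\<lambda>w. - s * H (s + 1,w,c)) has_field_derivative - s * dz H (s + 1,z,c)) (at z)"
        by (rule DERIV_cmult[OF holo3_DERIV(1)[OF H mem[OF W(3)]]])
      show "open {w. (w, c) \<in> W}"
        using open_vimage[OF W(1), of "\<lambda>w. (w, c)"] by (simp add: vimage_def continuous_intros)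
      show "- s * H (s + 1,w,c) = dc H (s,w,c)" if "w \<in> {w. (w, c) \<in> W}" for w
        using rel[OF mem[of w c s]] that by (simp add: rel_at_def)
    qed (use W in simp)
    then show ?thesis by (simp add: dz_def DERIV_imp_deriv)
  qed
  then have "z * dz (dc H) (s,z,c) + c * dc H (s,z,c) = - s * (z * dz H (s + 1,z,c) + c * H (s + 1,z,c))"
    unfolding r(2) by (simp add: algebra_simps)
  also have "\<dots> = - s * H (s,z,c)" unfolding r(1) by simp
  finally have r3: "z * dz (dc H) (s,z,c) + c * dc H (s,z,c) = - s * H (s,z,c)" .
  have "G (ext g (-1, 0, 0)) = H (s - 1, z, c)" "G (ext g (1, 0, 0)) = H (s + 1, z, c)"
    using G1[of "(-1,0,0)"] G1[of "(1,0,0)"] W by simp_all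
  then show ?thesis
    using Dz1 Dc2 Dzc r r3 unfolding e1 G0 field_differentiable_def by auto
qed

lemma satisfies_systemI:
  assumes "\<And>g. adm g \<Longrightarrow> \<exists>W H. open W \<and> convex W \<and> snd (g 1) \<in> W \<and> holo3 H (UNIV \<times> W) \<and>
      (\<forall>x\<in>UNIV \<times> W. rel_at H x) \<and> (\<forall>N k. follows N g W k \<longrightarrow> G k = H (k 1))"
  shows "satisfies_system G"
  unfolding satisfies_system_def
proof (intro allI impI, goal_cases)
  case (1 g)
  obtain s z c where p: "pathfinish g = (s,z,c)" by (cases "pathfinish g")
  obtain W H where W: "open W" "convex W" "snd (g 1) \<in> W" and H: "holo3 H (UNIV \<times> W)" "\<forall>x\<in>UNIV \<times> W. rel_at H x"
    "\<forall>N k. follows N g W k \<longrightarrow> G k = H (k 1)" using assms[OF 1] by blast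
  have "path g" "(z,c) \<in> W" using 1 W(3) p by (simp_all add: adm_def pathfinish_def)
  from system_at[OF this(1) p W(1,2) this(2) H(1)] show ?case
    unfolding p prod.case using H(2,3) by blast
qed

lemma adm_end_tube:
  assumes g: "adm g"
  obtains f V where "tube f V g" "germ_eq (snd (g 0)) (f 0) PhiD" "Rel (f 1) (snd (g 1))"
proof -
  obtain f V where T: "tube f V g" "germ_eq (snd x0) (f 0) PhiD" using tube_exists[OF g] by blast
  have g0: "g 0 = x0" "path g" using g by (auto simp: adm_def pathstart_def)
  have "Rel (f 1) (snd (g 1))"
    by (rule Rel_tube[OF g0(2) T(1)]) (use Rel_cong[OF T(2) Rel_PhiD] g0 in simp)
  then show thesis using that T g0 by simp
qed

lemma tube_end_ball:
  assumes T: "tube f V g" and R: "Rel (f 1) (snd (g 1))"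
  obtains r where "r > 0" "ball (snd (g 1)) r \<subseteq> V 1" "\<forall>x\<in>UNIV \<times> ball (snd (g 1)) r. rel_at (f 1) x"
proof -
  have V: "holo3 (f 1) (UNIV \<times> V 1)" "open (V 1)" "snd (g 1) \<in> V 1" using T unfolding tube_def by auto
  obtain r where r: "r > 0" "ball (snd (g 1)) r \<subseteq> V 1" using openE[OF V(2,3)] .
  have h: "holo3 (f 1) (UNIV \<times> ball (snd (g 1)) r)"
    by (rule holo3_subset[OF V(1)]) (use r in \<open>auto intro!: open_Times\<close>)
  have "rel_at (f 1) x" if "x \<in> UNIV \<times> ball (snd (g 1)) r" for x
    by (rule rel_at_convex[OF h convex_ball _ R that]) (use r in simp)
  then show thesis using that r by blast
qed

theorem theorem4p1:
  shows "satisfies_system Ztilde \<and>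
    (\<forall>tau. path tau \<and> path_image tau \<subseteq> NN \<and> pathstart tau = x0 \<and> pathfinish tau = x0
       \<longrightarrow> satisfies_system (Mono tau Ztilde))"
proof (intro conjI allI impI)
  show "satisfies_system Ztilde"
  proof (rule satisfies_systemI, goal_cases)
    case g: (1 g)
    obtain f V where T: "tube f V g" "germ_eq (snd (g 0)) (f 0) PhiD" "Rel (f 1) (snd (g 1))" using adm_end_tube[OF g] .
    obtain r where r: "r > 0" "ball (snd (g 1)) r \<subseteq> V 1" "\<forall>x\<in>UNIV \<times> ball (snd (g 1)) r. rel_at (f 1) x"
      using tube_end_ball[OF T(1,3)] .
    have "holo3 (f 1) (UNIV \<times> V 1)" using T unfolding tube_def by auto
    then have "holo3 (f 1) (UNIV \<times> ball (snd (g 1)) r)"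
      by (rule holo3_subset) (use r in \<open>auto intro!: open_Times\<close>)
    then show ?case
      using r Ztilde_follows[OF T(1,2) _ r(2)]
      by (intro exI[of _ "ball (snd (g 1)) r"] exI[of _ "f 1"] conjI) auto
  qed
next
  fix tau assume tau: "path tau \<and> path_image tau \<subseteq> NN \<and> pathstart tau = x0 \<and> pathfinish tau = x0"
  show "satisfies_system (Mono tau Ztilde)"
  proof (rule satisfies_systemI, goal_cases)
    case g: (1 g)
    have g1: "(tau +++ g) 1 = g 1" by (simp add: joinpaths_def)
    have g0: "(tau +++ g) 0 = tau 0" "tau 1 = g 0"
      using tau g by (simp_all add: joinpaths_def adm_def pathstart_def pathfinish_def)
    \<comment> \<open>The concatenation is itself admissible and has its own tube, whose last
      element may differ from that of \<open>g\<close> at the same end point.\<close>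
    have tg: "adm (tau +++ g)" using g tau unfolding adm_def by (auto intro: path_join_imp simp: path_image_join)
    obtain f V where T: "tube f V g" "germ_eq (snd (g 0)) (f 0) PhiD" "Rel (f 1) (snd (g 1))" using adm_end_tube[OF g] .
    obtain f' V' where T': "tube f' V' (tau +++ g)" "germ_eq (snd ((tau +++ g) 0)) (f' 0) PhiD" "Rel (f' 1) (snd ((tau +++ g) 1))"
      using adm_end_tube[OF tg] .
    obtain r1 where r1: "r1 > 0" "ball (snd (g 1)) r1 \<subseteq> V 1" "\<forall>x\<in>UNIV \<times> ball (snd (g 1)) r1. rel_at (f 1) x"
      using tube_end_ball[OF T(1,3)] .
    obtain r2 where r2: "r2 > 0" "ball (snd (g 1)) r2 \<subseteq> V' 1" "\<forall>x\<in>UNIV \<times> ball (snd (g 1)) r2. rel_at (f' 1) x"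
      using tube_end_ball[OF T'(1,3)] unfolding g1 .
    \<comment> \<open>One disc inside both last domains, so that the difference of the two last
      elements is defined there and inherits the linear equations.\<close>
    define W where "W = ball (snd (g 1)) (min r1 r2)"
    have W1: "W \<subseteq> ball (snd (g 1)) r1" "W \<subseteq> ball (snd (g 1)) r2" by (auto simp: W_def)
    have W: "W \<subseteq> V 1" "W \<subseteq> V' 1" using W1 r1(2) r2(2) by auto
    have oW: "open ((UNIV::complex set) \<times> W)" unfolding W_def by (intro open_Times open_UNIV open_ball)
    have "holo3 (f 1) (UNIV \<times> V 1)" "holo3 (f' 1) (UNIV \<times> V' 1)" using T T' unfolding tube_def by auto
    then have h: "holo3 (f 1) (UNIV \<times> W)" "holo3 (f' 1) (UNIV \<times> W)"
      using holo3_subset[OF _ oW] W by blast+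
    show ?case
    proof (intro exI[of _ W] exI[of _ "\<lambda>x. f' 1 x - f 1 x"] conjI ballI allI impI)
      show "open W" "convex W" "snd (g 1) \<in> W" using r1 r2 by (auto simp: W_def)
      show "holo3 (\<lambda>x. f' 1 x - f 1 x) (UNIV \<times> W)" by (intro holo3_diff h)
      show "rel_at (\<lambda>x. f' 1 x - f 1 x) x" if x: "x \<in> UNIV \<times> W" for x
        by (rule rel_at_diff[OF h(2,1) x]) (use bspec[OF r1(3), of x] bspec[OF r2(3), of x] W1 x in auto)
      show "Mono tau Ztilde k = f' 1 (k 1) - f 1 (k 1)" if k: "follows N g W k" for N k
        using Ztilde_follows[OF T(1,2) k W(1)] Ztilde_join_follows[OF T'(1) _ k W(2) _ g0(2)] T'(2) tau g0(1)
        by (simp add: Mono_def)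
    qed
  qed
qed

end
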